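(* Let $\mathcal{C}$ be a path category. If $\mathcal{C}$ has weak homotopy $\Pi$-types, then $\mathrm{Hex}(\mathcal{C})$ is locally cartesian closed.
   Context: A path category is a category $\mathcal{C}$ with two classes of maps, fibrations and weak equivalences (maps in both classes are called acyclic fibrations), such that: (1) fibrations are closed under composition; (2) the pullback of a fibration along any map exists and is a fibration; (3) the pullback of an acyclic fibration along any map is an acyclic fibration; (4) 2-out-of-6: if $f:A\to B$, $g:B\to C$, $h:C\to D$ and $gf$, $hg$ are weak equivalences, then so are $f,g,h,hgf$; (5) isomorphisms are acyclic fibrations and every acyclic fibration has a section; (6) every object $B$ has a path object, i.e. a factorisation of the diagonal $B \to B\times B$ as a weak equivalence $r: B \to PB$ followed by a fibration $(s,t): PB \to B \times B$; (7) there is a terminal object $1$ and every map $X \to 1$ is a fibration. For an object $A$, $\mathcal{C}(A)$ is the full subcategory of $\mathcal{C}/A$ on the fibrations with codomain $A$, with fibrations and weak equivalences as in $\mathcal{C}$; it is again a path category. If $p: X \to I$ is a fibration and $f, g: Y \to X$ satisfy $pf = pg$, then $f$ and $g$ are fibrewise homotopic over $I$ if for a path object $(s,t): P_I(X) \to X \times_I X$ of $X$ in $\mathcal{C}(I)$ there is $h: Y \to P_I(X)$ with $sh = f$ and $th = g$ (here $pf=pg$ need not be a fibration). $\mathcal{C}$ has weak homotopy $\Pi$-types if for any two fibrations $f: X\to J$ and $\alpha: J\to I$ there is an object $\Pi_\alpha X$ of $\mathcal{C}(I)$ (a fibration $\Pi_\alpha X\to I$) together with a map $\mathrm{ev}: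 \alpha^*\Pi_\alpha X\to X$ over $J$ such that: for any maps $g: Y\to I$ and $m: \alpha^*Y\to X$ with $m$ over $J$, there is a map $n: Y\to\Pi_\alpha X$ over $I$ such that $m$ and $\mathrm{ev}\circ\alpha^*n: \alpha^*Y\to X$ are fibrewise homotopic over $J$. Here $\alpha^*$ denotes pullback along $\alpha$. A homotopy equivalence relation on $X$ in $\mathcal{C}$ is a fibration $p=(p_1,p_2): R \to X \times X$ such that there exist: $\rho: X \to R$ with $p\rho = \Delta_X$; $\sigma: R \to R$ with $p_1\sigma = p_2$, $p_2\sigma = p_1$; and, for the pullback $R\times_X R$ of $p_2$ and $p_1$ with projections $q_1,q_2$ (so $p_2q_1 = p_1q_2$), a map $\tau: R\times_X R \to R$ with $p_1\tau = p_1q_1$ and $p_2\tau = p_2q_2$. $\mathrm{Hex}(\mathcal{C})$ has as objects the pairs $(X, \rho: R \to X\times X)$ with $\rho$ a homotopy equivalence relation in $\mathcal{C}$. A morphism $(X,\rho:R\to X\times X) \to (Y,\sigma: S\to Y\times Y)$ is an equivalence class of maps $f: X \to Y$ in $\mathcal{C}$ for which there is $\varphi: R \to S$ with $\sigma\varphi = (f\times f)\rho$; two such $f,g$ are identified if there is $H: X \to S$ with $\sigma H = (f,g)$. A category with finite limits is locally cartesian closed if every slice category is cartesian closed. *)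

theory Defs
  imports Main
begin

section \<open>Categories\<close>

text \<open>Nothing is assumed about the operations outside the carriers; the composite
  \<open>g \<cdot>\<^bsub>C\<^esub> f\<close> (first \<open>f\<close>, then \<open>g\<close>) is meaningful only if \<open>Cod C f = Dom C g\<close>.\<close>

record ('o, 'm) cat =
  Obj :: "'o set"
  Arr :: "'m set"
  Dom :: "'m \<Rightarrow> 'o"
  Cod :: "'m \<Rightarrow> 'o"
  Ident :: "'o \<Rightarrow> 'm"
  Comp :: "'m \<Rightarrow> 'm \<Rightarrow> 'm"  (infixr \<open>\<cdot>\<index>\<close> 75)

definition Hom :: "('o, 'm, 'z) cat_scheme \<Rightarrow> 'o \<Rightarrow> 'o \<Rightarrow> 'm set" where
  "Hom C A B = {f \<in> Arr C. Dom C f = A \<and> Cod C f = B}"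

locale category =
  fixes C :: "('o, 'm, 'z) cat_scheme" (structure)
  assumes dom_obj: "f \<in> Arr C \<Longrightarrow> Dom C f \<in> Obj C"
    and cod_obj: "f \<in> Arr C \<Longrightarrow> Cod C f \<in> Obj C"
    and ident_hom: "A \<in> Obj C \<Longrightarrow> Ident C A \<in> Hom C A A"
    and comp_hom: "\<lbrakk>f \<in> Hom C A B; g \<in> Hom C B D\<rbrakk> \<Longrightarrow> g \<cdot> f \<in> Hom C A D"
    and comp_ident: "f \<in> Hom C A B \<Longrightarrow> f \<cdot> Ident C A = f"
    and ident_comp: "f \<in> Hom C A B \<Longrightarrow> Ident C B \<cdot> f = f"
    and comp_assoc: "\<lbrakk>f \<in> Hom C A B; g \<in> Hom C B D; h \<in> Hom C D E\<rbrakk>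
      \<Longrightarrow> (h \<cdot> g) \<cdot> f = h \<cdot> (g \<cdot> f)"

definition iso :: "('o, 'm, 'z) cat_scheme \<Rightarrow> 'm \<Rightarrow> bool" where
  "iso C f \<longleftrightarrow> f \<in> Arr C \<and> (\<exists>g \<in> Hom C (Cod C f) (Dom C f).
     g \<cdot>\<^bsub>C\<^esub> f = Ident C (Dom C f) \<and> f \<cdot>\<^bsub>C\<^esub> g = Ident C (Cod C f))"

definition terminal :: "('o, 'm, 'z) cat_scheme \<Rightarrow> 'o \<Rightarrow> bool" where
  "terminal C T \<longleftrightarrow> T \<in> Obj C \<and> (\<forall>X \<in> Obj C. \<exists>!f. f \<in> Hom C X T)"

definition is_product :: "('o, 'm, 'z) cat_scheme \<Rightarrow> 'o \<Rightarrow> 'o \<Rightarrow> 'm \<Rightarrow> 'm \<Rightarrow> bool" where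
  "is_product C A B p q \<longleftrightarrow>
     p \<in> Hom C (Dom C p) A \<and> q \<in> Hom C (Dom C p) B \<and>
     (\<forall>X. \<forall>f \<in> Hom C X A. \<forall>g \<in> Hom C X B.
        \<exists>!h. h \<in> Hom C X (Dom C p) \<and> p \<cdot>\<^bsub>C\<^esub> h = f \<and> q \<cdot>\<^bsub>C\<^esub> h = g)"

definition is_pullback :: "('o, 'm, 'z) cat_scheme \<Rightarrow> 'm \<Rightarrow> 'm \<Rightarrow> 'm \<Rightarrow> 'm \<Rightarrow> bool" where
  "is_pullback C f g p q \<longleftrightarrow>
     f \<in> Arr C \<and> g \<in> Arr C \<and> Cod C f = Cod C g \<and>
     p \<in> Hom C (Dom C p) (Dom C f) \<and> q \<in> Hom C (Dom C p) (Dom C g) \<and>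
     f \<cdot>\<^bsub>C\<^esub> p = g \<cdot>\<^bsub>C\<^esub> q \<and>
     (\<forall>X. \<forall>a \<in> Hom C X (Dom C f). \<forall>b \<in> Hom C X (Dom C g). f \<cdot>\<^bsub>C\<^esub> a = g \<cdot>\<^bsub>C\<^esub> b \<longrightarrow>
        (\<exists>!h. h \<in> Hom C X (Dom C p) \<and> p \<cdot>\<^bsub>C\<^esub> h = a \<and> q \<cdot>\<^bsub>C\<^esub> h = b))"

text \<open>An arbitrary choice of binary products (meaningful where they exist), giving
  \<open>A \<times> B\<close>, its projections, \<open>(f, g)\<close>, the diagonal and \<open>f \<times> g\<close>.\<close>

definition projs :: "('o, 'm, 'z) cat_scheme \<Rightarrow> 'o \<Rightarrow> 'o \<Rightarrow> 'm \<times> 'm" where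
  "projs C A B = (SOME pq. is_product C A B (fst pq) (snd pq))"

definition pr1 :: "('o, 'm, 'z) cat_scheme \<Rightarrow> 'o \<Rightarrow> 'o \<Rightarrow> 'm" where
  "pr1 C A B = fst (projs C A B)"

definition pr2 :: "('o, 'm, 'z) cat_scheme \<Rightarrow> 'o \<Rightarrow> 'o \<Rightarrow> 'm" where
  "pr2 C A B = snd (projs C A B)"

definition prd :: "('o, 'm, 'z) cat_scheme \<Rightarrow> 'o \<Rightarrow> 'o \<Rightarrow> 'o" where
  "prd C A B = Dom C (pr1 C A B)"

definition pairing :: "('o, 'm, 'z) cat_scheme \<Rightarrow> 'm \<Rightarrow> 'm \<Rightarrow> 'm" where
  "pairing C f g = (THE h. h \<in> Hom C (Dom C f) (prd C (Cod C f) (Cod C g)) \<and>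
     pr1 C (Cod C f) (Cod C g) \<cdot>\<^bsub>C\<^esub> h = f \<and> pr2 C (Cod C f) (Cod C g) \<cdot>\<^bsub>C\<^esub> h = g)"

definition diagonal :: "('o, 'm, 'z) cat_scheme \<Rightarrow> 'o \<Rightarrow> 'm" where
  "diagonal C A = pairing C (Ident C A) (Ident C A)"

definition cross :: "('o, 'm, 'z) cat_scheme \<Rightarrow> 'm \<Rightarrow> 'm \<Rightarrow> 'm" where
  "cross C f g = pairing C (f \<cdot>\<^bsub>C\<^esub> pr1 C (Dom C f) (Dom C g)) (g \<cdot>\<^bsub>C\<^esub> pr2 C (Dom C f) (Dom C g))"


section \<open>Finite limits, slices, local cartesian closure\<close>

definition is_functor ::
  "('j, 'u, 'y) cat_scheme \<Rightarrow> ('o, 'm, 'z) cat_scheme \<Rightarrow> ('j \<Rightarrow> 'o) \<Rightarrow> ('u \<Rightarrow> 'm) \<Rightarrow> bool" where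
  "is_functor J C F\<^sub>o F\<^sub>a \<longleftrightarrow>
     (\<forall>j \<in> Obj J. F\<^sub>o j \<in> Obj C \<and> F\<^sub>a (Ident J j) = Ident C (F\<^sub>o j)) \<and>
     (\<forall>u \<in> Arr J. F\<^sub>a u \<in> Hom C (F\<^sub>o (Dom J u)) (F\<^sub>o (Cod J u))) \<and>
     (\<forall>u \<in> Arr J. \<forall>v \<in> Arr J. Cod J u = Dom J v \<longrightarrow> F\<^sub>a (v \<cdot>\<^bsub>J\<^esub> u) = F\<^sub>a v \<cdot>\<^bsub>C\<^esub> F\<^sub>a u)"

definition is_cone ::
  "('j, 'u, 'y) cat_scheme \<Rightarrow> ('o, 'm, 'z) cat_scheme \<Rightarrow> ('j \<Rightarrow> 'o) \<Rightarrow> ('u \<Rightarrow> 'm) \<Rightarrow>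
    'o \<Rightarrow> ('j \<Rightarrow> 'm) \<Rightarrow> bool" where
  "is_cone J C F\<^sub>o F\<^sub>a L l \<longleftrightarrow>
     L \<in> Obj C \<and> (\<forall>j \<in> Obj J. l j \<in> Hom C L (F\<^sub>o j)) \<and>
     (\<forall>u \<in> Arr J. F\<^sub>a u \<cdot>\<^bsub>C\<^esub> l (Dom J u) = l (Cod J u))"

definition is_limit ::
  "('j, 'u, 'y) cat_scheme \<Rightarrow> ('o, 'm, 'z) cat_scheme \<Rightarrow> ('j \<Rightarrow> 'o) \<Rightarrow> ('u \<Rightarrow> 'm) \<Rightarrow>
    'o \<Rightarrow> ('j \<Rightarrow> 'm) \<Rightarrow> bool" where
  "is_limit J C F\<^sub>o F\<^sub>a L l \<longleftrightarrow>
     is_cone J C F\<^sub>o F\<^sub>a L l \<and>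
     (\<forall>X x. is_cone J C F\<^sub>o F\<^sub>a X x \<longrightarrow>
        (\<exists>!h. h \<in> Hom C X L \<and> (\<forall>j \<in> Obj J. l j \<cdot>\<^bsub>C\<^esub> h = x j)))"

text \<open>Every finite category is isomorphic to one whose objects and arrows are natural numbers,
  so the shapes range over those.\<close>

definition has_finite_limits :: "('o, 'm, 'z) cat_scheme \<Rightarrow> bool" where
  "has_finite_limits C \<longleftrightarrow>
     (\<forall>(J :: (nat, nat) cat) F\<^sub>o F\<^sub>a.
        category J \<and> finite (Obj J) \<and> finite (Arr J) \<and> is_functor J C F\<^sub>o F\<^sub>a \<longrightarrow>
        (\<exists>L l. is_limit J C F\<^sub>o F\<^sub>a L l))"

definition is_exponential ::
  "('o, 'm, 'z) cat_scheme \<Rightarrow> 'o \<Rightarrow> 'o \<Rightarrow> 'o \<Rightarrow> 'm \<Rightarrow> bool" where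
  "is_exponential C A B E ev \<longleftrightarrow>
     E \<in> Obj C \<and> ev \<in> Hom C (prd C E A) B \<and>
     (\<forall>Z \<in> Obj C. \<forall>f \<in> Hom C (prd C Z A) B.
        \<exists>!g. g \<in> Hom C Z E \<and> ev \<cdot>\<^bsub>C\<^esub> cross C g (Ident C A) = f)"

definition cartesian_closed :: "('o, 'm, 'z) cat_scheme \<Rightarrow> bool" where
  "cartesian_closed C \<longleftrightarrow>
     category C \<and>
     (\<exists>T. terminal C T) \<and>
     (\<forall>A \<in> Obj C. \<forall>B \<in> Obj C. \<exists>p q. is_product C A B p q) \<and>
     (\<forall>A \<in> Obj C. \<forall>B \<in> Obj C. \<exists>E ev. is_exponential C A B E ev)"

text \<open>An arrow of the slice from \<open>p\<close> to \<open>q\<close> is a triple \<open>(p, h, q)\<close> with \<open>q \<cdot> h = p\<close>, so that it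
  determines its domain and codomain; \<open>und\<close> is the underlying arrow \<open>h\<close>.\<close>

definition und :: "'m \<times> 'm \<times> 'm \<Rightarrow> 'm" where
  "und x = fst (snd x)"

definition slice :: "('o, 'm, 'z) cat_scheme \<Rightarrow> 'o \<Rightarrow> ('m, 'm \<times> 'm \<times> 'm) cat" where
  "slice C A =
     \<lparr>Obj = {p \<in> Arr C. Cod C p = A},
      Arr = {(p, h, q). p \<in> Arr C \<and> Cod C p = A \<and> q \<in> Arr C \<and> Cod C q = A \<and>
                        h \<in> Hom C (Dom C p) (Dom C q) \<and> q \<cdot>\<^bsub>C\<^esub> h = p},
      Dom = (\<lambda>(p, h, q). p),
      Cod = (\<lambda>(p, h, q). q),
      Ident = (\<lambda>p. (p, Ident C (Dom C p), p)),
      Comp = (\<lambda>(q', k, r) (p, h, q). (p, k \<cdot>\<^bsub>C\<^esub> h, r))\<rparr>"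

definition locally_cartesian_closed :: "('o, 'm, 'z) cat_scheme \<Rightarrow> bool" where
  "locally_cartesian_closed C \<longleftrightarrow>
     category C \<and> has_finite_limits C \<and> (\<forall>A \<in> Obj C. cartesian_closed (slice C A))"


section \<open>Path categories\<close>

record ('o, 'm) fcat = "('o, 'm) cat" +
  Fib :: "'m set"
  Weq :: "'m set"

text \<open>The path object is \<open>Cod C r = Dom C d\<close>; its source and target maps are the components
  of \<open>d = (s, t)\<close>.\<close>

definition path_object :: "('o, 'm, 'z) fcat_scheme \<Rightarrow> 'o \<Rightarrow> 'm \<Rightarrow> 'm \<Rightarrow> bool" where
  "path_object C B r d \<longleftrightarrow>
     r \<in> Weq C \<and> d \<in> Fib C \<and> Dom C r = B \<and> Cod C r = Dom C d \<and> Cod C d = prd C B B \<and>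
     d \<cdot>\<^bsub>C\<^esub> r = diagonal C B"

locale path_category = category C
  for C :: "('o, 'm, 'z) fcat_scheme" (structure) +
  assumes fib_arr: "Fib C \<subseteq> Arr C"
    and weq_arr: "Weq C \<subseteq> Arr C"
    and fib_comp: "\<lbrakk>f \<in> Fib C; g \<in> Fib C; Cod C f = Dom C g\<rbrakk> \<Longrightarrow> g \<cdot> f \<in> Fib C"
    and fib_pullback_exists:
      "\<lbrakk>f \<in> Fib C; g \<in> Arr C; Cod C f = Cod C g\<rbrakk> \<Longrightarrow> \<exists>p q. is_pullback C f g p q"
    and fib_pullback: "\<lbrakk>f \<in> Fib C; is_pullback C f g p q\<rbrakk> \<Longrightarrow> q \<in> Fib C"
    and acyclic_fib_pullback:
      "\<lbrakk>f \<in> Fib C \<inter> Weq C; is_pullback C f g p q\<rbrakk> \<Longrightarrow> q \<in> Fib C \<inter> Weq C"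
    and two_out_of_six:
      "\<lbrakk>f \<in> Hom C A B; g \<in> Hom C B D; h \<in> Hom C D E; g \<cdot> f \<in> Weq C; h \<cdot> g \<in> Weq C\<rbrakk>
        \<Longrightarrow> f \<in> Weq C \<and> g \<in> Weq C \<and> h \<in> Weq C \<and> h \<cdot> (g \<cdot> f) \<in> Weq C"
    and iso_acyclic_fib: "iso C f \<Longrightarrow> f \<in> Fib C \<inter> Weq C"
    and acyclic_fib_section:
      "f \<in> Fib C \<inter> Weq C \<Longrightarrow> \<exists>s \<in> Hom C (Cod C f) (Dom C f). f \<cdot> s = Ident C (Cod C f)"
    and path_object_exists: "B \<in> Obj C \<Longrightarrow> \<exists>r d. path_object C B r d"
    and terminal_fib: "\<exists>T. terminal C T \<and> (\<forall>f \<in> Arr C. Cod C f = T \<longrightarrow> f \<in> Fib C)"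

text \<open>The category \<open>C(A)\<close>: the full subcategory of the slice on the fibrations.\<close>

definition fib_slice :: "('o, 'm, 'z) fcat_scheme \<Rightarrow> 'o \<Rightarrow> ('m, 'm \<times> 'm \<times> 'm) fcat" where
  "fib_slice C A = (let A' = {x \<in> Arr (slice C A). Dom (slice C A) x \<in> Fib C \<and> Cod (slice C A) x \<in> Fib C} in
     \<lparr>Obj = {p \<in> Fib C. Cod C p = A},
      Arr = A',
      Dom = Dom (slice C A),
      Cod = Cod (slice C A),
      Ident = Ident (slice C A),
      Comp = Comp (slice C A),
      Fib = {x \<in> A'. und x \<in> Fib C},
      Weq = {x \<in> A'. und x \<in> Weq C}\<rparr>)"

text \<open>Products in \<open>C(I)\<close> are fibre products over \<open>I\<close>, so a path object of \<open>p : X \<rightarrow> I\<close> in \<open>C(I)\<close>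
  is a fibration \<open>P\<^sub>I(X) \<rightarrow> X \<times>\<^sub>I X\<close> over \<open>I\<close>.\<close>

definition fibrewise_homotopic :: "('o, 'm, 'z) fcat_scheme \<Rightarrow> 'm \<Rightarrow> 'm \<Rightarrow> 'm \<Rightarrow> bool" where
  "fibrewise_homotopic C p f g \<longleftrightarrow>
     p \<in> Fib C \<and> f \<in> Hom C (Dom C f) (Dom C p) \<and> g \<in> Hom C (Dom C f) (Dom C p) \<and>
     p \<cdot>\<^bsub>C\<^esub> f = p \<cdot>\<^bsub>C\<^esub> g \<and>
     (\<exists>r d. let D = fib_slice C (Cod C p);
                s = pr1 D p p \<cdot>\<^bsub>D\<^esub> d;
                t = pr2 D p p \<cdot>\<^bsub>D\<^esub> d
            in path_object D p r d \<and>
               (\<exists>h \<in> Hom C (Dom C f) (Dom C (und d)). und s \<cdot>\<^bsub>C\<^esub> h = f \<and> und t \<cdot>\<^bsub>C\<^esub> h = g))"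

text \<open>Here \<open>\<pi> : \<Pi>\<^sub>\<alpha>X \<rightarrow> I\<close>, the squares \<open>(a, b)\<close> and \<open>(a', b')\<close> exhibit \<open>\<alpha>\<^sup>*\<Pi>\<^sub>\<alpha>X\<close> and \<open>\<alpha>\<^sup>*Y\<close>
  with their maps to \<open>J\<close>, and \<open>k\<close> is \<open>\<alpha>\<^sup>*n\<close>.\<close>

definition weak_homotopy_Pi_types :: "('o, 'm, 'z) fcat_scheme \<Rightarrow> bool" where
  "weak_homotopy_Pi_types C \<longleftrightarrow>
     (\<forall>f \<in> Fib C. \<forall>\<alpha> \<in> Fib C. Cod C f = Dom C \<alpha> \<longrightarrow>
        (\<exists>\<pi> \<in> Fib C. Cod C \<pi> = Cod C \<alpha> \<and>
          (\<exists>a b ev. is_pullback C \<alpha> \<pi> a b \<and>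
             ev \<in> Hom C (Dom C a) (Dom C f) \<and> f \<cdot>\<^bsub>C\<^esub> ev = a \<and>
             (\<forall>g a' b' m. is_pullback C \<alpha> g a' b' \<and>
                m \<in> Hom C (Dom C a') (Dom C f) \<and> f \<cdot>\<^bsub>C\<^esub> m = a' \<longrightarrow>
                (\<exists>n \<in> Hom C (Dom C g) (Dom C \<pi>). \<pi> \<cdot>\<^bsub>C\<^esub> n = g \<and>
                   (\<exists>k \<in> Hom C (Dom C a') (Dom C a).
                      a \<cdot>\<^bsub>C\<^esub> k = a' \<and> b \<cdot>\<^bsub>C\<^esub> k = n \<cdot>\<^bsub>C\<^esub> b' \<and>
                      fibrewise_homotopic C f m (ev \<cdot>\<^bsub>C\<^esub> k)))))))"


section \<open>The homotopy exact completion\<close>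

definition heq_rel :: "('o, 'm, 'z) fcat_scheme \<Rightarrow> 'o \<Rightarrow> 'm \<Rightarrow> bool" where
  "heq_rel C X p \<longleftrightarrow>
     p \<in> Fib C \<and> Cod C p = prd C X X \<and>
     (let R = Dom C p; p\<^sub>1 = pr1 C X X \<cdot>\<^bsub>C\<^esub> p; p\<^sub>2 = pr2 C X X \<cdot>\<^bsub>C\<^esub> p in
       (\<exists>\<rho> \<in> Hom C X R. p \<cdot>\<^bsub>C\<^esub> \<rho> = diagonal C X) \<and>
       (\<exists>\<sigma> \<in> Hom C R R. p\<^sub>1 \<cdot>\<^bsub>C\<^esub> \<sigma> = p\<^sub>2 \<and> p\<^sub>2 \<cdot>\<^bsub>C\<^esub> \<sigma> = p\<^sub>1) \<and>
       (\<exists>q\<^sub>1 q\<^sub>2. is_pullback C p\<^sub>2 p\<^sub>1 q\<^sub>1 q\<^sub>2 \<and>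
          (\<exists>\<tau> \<in> Hom C (Dom C q\<^sub>1) R. p\<^sub>1 \<cdot>\<^bsub>C\<^esub> \<tau> = p\<^sub>1 \<cdot>\<^bsub>C\<^esub> q\<^sub>1 \<and> p\<^sub>2 \<cdot>\<^bsub>C\<^esub> \<tau> = p\<^sub>2 \<cdot>\<^bsub>C\<^esub> q\<^sub>2)))"

definition hex_maps :: "('o, 'm, 'z) fcat_scheme \<Rightarrow> 'o \<times> 'm \<Rightarrow> 'o \<times> 'm \<Rightarrow> 'm set" where
  "hex_maps C = (\<lambda>(X, \<rho>) (Y, \<sigma>).
     {f \<in> Hom C X Y. \<exists>\<phi> \<in> Hom C (Dom C \<rho>) (Dom C \<sigma>). \<sigma> \<cdot>\<^bsub>C\<^esub> \<phi> = cross C f f \<cdot>\<^bsub>C\<^esub> \<rho>})"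

definition hex_rel :: "('o, 'm, 'z) fcat_scheme \<Rightarrow> 'o \<times> 'm \<Rightarrow> 'o \<times> 'm \<Rightarrow> ('m \<times> 'm) set" where
  "hex_rel C = (\<lambda>(X, \<rho>) (Y, \<sigma>).
     {(f, g). f \<in> hex_maps C (X, \<rho>) (Y, \<sigma>) \<and> g \<in> hex_maps C (X, \<rho>) (Y, \<sigma>) \<and>
              (\<exists>H \<in> Hom C X (Dom C \<sigma>). \<sigma> \<cdot>\<^bsub>C\<^esub> H = pairing C f g)})"

text \<open>A morphism is a triple consisting of its domain, its codomain and an equivalence class.\<close>

definition Hex :: "('o, 'm, 'z) fcat_scheme \<Rightarrow>
    ('o \<times> 'm, ('o \<times> 'm) \<times> ('o \<times> 'm) \<times> 'm set) cat" where
  "Hex C = (let H = {(X, \<rho>). X \<in> Obj C \<and> heq_rel C X \<rho>} in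
     \<lparr>Obj = H,
      Arr = {(A, B, F). A \<in> H \<and> B \<in> H \<and> F \<in> hex_maps C A B // hex_rel C A B},
      Dom = (\<lambda>(A, B, F). A),
      Cod = (\<lambda>(A, B, F). B),
      Ident = (\<lambda>A. (A, A, hex_rel C A A `` {Ident C (fst A)})),
      Comp = (\<lambda>(B', D, G) (A, B, F). (A, D, hex_rel C A D `` {g \<cdot>\<^bsub>C\<^esub> f | g f. g \<in> G \<and> f \<in> F}))\<rparr>)"

end

theory Submission
  imports Defs
begin

text \<open>A homotopy equivalence relation on \<open>X\<close> is the same as a stable family of equivalence relations on the
  generalized elements \<open>Z \<rightarrow> X\<close> that is represented by a fibration over \<open>X \<times> X\<close>, so objects of \<open>Hex C\<close> can be
  treated as setoids. Predicates represented by fibrations are closed under substitution and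
  conjunction, and weak \<open>\<Pi>\<close>-types give universal quantification along fibrations. The exponential of
  \<open>q : B \<rightarrow> T\<close> by \<open>p : A \<rightarrow> T\<close> consists of the elements of a weak \<open>\<Pi>\<close>-type, the functions on
  \<open>{x | p x \<sim> i}\<close>, that respect the relations, modulo pointwise equivalence.
  Homotopy enters only once: if \<open>u \<cdot> w\<close> lifts through a fibration and \<open>w\<close> is a weak equivalence, then \<open>u\<close>
  lifts too, so fibrewise homotopic maps are identified by every homotopy equivalence relation,
  and the \<open>\<beta>\<close>-law of the weak \<open>\<Pi>\<close>-type becomes an equation in \<open>Hex C\<close>.\<close>

section \<open>Categories\<close>

text \<open>Two gaps shape the proof. First, a map \<open>p : A \<rightarrow> T\<close> of
  \<open>Hex C\<close> is represented by an arbitrary map of C, and diagrams commute only up to the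
  relation of \<open>T\<close>, whereas weak Pi-types are available along fibrations. The fibre {x |
  p x ~ i} mends both: these fibres form a fibration over \<open>T\<close>, and an element over i
  can be moved to any i' ~ i without changing x. Second, a weak Pi-type provides transposes without
  uniqueness. The quotient supplies it: functions are compared by their values at equivalent
  arguments, and a transpose has its values prescribed. This comparison is a partial equivalence
  relation that is reflexive exactly at the functions respecting the relations, so one formula
  yields both the carrier and the relation of the exponential. To count as a relation of
  \<open>Hex C\<close> it must be represented by a fibration; this is the second use of weak
  Pi-types, now as a universal quantifier on predicates.\<close>

lemma ex1_cong: "(\<And>x. P x \<longleftrightarrow> Q x) \<Longrightarrow> (\<exists>!x. P x) \<longleftrightarrow> (\<exists>!x. Q x)"
  by simp

lemma ex1_image: "\<exists>!n. P n \<Longrightarrow> \<exists>!x. \<exists>n. x = (a, n, b) \<and> P n"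
  by blast

context category
begin

lemma comp_arr [simp]:
  assumes "f \<in> Arr C" "g \<in> Arr C" "Cod C f = Dom C g"
  shows "g \<cdot> f \<in> Arr C" "Dom C (g \<cdot> f) = Dom C f" "Cod C (g \<cdot> f) = Cod C g"
  using comp_hom[of f "Dom C f" "Cod C f" g "Cod C g"] assms by (auto simp: Hom_def)

lemma assoc [simp]:
  assumes "f \<in> Arr C" "g \<in> Arr C" "h \<in> Arr C" "Cod C f = Dom C g" "Cod C g = Dom C h"
  shows "(h \<cdot> g) \<cdot> f = h \<cdot> (g \<cdot> f)"
  using comp_assoc[of f "Dom C f" "Cod C f" g "Cod C g" h "Cod C h"] assms by (auto simp: Hom_def)

lemma ident_arr [simp]:
  assumes "A \<in> Obj C"
  shows "Ident C A \<in> Arr C" "Dom C (Ident C A) = A" "Cod C (Ident C A) = A"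
  using ident_hom[OF assms] by (auto simp: Hom_def)

lemma ident_right [simp]: "\<lbrakk>f \<in> Arr C; Dom C f = A\<rbrakk> \<Longrightarrow> f \<cdot> Ident C A = f"
  using comp_ident[of f A "Cod C f"] by (auto simp: Hom_def)

lemma ident_left [simp]: "\<lbrakk>f \<in> Arr C; Cod C f = A\<rbrakk> \<Longrightarrow> Ident C A \<cdot> f = f"
  using ident_comp[of f "Dom C f" A] by (auto simp: Hom_def)

declare dom_obj [simp] cod_obj [simp]

text \<open>\<open>assoc\<close> is a simp rule that brackets to the right, so the left side of a
  known equation between composites is no longer visible once an arrow \<open>u\<close> is composed
  on the right. This lemma and \<open>rewrite_tail1\<close> restate such an equation in the form in
  which simp meets it.\<close>

lemma rewrite_tail:
  assumes "g \<cdot> f = k \<cdot> l" "f \<in> Arr C" "g \<in> Arr C" "k \<in> Arr C" "l \<in> Arr C" "u \<in> Arr C"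
    "Cod C f = Dom C g" "Cod C l = Dom C k" "Cod C u = Dom C f" "Dom C l = Dom C f"
  shows "g \<cdot> (f \<cdot> u) = k \<cdot> (l \<cdot> u)"
  using assms assoc[of u f g] assoc[of u l k] by simp

lemma rewrite_tail1:
  assumes "g \<cdot> f = k" "f \<in> Arr C" "g \<in> Arr C" "u \<in> Arr C"
    "Cod C f = Dom C g" "Cod C u = Dom C f"
  shows "g \<cdot> (f \<cdot> u) = k \<cdot> u"
  using assms assoc[of u f g] by simp

lemma iso_ident: "A \<in> Obj C \<Longrightarrow> iso C (Ident C A)"
  unfolding iso_def by (auto simp: Hom_def intro!: bexI[of _ "Ident C A"])

section \<open>Terminal objects, products and pullbacks\<close>

lemma terminal_arrow:
  assumes "terminal C T" "X \<in> Obj C"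
  obtains t where "t \<in> Arr C" "Dom C t = X" "Cod C t = T"
  using assms unfolding terminal_def Hom_def by blast

lemma terminal_eq:
  assumes "terminal C T" "f \<in> Arr C" "g \<in> Arr C" "Dom C f = Dom C g" "Cod C f = T" "Cod C g = T"
  shows "f = g"
proof -
  have "\<exists>!h. h \<in> Hom C (Dom C f) T" using assms unfolding terminal_def by auto
  then show ?thesis using assms by (auto simp: Hom_def)
qed

lemma productD:
  assumes "is_product C A B p q"
  shows "p \<in> Arr C" "q \<in> Arr C" "Cod C p = A" "Cod C q = B" "Dom C q = Dom C p"
  using assms unfolding is_product_def Hom_def by auto

lemma product_pair:
  assumes "is_product C A B p q" "f \<in> Arr C" "g \<in> Arr C" "Dom C f = Dom C g" "Cod C f = A" "Cod C g = B"
  obtains h where "h \<in> Arr C" "Dom C h = Dom C f" "Cod C h = Dom C p" "p \<cdot> h = f" "q \<cdot> h = g"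
proof -
  have "\<exists>!h. h \<in> Hom C (Dom C f) (Dom C p) \<and> p \<cdot> h = f \<and> q \<cdot> h = g"
  proof -
    have "f \<in> Hom C (Dom C f) A" "g \<in> Hom C (Dom C f) B" using assms by (auto simp: Hom_def)
    then show ?thesis using assms(1) unfolding is_product_def by blast
  qed
  then obtain h where "h \<in> Hom C (Dom C f) (Dom C p) \<and> p \<cdot> h = f \<and> q \<cdot> h = g" by blast
  then show ?thesis by (intro that[of h]) (auto simp: Hom_def)
qed

lemma product_eq:
  assumes "is_product C A B p q" "h \<in> Arr C" "k \<in> Arr C" "Dom C h = Dom C k"
    "Cod C h = Dom C p" "Cod C k = Dom C p" "p \<cdot> h = p \<cdot> k" "q \<cdot> h = q \<cdot> k"
  shows "h = k"
proof -
  have "\<exists>!l. l \<in> Hom C (Dom C h) (Dom C p) \<and> p \<cdot> l = p \<cdot> h \<and> q \<cdot> l = q \<cdot> h"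
  proof -
    have "p \<cdot> h \<in> Hom C (Dom C h) A" "q \<cdot> h \<in> Hom C (Dom C h) B"
      using assms(2,5) productD[OF assms(1)] by (auto simp: Hom_def)
    then show ?thesis using assms(1) unfolding is_product_def by blast
  qed
  then show ?thesis using assms by (auto simp: Hom_def)
qed

lemma productI:
  assumes "p \<in> Arr C" "q \<in> Arr C" "Cod C p = A" "Cod C q = B" "Dom C q = Dom C p"
    and "\<And>f g. \<lbrakk>f \<in> Arr C; g \<in> Arr C; Dom C f = Dom C g; Cod C f = A; Cod C g = B\<rbrakk> \<Longrightarrow>
      \<exists>h. h \<in> Arr C \<and> Dom C h = Dom C f \<and> Cod C h = Dom C p \<and> p \<cdot> h = f \<and> q \<cdot> h = g"
    and "\<And>h k. \<lbrakk>h \<in> Arr C; k \<in> Arr C; Dom C h = Dom C k; Cod C h = Dom C p; Cod C k = Dom C p;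
      p \<cdot> h = p \<cdot> k; q \<cdot> h = q \<cdot> k\<rbrakk> \<Longrightarrow> h = k"
  shows "is_product C A B p q"
  unfolding is_product_def
proof (intro conjI allI ballI)
  fix X f g assume fg: "f \<in> Hom C X A" "g \<in> Hom C X B"
  then obtain h where "h \<in> Arr C \<and> Dom C h = Dom C f \<and> Cod C h = Dom C p \<and> p \<cdot> h = f \<and> q \<cdot> h = g"
    using assms(6)[of f g] by (auto simp: Hom_def)
  then show "\<exists>!h. h \<in> Hom C X (Dom C p) \<and> p \<cdot> h = f \<and> q \<cdot> h = g"
    using fg by (intro ex1I[of _ h]) (auto simp: Hom_def intro!: assms(7))
qed (use assms in \<open>auto simp: Hom_def\<close>)

lemma pullbackD:
  assumes "is_pullback C f g p q"
  shows "f \<in> Arr C" "g \<in> Arr C" "p \<in> Arr C" "q \<in> Arr C" "Cod C f = Cod C g"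
    "Cod C p = Dom C f" "Cod C q = Dom C g" "Dom C q = Dom C p" "f \<cdot> p = g \<cdot> q"
  using assms unfolding is_pullback_def Hom_def by auto

lemma pullback_pair:
  assumes "is_pullback C f g p q" "a \<in> Arr C" "b \<in> Arr C" "Dom C a = Dom C b" "Cod C a = Dom C f"
    "Cod C b = Dom C g" "f \<cdot> a = g \<cdot> b"
  obtains h where "h \<in> Arr C" "Dom C h = Dom C a" "Cod C h = Dom C p" "p \<cdot> h = a" "q \<cdot> h = b"
proof -
  have "\<exists>!h. h \<in> Hom C (Dom C a) (Dom C p) \<and> p \<cdot> h = a \<and> q \<cdot> h = b"
  proof -
    have "a \<in> Hom C (Dom C a) (Dom C f)" "b \<in> Hom C (Dom C a) (Dom C g)" using assms by (auto simp: Hom_def)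
    then show ?thesis using assms(1,7) unfolding is_pullback_def by blast
  qed
  then obtain h where "h \<in> Hom C (Dom C a) (Dom C p) \<and> p \<cdot> h = a \<and> q \<cdot> h = b" by blast
  then show ?thesis by (intro that[of h]) (auto simp: Hom_def)
qed

lemma pullback_eq:
  assumes "is_pullback C f g p q" "h \<in> Arr C" "k \<in> Arr C" "Dom C h = Dom C k"
    "Cod C h = Dom C p" "Cod C k = Dom C p" "p \<cdot> h = p \<cdot> k" "q \<cdot> h = q \<cdot> k"
  shows "h = k"
proof -
  note D = pullbackD[OF assms(1)]
  have "f \<cdot> (p \<cdot> h) = g \<cdot> (q \<cdot> h)"
    by (rule rewrite_tail[OF D(9)]) (use D assms in auto)
  then have "\<exists>!l. l \<in> Hom C (Dom C h) (Dom C p) \<and> p \<cdot> l = p \<cdot> h \<and> q \<cdot> l = q \<cdot> h"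
  proof -
    have "p \<cdot> h \<in> Hom C (Dom C h) (Dom C f)" "q \<cdot> h \<in> Hom C (Dom C h) (Dom C g)"
      using assms(2,5) D by (auto simp: Hom_def)
    then show ?thesis using assms(1) \<open>f \<cdot> (p \<cdot> h) = g \<cdot> (q \<cdot> h)\<close>
      unfolding is_pullback_def by blast
  qed
  then show ?thesis using assms by (auto simp: Hom_def)
qed

lemma pullbackI:
  assumes "f \<in> Arr C" "g \<in> Arr C" "p \<in> Arr C" "q \<in> Arr C" "Cod C f = Cod C g"
    "Cod C p = Dom C f" "Cod C q = Dom C g" "Dom C q = Dom C p" "f \<cdot> p = g \<cdot> q"
    and "\<And>a b. \<lbrakk>a \<in> Arr C; b \<in> Arr C; Dom C a = Dom C b; Cod C a = Dom C f; Cod C b = Dom C g; f \<cdot> a = g \<cdot> b\<rbrakk> \<Longrightarrow>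
      \<exists>h. h \<in> Arr C \<and> Dom C h = Dom C a \<and> Cod C h = Dom C p \<and> p \<cdot> h = a \<and> q \<cdot> h = b"
    and "\<And>h k. \<lbrakk>h \<in> Arr C; k \<in> Arr C; Dom C h = Dom C k; Cod C h = Dom C p; Cod C k = Dom C p;
      p \<cdot> h = p \<cdot> k; q \<cdot> h = q \<cdot> k\<rbrakk> \<Longrightarrow> h = k"
  shows "is_pullback C f g p q"
  unfolding is_pullback_def
proof (intro conjI allI ballI impI)
  fix X a b assume ab: "a \<in> Hom C X (Dom C f)" "b \<in> Hom C X (Dom C g)" "f \<cdot> a = g \<cdot> b"
  then obtain h where "h \<in> Arr C \<and> Dom C h = Dom C a \<and> Cod C h = Dom C p \<and> p \<cdot> h = a \<and> q \<cdot> h = b"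
    using assms(10)[of a b] by (auto simp: Hom_def)
  then show "\<exists>!h. h \<in> Hom C X (Dom C p) \<and> p \<cdot> h = a \<and> q \<cdot> h = b"
    using ab by (intro ex1I[of _ h]) (auto simp: Hom_def intro!: assms(11))
qed (use assms in \<open>auto simp: Hom_def\<close>)

lemma pullback_sym: "is_pullback C f g p q \<Longrightarrow> is_pullback C g f q p"
proof -
  assume pb: "is_pullback C f g p q"
  note D = pullbackD[OF pb]
  show ?thesis
  proof (rule pullbackI)
    fix a b assume ab: "a \<in> Arr C" "b \<in> Arr C" "Dom C a = Dom C b" "Cod C a = Dom C g"
      "Cod C b = Dom C f" "g \<cdot> a = f \<cdot> b"
    show "\<exists>h. h \<in> Arr C \<and> Dom C h = Dom C a \<and> Cod C h = Dom C q \<and> q \<cdot> h = a \<and> p \<cdot> h = b"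
      using pullback_pair[OF pb ab(2,1) ab(3)[symmetric] ab(5,4) ab(6)[symmetric]] D(8) ab(3) by metis
  next
    fix h k assume "h \<in> Arr C" "k \<in> Arr C" "Dom C h = Dom C k" "Cod C h = Dom C q" "Cod C k = Dom C q"
      "q \<cdot> h = q \<cdot> k" "p \<cdot> h = p \<cdot> k"
    note hk = this
    show "h = k" by (rule pullback_eq[OF pb]) (use hk D(8) in simp_all)
  qed (use D in simp_all)
qed

lemma product_is_pullback:
  assumes "is_product C A B p q" "terminal C T" "a \<in> Hom C A T" "b \<in> Hom C B T"
  shows "is_pullback C a b p q"
proof -
  note D = productD[OF assms(1)]
  show ?thesis
  proof (rule pullbackI)
    show "a \<cdot> p = b \<cdot> q" by (rule terminal_eq[OF assms(2)]) (use assms D in \<open>simp_all add: Hom_def\<close>)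
    fix f g assume "f \<in> Arr C" "g \<in> Arr C" "Dom C f = Dom C g" "Cod C f = Dom C a" "Cod C g = Dom C b"
    then show "\<exists>h. h \<in> Arr C \<and> Dom C h = Dom C f \<and> Cod C h = Dom C p \<and> p \<cdot> h = f \<and> q \<cdot> h = g"
      using product_pair[OF assms(1), of f g] assms(3,4) by (simp add: Hom_def) metis
  next
    fix h k assume "h \<in> Arr C" "k \<in> Arr C" "Dom C h = Dom C k" "Cod C h = Dom C p" "Cod C k = Dom C p"
      "p \<cdot> h = p \<cdot> k" "q \<cdot> h = q \<cdot> k"
    then show "h = k" by (rule product_eq[OF assms(1)])
  qed (use assms D in \<open>simp_all add: Hom_def\<close>)
qed

lemma pullback_is_product:
  assumes "is_pullback C a b p q" "terminal C T" "Cod C a = T"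
  shows "is_product C (Dom C a) (Dom C b) p q"
proof -
  note D = pullbackD[OF assms(1)]
  show ?thesis
  proof (rule productI)
    fix f g assume fg: "f \<in> Arr C" "g \<in> Arr C" "Dom C f = Dom C g" "Cod C f = Dom C a" "Cod C g = Dom C b"
    have "a \<cdot> f = b \<cdot> g" by (rule terminal_eq[OF assms(2)]) (use fg D assms(3) in simp_all)
    then show "\<exists>h. h \<in> Arr C \<and> Dom C h = Dom C f \<and> Cod C h = Dom C p \<and> p \<cdot> h = f \<and> q \<cdot> h = g"
      using pullback_pair[OF assms(1) fg] by metis
  next
    fix h k assume "h \<in> Arr C" "k \<in> Arr C" "Dom C h = Dom C k" "Cod C h = Dom C p" "Cod C k = Dom C p"
      "p \<cdot> h = p \<cdot> k" "q \<cdot> h = q \<cdot> k"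
    then show "h = k" by (rule pullback_eq[OF assms(1)])
  qed (use D in simp_all)
qed

section \<open>Chosen products, and exponentials relative to arbitrary products\<close>

lemma chosen_product:
  assumes "\<exists>p q. is_product C A B p q"
  shows "is_product C A B (pr1 C A B) (pr2 C A B)"
proof -
  obtain p q where "is_product C A B (fst (p, q)) (snd (p, q))" using assms by auto
  then show ?thesis unfolding pr1_def pr2_def projs_def by (rule someI)
qed

lemma pairing:
  assumes "\<exists>p q. is_product C (Cod C f) (Cod C g) p q" "f \<in> Arr C" "g \<in> Arr C" "Dom C f = Dom C g"
  shows "pairing C f g \<in> Arr C" "Dom C (pairing C f g) = Dom C f"
    "Cod C (pairing C f g) = prd C (Cod C f) (Cod C g)"
    "pr1 C (Cod C f) (Cod C g) \<cdot> pairing C f g = f" "pr2 C (Cod C f) (Cod C g) \<cdot> pairing C f g = g"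
proof -
  let ?P = "\<lambda>h. h \<in> Hom C (Dom C f) (prd C (Cod C f) (Cod C g)) \<and>
     pr1 C (Cod C f) (Cod C g) \<cdot> h = f \<and> pr2 C (Cod C f) (Cod C g) \<cdot> h = g"
  have "\<exists>!h. ?P h"
  proof -
    have "f \<in> Hom C (Dom C f) (Cod C f)" "g \<in> Hom C (Dom C f) (Cod C g)"
      using assms by (auto simp: Hom_def)
    then show ?thesis
      using chosen_product[OF assms(1)] unfolding is_product_def prd_def by blast
  qed
  then have "?P (THE h. ?P h)" by (rule theI')
  then show "pairing C f g \<in> Arr C" "Dom C (pairing C f g) = Dom C f"
    "Cod C (pairing C f g) = prd C (Cod C f) (Cod C g)"
    "pr1 C (Cod C f) (Cod C g) \<cdot> pairing C f g = f" "pr2 C (Cod C f) (Cod C g) \<cdot> pairing C f g = g"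
    unfolding pairing_def by (auto simp: Hom_def)
qed

text \<open>\<open>is_exponential\<close> speaks of the products picked by \<open>SOME\<close>,
  about which nothing concrete is known in a slice. This criterion accepts any product of
  \<open>E\<close> and \<open>A\<close> and, for each \<open>Z\<close>, some product of
  \<open>Z\<close> and \<open>A\<close>; the arrow \<open>k\<close> plays the part of
  \<open>g \<times> 1\<close>. The proof compares these with the chosen products.\<close>

lemma exponentialI:
  assumes prods: "\<And>A B. \<lbrakk>A \<in> Obj C; B \<in> Obj C\<rbrakk> \<Longrightarrow> \<exists>p q. is_product C A B p q"
    and ob: "A \<in> Obj C" "E \<in> Obj C"
    and pq: "is_product C E A p q" and ev: "ev \<in> Hom C (Dom C p) B"
    and univ: "\<And>Z. Z \<in> Obj C \<Longrightarrow> \<exists>v w. is_product C Z A v w \<and>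
      (\<forall>f \<in> Hom C (Dom C v) B. \<exists>!g. g \<in> Hom C Z E \<and>
         (\<exists>k \<in> Hom C (Dom C v) (Dom C p). p \<cdot> k = g \<cdot> v \<and> q \<cdot> k = w \<and> ev \<cdot> k = f))"
  shows "\<exists>ev. is_exponential C A B E ev"
proof -
  note P = chosen_product[OF prods, of _ A]
  note D = productD[OF pq] and D' = productD[OF P[OF ob(2,1)]]
  obtain i where i: "i \<in> Arr C" "Dom C i = prd C E A" "Cod C i = Dom C p"
      "p \<cdot> i = pr1 C E A" "q \<cdot> i = pr2 C E A"
    using product_pair[OF pq, of "pr1 C E A" "pr2 C E A"] D' unfolding prd_def by auto
  show ?thesis unfolding is_exponential_def
  proof (intro exI[of _ "ev \<cdot> i"] conjI ballI)
    show "ev \<cdot> i \<in> Hom C (prd C E A) B" using ev i by (auto simp: Hom_def)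
  next
    fix Z f assume Z: "Z \<in> Obj C" and f: "f \<in> Hom C (prd C Z A) B"
    obtain v w where vw: "is_product C Z A v w" and
      uni: "\<forall>f \<in> Hom C (Dom C v) B. \<exists>!g. g \<in> Hom C Z E \<and>
         (\<exists>k \<in> Hom C (Dom C v) (Dom C p). p \<cdot> k = g \<cdot> v \<and> q \<cdot> k = w \<and> ev \<cdot> k = f)"
      using univ[OF Z] by (elim exE conjE)
    note V = productD[OF vw] and V' = productD[OF P[OF Z ob(1)]]
    obtain j where j: "j \<in> Arr C" "Dom C j = Dom C v" "Cod C j = prd C Z A"
        "pr1 C Z A \<cdot> j = v" "pr2 C Z A \<cdot> j = w"
      using product_pair[OF P[OF Z ob(1)], of v w] V unfolding prd_def by auto
    obtain j' where j': "j' \<in> Arr C" "Dom C j' = prd C Z A" "Cod C j' = Dom C v"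
        "v \<cdot> j' = pr1 C Z A" "w \<cdot> j' = pr2 C Z A"
      using product_pair[OF vw, of "pr1 C Z A" "pr2 C Z A"] V' unfolding prd_def by auto
    \<comment> \<open>In \<open>main\<close> the arrow \<open>j\<close> occurs on the right of
      \<open>f\<close> and has to be cancelled; this half of its being an isomorphism does
      it.\<close>
    have jj: "j \<cdot> j' = Ident C (prd C Z A)"
    proof (rule product_eq[OF P[OF Z ob(1)]])
      show "pr1 C Z A \<cdot> (j \<cdot> j') = pr1 C Z A \<cdot> Ident C (prd C Z A)"
        using V' j j' by (simp add: rewrite_tail1[OF j(4)] prd_def)
      show "pr2 C Z A \<cdot> (j \<cdot> j') = pr2 C Z A \<cdot> Ident C (prd C Z A)"
        using V' j j' by (simp add: rewrite_tail1[OF j(5)] prd_def)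
    qed (use V' j j' in \<open>auto simp: prd_def\<close>)
    have main: "(ev \<cdot> i) \<cdot> cross C g (Ident C A) = f \<longleftrightarrow>
         (\<exists>k \<in> Hom C (Dom C v) (Dom C p). p \<cdot> k = g \<cdot> v \<and> q \<cdot> k = w \<and> ev \<cdot> k = f \<cdot> j)"
      if g: "g \<in> Hom C Z E" for g
    proof -
      let ?c = "cross C g (Ident C A)"
      have a: "g \<cdot> pr1 C Z A \<in> Arr C" "Ident C A \<cdot> pr2 C Z A \<in> Arr C"
        "Dom C (g \<cdot> pr1 C Z A) = prd C Z A" "Dom C (Ident C A \<cdot> pr2 C Z A) = prd C Z A"
        "Cod C (g \<cdot> pr1 C Z A) = E" "Cod C (Ident C A \<cdot> pr2 C Z A) = A"
        "Dom C g = Z" "Cod C g = E" "g \<in> Arr C" "Ident C A \<cdot> pr2 C Z A = pr2 C Z A"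
        using g V' ob by (auto simp: Hom_def prd_def)
      have c: "?c \<in> Arr C" "Dom C ?c = prd C Z A" "Cod C ?c = prd C E A"
        "pr1 C E A \<cdot> ?c = g \<cdot> pr1 C Z A" "pr2 C E A \<cdot> ?c = pr2 C Z A"
        using pairing[of "g \<cdot> pr1 C Z A" "Ident C A \<cdot> pr2 C Z A"] prods[of E A] ob a
        unfolding cross_def by auto
      \<comment> \<open>\<open>?k\<close> is \<open>g \<times> 1\<close> carried over from the
        chosen products to the given ones. It is the only candidate for \<open>k\<close>, as both
        projections of \<open>k\<close> are prescribed.\<close>
      let ?k = "i \<cdot> (?c \<cdot> j)"
      have k: "?k \<in> Hom C (Dom C v) (Dom C p)" using c i j by (auto simp: Hom_def)
      have pk: "p \<cdot> ?k = g \<cdot> v"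
        using D D' c i j a V' by (simp add: rewrite_tail1[OF i(4)] rewrite_tail1[OF c(4)] prd_def)
      have qk: "q \<cdot> ?k = w"
        using D D' c i j a V' by (simp add: rewrite_tail1[OF i(5)] rewrite_tail1[OF c(5)] prd_def)
      have unique: "k = ?k" if "k \<in> Hom C (Dom C v) (Dom C p)" "p \<cdot> k = g \<cdot> v" "q \<cdot> k = w" for k
        by (rule product_eq[OF pq]) (use that k pk qk in \<open>auto simp: Hom_def\<close>)
      have "(ev \<cdot> i) \<cdot> ?c = f \<longleftrightarrow> ev \<cdot> ?k = f \<cdot> j"
      proof
        assume "(ev \<cdot> i) \<cdot> ?c = f"
        then show "ev \<cdot> ?k = f \<cdot> j" using ev c i j by (auto simp: Hom_def)
      next
        assume "ev \<cdot> ?k = f \<cdot> j"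
        then have "(ev \<cdot> ?k) \<cdot> j' = (f \<cdot> j) \<cdot> j'" by simp
        then show "(ev \<cdot> i) \<cdot> ?c = f" using ev c i j j' f by (simp add: Hom_def jj)
      qed
      then show ?thesis using k pk qk unique by metis
    qed
    have "f \<cdot> j \<in> Hom C (Dom C v) B" using f j by (auto simp: Hom_def)
    from bspec[OF uni this] show "\<exists>!g. g \<in> Hom C Z E \<and> (ev \<cdot> i) \<cdot> cross C g (Ident C A) = f"
      by (rule ex1_cong[THEN iffD1, rotated]) (use main in blast)
  qed (use ob in auto)
qed

end

section \<open>Slices and finite limits\<close>

lemma slice_simps [simp]:
  "Obj (slice C A) = {p \<in> Arr C. Cod C p = A}"
  "(p, h, q) \<in> Arr (slice C A) \<longleftrightarrow> p \<in> Arr C \<and> Cod C p = A \<and> q \<in> Arr C \<and> Cod C q = A \<and>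
     h \<in> Hom C (Dom C p) (Dom C q) \<and> q \<cdot>\<^bsub>C\<^esub> h = p"
  "Dom (slice C A) (p, h, q) = p"
  "Cod (slice C A) (p, h, q) = q"
  "Ident (slice C A) p = (p, Ident C (Dom C p), p)"
  "(q', k, r) \<cdot>\<^bsub>slice C A\<^esub> (p, h, q) = (p, k \<cdot>\<^bsub>C\<^esub> h, r)"
  by (auto simp: slice_def)

context category
begin

lemma slice_category: "category (slice C A)"
proof
  fix f g B D E assume "f \<in> Hom (slice C A) B D" "g \<in> Hom (slice C A) D E"
  then show "g \<cdot>\<^bsub>slice C A\<^esub> f \<in> Hom (slice C A) B E"
    by (cases f; cases g) (auto simp: Hom_def rewrite_tail1)
qed (auto simp: Hom_def)

lemma slice_terminal: "A \<in> Obj C \<Longrightarrow> terminal (slice C A) (Ident C A)"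
  unfolding terminal_def
proof (intro conjI ballI)
  fix p assume "A \<in> Obj C" "p \<in> Obj (slice C A)"
  then show "\<exists>!f. f \<in> Hom (slice C A) p (Ident C A)"
    by (intro ex1I[of _ "(p, p, Ident C A)"]) (auto simp: Hom_def)
qed simp

lemma slice_product:
  assumes pb: "is_pullback C f g p q" and A: "Cod C f = A"
  shows "is_product (slice C A) f g (f \<cdot> p, p, f) (f \<cdot> p, q, g)"
proof -
  interpret S: category "slice C A" by (rule slice_category)
  note D = pullbackD[OF pb]
  show ?thesis
  proof (rule S.productI)
    fix x y assume xy: "x \<in> Arr (slice C A)" "y \<in> Arr (slice C A)" "Dom (slice C A) x = Dom (slice C A) y"
      "Cod (slice C A) x = f" "Cod (slice C A) y = g"
    obtain h a b where eq: "x = (h, a, f)" "y = (h, b, g)"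
      using xy by (cases x; cases y) auto
    have ab: "a \<in> Arr C" "b \<in> Arr C" "h \<in> Arr C" "Dom C a = Dom C h" "Dom C b = Dom C h"
      "Cod C a = Dom C f" "Cod C b = Dom C g" "Cod C h = A"
      "f \<cdot> a = h" "g \<cdot> b = h" using xy unfolding eq by (auto simp: Hom_def)
    obtain k where k: "k \<in> Arr C" "Dom C k = Dom C a" "Cod C k = Dom C p" "p \<cdot> k = a" "q \<cdot> k = b"
      by (rule pullback_pair[OF pb, of a b]) (use ab in auto)
    show "\<exists>k. k \<in> Arr (slice C A) \<and> Dom (slice C A) k = Dom (slice C A) x \<and>
        Cod (slice C A) k = Dom (slice C A) (f \<cdot> p, p, f) \<and>
        (f \<cdot> p, p, f) \<cdot>\<^bsub>slice C A\<^esub> k = x \<and> (f \<cdot> p, q, g) \<cdot>\<^bsub>slice C A\<^esub> k = y"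
      by (rule exI[of _ "(h, k, f \<cdot> p)"])
         (use k ab A D in \<open>simp add: eq Hom_def\<close>)
  next
    fix x y assume xy: "x \<in> Arr (slice C A)" "y \<in> Arr (slice C A)" "Dom (slice C A) x = Dom (slice C A) y"
      "Cod (slice C A) x = Dom (slice C A) (f \<cdot> p, p, f)" "Cod (slice C A) y = Dom (slice C A) (f \<cdot> p, p, f)"
      "(f \<cdot> p, p, f) \<cdot>\<^bsub>slice C A\<^esub> x = (f \<cdot> p, p, f) \<cdot>\<^bsub>slice C A\<^esub> y"
      "(f \<cdot> p, q, g) \<cdot>\<^bsub>slice C A\<^esub> x = (f \<cdot> p, q, g) \<cdot>\<^bsub>slice C A\<^esub> y"
    obtain h k a where eq: "x = (a, h, f \<cdot> p)" "y = (a, k, f \<cdot> p)"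
      using xy(3-5) by (cases x; cases y) auto
    have "h = k"
      by (rule pullback_eq[OF pb]) (use xy D in \<open>simp_all add: eq Hom_def\<close>)
    then show "x = y" using eq by simp
  qed (use D A in \<open>auto simp: Hom_def\<close>)
qed

text \<open>Products in a slice are pullbacks, so the criterion of \<open>exponentialI\<close> can
  be phrased with arrows of the ambient category alone, and the triples that encode arrows of the
  slice disappear from the remaining task.\<close>

lemma slice_exponential:
  assumes pbs: "\<forall>f \<in> Arr C. \<forall>g \<in> Arr C. Cod C f = Cod C g \<longrightarrow> (\<exists>p q. is_pullback C f g p q)"
    and p: "p \<in> Arr C" "Cod C p = A" and q: "q \<in> Arr C" "Cod C q = A"
    and e: "Cod C e = A" and w: "is_pullback C e p w\<^sub>1 w\<^sub>2"
    and ev: "ev \<in> Hom C (Dom C w\<^sub>1) (Dom C q)" "q \<cdot> ev = p \<cdot> w\<^sub>2"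
    and univ: "\<And>z. \<lbrakk>z \<in> Arr C; Cod C z = A\<rbrakk> \<Longrightarrow> \<exists>v\<^sub>1 v\<^sub>2. is_pullback C z p v\<^sub>1 v\<^sub>2 \<and>
      (\<forall>f \<in> Hom C (Dom C v\<^sub>1) (Dom C q). q \<cdot> f = p \<cdot> v\<^sub>2 \<longrightarrow>
        (\<exists>!n. n \<in> Hom C (Dom C z) (Dom C e) \<and> e \<cdot> n = z \<and>
          (\<exists>k \<in> Hom C (Dom C v\<^sub>1) (Dom C w\<^sub>1). w\<^sub>1 \<cdot> k = n \<cdot> v\<^sub>1 \<and> w\<^sub>2 \<cdot> k = v\<^sub>2 \<and> ev \<cdot> k = f)))"
  shows "\<exists>E ev. is_exponential (slice C A) p q E ev"
proof -
  interpret S: category "slice C A" by (rule slice_category)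
  note W = pullbackD[OF w]
  have "\<exists>ev. is_exponential (slice C A) p q e ev"
  proof (rule S.exponentialI)
    fix f g assume "f \<in> Obj (slice C A)" "g \<in> Obj (slice C A)"
    then show "\<exists>p q. is_product (slice C A) f g p q"
      using pbs[rule_format, of f g] slice_product[of f g _ _ A] by auto metis
  next
    show "is_product (slice C A) e p (e \<cdot> w\<^sub>1, w\<^sub>1, e) (e \<cdot> w\<^sub>1, w\<^sub>2, p)" by (rule slice_product[OF w e])
    show "(e \<cdot> w\<^sub>1, ev, q) \<in> Hom (slice C A) (Dom (slice C A) (e \<cdot> w\<^sub>1, w\<^sub>1, e)) q"
      using ev p q W by (auto simp: Hom_def)
    fix z assume "z \<in> Obj (slice C A)"
    then have z: "z \<in> Arr C" "Cod C z = A" by auto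
    obtain v\<^sub>1 v\<^sub>2 where v: "is_pullback C z p v\<^sub>1 v\<^sub>2" and
      uni: "\<forall>f \<in> Hom C (Dom C v\<^sub>1) (Dom C q). q \<cdot> f = p \<cdot> v\<^sub>2 \<longrightarrow>
        (\<exists>!n. n \<in> Hom C (Dom C z) (Dom C e) \<and> e \<cdot> n = z \<and>
          (\<exists>k \<in> Hom C (Dom C v\<^sub>1) (Dom C w\<^sub>1). w\<^sub>1 \<cdot> k = n \<cdot> v\<^sub>1 \<and> w\<^sub>2 \<cdot> k = v\<^sub>2 \<and> ev \<cdot> k = f))"
      using univ[OF z] by (elim exE conjE)
    note V = pullbackD[OF v]
    show "\<exists>v w. is_product (slice C A) z p v w \<and>
      (\<forall>f \<in> Hom (slice C A) (Dom (slice C A) v) q. \<exists>!g. g \<in> Hom (slice C A) z e \<and>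
         (\<exists>k \<in> Hom (slice C A) (Dom (slice C A) v) (Dom (slice C A) (e \<cdot> w\<^sub>1, w\<^sub>1, e)).
           (e \<cdot> w\<^sub>1, w\<^sub>1, e) \<cdot>\<^bsub>slice C A\<^esub> k = g \<cdot>\<^bsub>slice C A\<^esub> v \<and>
           (e \<cdot> w\<^sub>1, w\<^sub>2, p) \<cdot>\<^bsub>slice C A\<^esub> k = w \<and> (e \<cdot> w\<^sub>1, ev, q) \<cdot>\<^bsub>slice C A\<^esub> k = f))"
    proof (intro exI conjI ballI)
      show "is_product (slice C A) z p (z \<cdot> v\<^sub>1, v\<^sub>1, z) (z \<cdot> v\<^sub>1, v\<^sub>2, p)" by (rule slice_product[OF v z(2)])
      fix f' assume f': "f' \<in> Hom (slice C A) (Dom (slice C A) (z \<cdot> v\<^sub>1, v\<^sub>1, z)) q"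
      then obtain f where eq: "f' = (z \<cdot> v\<^sub>1, f, q)" by (cases f') (auto simp: Hom_def)
      have f: "f \<in> Hom C (Dom C v\<^sub>1) (Dom C q)" "q \<cdot> f = p \<cdot> v\<^sub>2"
        using f' V unfolding eq by (auto simp: Hom_def)
      have conv: "(g' \<in> Hom (slice C A) z e \<and>
         (\<exists>k \<in> Hom (slice C A) (Dom (slice C A) (z \<cdot> v\<^sub>1, v\<^sub>1, z)) (Dom (slice C A) (e \<cdot> w\<^sub>1, w\<^sub>1, e)).
           (e \<cdot> w\<^sub>1, w\<^sub>1, e) \<cdot>\<^bsub>slice C A\<^esub> k = g' \<cdot>\<^bsub>slice C A\<^esub> (z \<cdot> v\<^sub>1, v\<^sub>1, z) \<and>
           (e \<cdot> w\<^sub>1, w\<^sub>2, p) \<cdot>\<^bsub>slice C A\<^esub> k = (z \<cdot> v\<^sub>1, v\<^sub>2, p) \<and> (e \<cdot> w\<^sub>1, ev, q) \<cdot>\<^bsub>slice C A\<^esub> k = f')) \<longleftrightarrow>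
         (\<exists>n. g' = (z, n, e) \<and> n \<in> Hom C (Dom C z) (Dom C e) \<and> e \<cdot> n = z \<and>
          (\<exists>k \<in> Hom C (Dom C v\<^sub>1) (Dom C w\<^sub>1). w\<^sub>1 \<cdot> k = n \<cdot> v\<^sub>1 \<and> w\<^sub>2 \<cdot> k = v\<^sub>2 \<and> ev \<cdot> k = f))"
        (is "?L \<longleftrightarrow> ?R") for g'
      proof
        assume L: ?L
        then obtain n k where eqs: "g' = (z, n, e)" "(z \<cdot> v\<^sub>1, k, e \<cdot> w\<^sub>1) \<in> Arr (slice C A)"
          "(e \<cdot> w\<^sub>1, w\<^sub>1, e) \<cdot>\<^bsub>slice C A\<^esub> (z \<cdot> v\<^sub>1, k, e \<cdot> w\<^sub>1) = (z, n, e) \<cdot>\<^bsub>slice C A\<^esub> (z \<cdot> v\<^sub>1, v\<^sub>1, z)"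
          "(e \<cdot> w\<^sub>1, w\<^sub>2, p) \<cdot>\<^bsub>slice C A\<^esub> (z \<cdot> v\<^sub>1, k, e \<cdot> w\<^sub>1) = (z \<cdot> v\<^sub>1, v\<^sub>2, p)"
          "(e \<cdot> w\<^sub>1, ev, q) \<cdot>\<^bsub>slice C A\<^esub> (z \<cdot> v\<^sub>1, k, e \<cdot> w\<^sub>1) = f'"
          by (cases g') (auto simp: Hom_def simp del: slice_simps(2,6))
        have "n \<in> Hom C (Dom C z) (Dom C e)" "e \<cdot> n = z" using L eqs(1) by (auto simp: Hom_def)
        moreover have "k \<in> Hom C (Dom C v\<^sub>1) (Dom C w\<^sub>1)" "w\<^sub>1 \<cdot> k = n \<cdot> v\<^sub>1" "w\<^sub>2 \<cdot> k = v\<^sub>2" "ev \<cdot> k = f"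
          using eqs(2-) V W unfolding eq by (simp_all add: Hom_def)
        ultimately show ?R using eqs(1) by blast
      next
        assume ?R
        then obtain n k where n: "g' = (z, n, e)" "n \<in> Hom C (Dom C z) (Dom C e)" "e \<cdot> n = z" and
          k: "k \<in> Hom C (Dom C v\<^sub>1) (Dom C w\<^sub>1)" "w\<^sub>1 \<cdot> k = n \<cdot> v\<^sub>1" "w\<^sub>2 \<cdot> k = v\<^sub>2" "ev \<cdot> k = f" by blast
        \<comment> \<open>This makes \<open>k\<close> an arrow over \<open>A\<close>. It follows
          from the first projection, since \<open>n\<close> lies over \<open>A\<close>.\<close>
        have "e \<cdot> (w\<^sub>1 \<cdot> k) = z \<cdot> v\<^sub>1"
          using k n V W by (simp add: Hom_def rewrite_tail1[OF n(3)])
        then show ?L unfolding n(1) eq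
          using n k e z W V by (intro conjI bexI[of _ "(z \<cdot> v\<^sub>1, k, e \<cdot> w\<^sub>1)"]) (auto simp: Hom_def)
      qed
      show "\<exists>!g. g \<in> Hom (slice C A) z e \<and>
         (\<exists>k \<in> Hom (slice C A) (Dom (slice C A) (z \<cdot> v\<^sub>1, v\<^sub>1, z)) (Dom (slice C A) (e \<cdot> w\<^sub>1, w\<^sub>1, e)).
           (e \<cdot> w\<^sub>1, w\<^sub>1, e) \<cdot>\<^bsub>slice C A\<^esub> k = g \<cdot>\<^bsub>slice C A\<^esub> (z \<cdot> v\<^sub>1, v\<^sub>1, z) \<and>
           (e \<cdot> w\<^sub>1, w\<^sub>2, p) \<cdot>\<^bsub>slice C A\<^esub> k = (z \<cdot> v\<^sub>1, v\<^sub>2, p) \<and> (e \<cdot> w\<^sub>1, ev, q) \<cdot>\<^bsub>slice C A\<^esub> k = f')"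
        unfolding conv using uni[rule_format, OF f] by (rule ex1_image)
    qed
  qed (use p e W in auto)
  then show ?thesis by blast
qed

section \<open>Finite limits from a terminal object and pullbacks\<close>

lemma equalizer_exists:
  assumes T: "terminal C T"
    and pbs: "\<forall>f \<in> Arr C. \<forall>g \<in> Arr C. Cod C f = Cod C g \<longrightarrow> (\<exists>p q. is_pullback C f g p q)"
    and fg: "f \<in> Arr C" "g \<in> Arr C" "Dom C f = Dom C g" "Cod C f = Cod C g"
  obtains e where "e \<in> Arr C" "Cod C e = Dom C f" "f \<cdot> e = g \<cdot> e"
    "\<And>x. \<lbrakk>x \<in> Arr C; Cod C x = Dom C f; f \<cdot> x = g \<cdot> x\<rbrakk> \<Longrightarrow>
      \<exists>h. h \<in> Arr C \<and> Dom C h = Dom C x \<and> Cod C h = Dom C e \<and> e \<cdot> h = x"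
    "\<And>h k. \<lbrakk>h \<in> Arr C; k \<in> Arr C; Dom C h = Dom C k; Cod C h = Dom C e; Cod C k = Dom C e;
      e \<cdot> h = e \<cdot> k\<rbrakk> \<Longrightarrow> h = k"
proof -
  define X where "X = Dom C f"
  have X: "X \<in> Obj C" "Dom C f = X" "Dom C g = X" using fg by (auto simp: X_def)
  obtain t where t: "t \<in> Arr C" "Dom C t = X" "Cod C t = T"
    using terminal_arrow[OF T X(1)] .
  obtain t' where t': "t' \<in> Arr C" "Dom C t' = Cod C f" "Cod C t' = T"
    using terminal_arrow[OF T cod_obj[OF fg(1)]] .
  obtain p q where pb\<^sub>0: "is_pullback C t t' p q" using pbs[rule_format, of t t'] t t' by auto
  then have P: "is_product C X (Cod C f) p q"
    using pullback_is_product[OF pb\<^sub>0 T t(3)] t t' by simp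
  note D = productD[OF P]
  \<comment> \<open>\<open>a\<close> and \<open>b\<close> are the graphs of \<open>f\<close> and
    \<open>g\<close>. The equalizer is their pullback: equality of the first coordinates makes the
    two legs coincide, and equality of the second ones then says
    \<open>f \<cdot> e = g \<cdot> e\<close>.\<close>
  obtain a where a: "a \<in> Arr C" "Dom C a = X" "Cod C a = Dom C p" "p \<cdot> a = Ident C X" "q \<cdot> a = f"
    by (rule product_pair[OF P, of "Ident C X" f]) (use X fg in auto)
  obtain b where b: "b \<in> Arr C" "Dom C b = X" "Cod C b = Dom C p" "p \<cdot> b = Ident C X" "q \<cdot> b = g"
    by (rule product_pair[OF P, of "Ident C X" g]) (use X fg in auto)
  obtain e e' where pb: "is_pullback C a b e e'" using pbs[rule_format, of a b] a b by auto
  note E = pullbackD[OF pb]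
  have pa: "p \<cdot> (a \<cdot> x) = x" "q \<cdot> (a \<cdot> x) = f \<cdot> x" "p \<cdot> (b \<cdot> x) = x" "q \<cdot> (b \<cdot> x) = g \<cdot> x"
    if "x \<in> Arr C" "Cod C x = X" for x
    using that D a b by (simp_all add: rewrite_tail1[OF a(4)] rewrite_tail1[OF a(5)]
        rewrite_tail1[OF b(4)] rewrite_tail1[OF b(5)])
  have ee: "e = e'" using pa(1)[of e] pa(3)[of e'] E a b by simp
  show ?thesis
  proof (rule that)
    show "e \<in> Arr C" "Cod C e = Dom C f" using E a X by auto
    show "f \<cdot> e = g \<cdot> e" using pa(2)[of e] pa(4)[of e] E a ee by simp
  next
    fix x assume x: "x \<in> Arr C" "Cod C x = Dom C f" "f \<cdot> x = g \<cdot> x"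
    have "a \<cdot> x = b \<cdot> x"
      by (rule product_eq[OF P]) (use x X a b D pa[of x] in simp_all)
    then show "\<exists>h. h \<in> Arr C \<and> Dom C h = Dom C x \<and> Cod C h = Dom C e \<and> e \<cdot> h = x"
      using pullback_pair[OF pb, of x x] x X a b by metis
  next
    fix h k assume hk: "h \<in> Arr C" "k \<in> Arr C" "Dom C h = Dom C k" "Cod C h = Dom C e" "Cod C k = Dom C e"
      "e \<cdot> h = e \<cdot> k"
    show "h = k" by (rule pullback_eq[OF pb]) (use hk ee in auto)
  qed
qed

lemma finite_product_exists:
  assumes T: "terminal C T"
    and pbs: "\<forall>f \<in> Arr C. \<forall>g \<in> Arr C. Cod C f = Cod C g \<longrightarrow> (\<exists>p q. is_pullback C f g p q)"
    and "finite S" "\<forall>j \<in> S. F j \<in> Obj C"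
  shows "\<exists>L l. L \<in> Obj C \<and> (\<forall>j \<in> S. l j \<in> Hom C L (F j)) \<and>
    (\<forall>X x. X \<in> Obj C \<and> (\<forall>j \<in> S. x j \<in> Hom C X (F j)) \<longrightarrow>
      (\<exists>!h. h \<in> Hom C X L \<and> (\<forall>j \<in> S. l j \<cdot> h = x j)))"
  using assms(3,4)
proof (induction S rule: finite_induct)
  case empty
  show ?case using T unfolding terminal_def by (intro exI[of _ T]) auto
next
  case (insert s S)
  then obtain L l where L: "L \<in> Obj C" "\<forall>j \<in> S. l j \<in> Hom C L (F j)"
    and univ: "\<And>X x. \<lbrakk>X \<in> Obj C; \<forall>j \<in> S. x j \<in> Hom C X (F j)\<rbrakk> \<Longrightarrow>
      \<exists>!h. h \<in> Hom C X L \<and> (\<forall>j \<in> S. l j \<cdot> h = x j)"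
    by (auto simp: Ball_def)
  have Fs: "F s \<in> Obj C" using insert by simp
  obtain t where t: "t \<in> Arr C" "Dom C t = L" "Cod C t = T" using terminal_arrow[OF T L(1)] .
  obtain t' where t': "t' \<in> Arr C" "Dom C t' = F s" "Cod C t' = T" using terminal_arrow[OF T Fs] .
  obtain p q where pb\<^sub>0: "is_pullback C t t' p q" using pbs[rule_format, of t t'] t t' by auto
  then have P: "is_product C L (F s) p q"
    using pullback_is_product[OF pb\<^sub>0 T t(3)] t t' by simp
  note D = productD[OF P]
  define m where "m j = (if j = s then q else l j \<cdot> p)" for j
  have ms: "m s = q" and mj: "\<And>j. j \<in> S \<Longrightarrow> m j = l j \<cdot> p" using insert(2) by (auto simp: m_def)
  have lj: "l j \<in> Arr C" "Dom C (l j) = L" "Cod C (l j) = F j" if "j \<in> S" for j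
    using L that by (auto simp: Hom_def)
  show ?case
  proof (intro exI[of _ "Dom C p"] exI[of _ m] conjI allI impI)
    show "\<forall>j \<in> insert s S. m j \<in> Hom C (Dom C p) (F j)"
      using D lj by (auto simp: ms mj Hom_def)
    fix X x assume "X \<in> Obj C \<and> (\<forall>j \<in> insert s S. x j \<in> Hom C X (F j))"
    then have x: "X \<in> Obj C" "\<forall>j \<in> S. x j \<in> Hom C X (F j)"
      "x s \<in> Arr C" "Dom C (x s) = X" "Cod C (x s) = F s" by (auto simp: Hom_def)
    from univ[OF x(1,2)] obtain h where h: "h \<in> Arr C" "Dom C h = X" "Cod C h = L" "\<forall>j \<in> S. l j \<cdot> h = x j"
      by (auto simp: Hom_def)
    obtain k where k: "k \<in> Arr C" "Dom C k = X" "Cod C k = Dom C p" "p \<cdot> k = h" "q \<cdot> k = x s"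
      using product_pair[OF P h(1) x(3)] h(2,3) x(4,5) by metis
    show "\<exists>!h. h \<in> Hom C X (Dom C p) \<and> (\<forall>j \<in> insert s S. m j \<cdot> h = x j)"
    proof (rule ex1I[of _ k])
      show "k \<in> Hom C X (Dom C p) \<and> (\<forall>j \<in> insert s S. m j \<cdot> k = x j)"
        using k h lj D by (auto simp: Hom_def ms mj)
      fix k' assume k': "k' \<in> Hom C X (Dom C p) \<and> (\<forall>j \<in> insert s S. m j \<cdot> k' = x j)"
      then have "p \<cdot> k' \<in> Hom C X L" using D by (auto simp: Hom_def)
      moreover have "\<forall>j \<in> S. l j \<cdot> (p \<cdot> k') = x j"
      proof
        fix j assume j: "j \<in> S"
        then have "(l j \<cdot> p) \<cdot> k' = x j" using k' by (auto simp flip: mj)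
        then show "l j \<cdot> (p \<cdot> k') = x j" using lj[OF j] D k' by (simp add: Hom_def)
      qed
      ultimately have "p \<cdot> k' = h" using univ[OF x(1,2)] h by (auto simp: Hom_def)
      moreover have "q \<cdot> k' = x s" using k' ms by auto
      ultimately show "k' = k" by (intro product_eq[OF P, of k' k]) (use k' k in \<open>simp_all add: Hom_def\<close>)
    qed
  qed (use D in auto)
qed

text \<open>The arrows of the shape are imposed on cones one at a time. With none imposed, a limit
  is a product over all objects; imposing \<open>u\<close> as well cuts the limit down by the
  equalizer of the two maps to the object at \<open>Cod J u\<close>.\<close>

lemma finite_limits:
  assumes T: "terminal C T"
    and pbs: "\<forall>f \<in> Arr C. \<forall>g \<in> Arr C. Cod C f = Cod C g \<longrightarrow> (\<exists>p q. is_pullback C f g p q)"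
  shows "has_finite_limits C"
  unfolding has_finite_limits_def
proof (intro allI impI)
  fix J :: "(nat, nat) cat" and F\<^sub>o F\<^sub>a
  assume J: "category J \<and> finite (Obj J) \<and> finite (Arr J) \<and> is_functor J C F\<^sub>o F\<^sub>a"
  then interpret J: category J by simp
  have F: "\<And>j. j \<in> Obj J \<Longrightarrow> F\<^sub>o j \<in> Obj C"
    "\<And>u. u \<in> Arr J \<Longrightarrow> F\<^sub>a u \<in> Arr C \<and> Dom C (F\<^sub>a u) = F\<^sub>o (Dom J u) \<and> Cod C (F\<^sub>a u) = F\<^sub>o (Cod J u)"
    using J unfolding is_functor_def by (auto simp: Hom_def)
  define cone where "cone U L l \<longleftrightarrow> L \<in> Obj C \<and> (\<forall>j \<in> Obj J. l j \<in> Hom C L (F\<^sub>o j)) \<and>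
     (\<forall>u \<in> U. F\<^sub>a u \<cdot> l (Dom J u) = l (Cod J u))" for U L l
  have "\<exists>L l. cone U L l \<and> (\<forall>X x. cone U X x \<longrightarrow> (\<exists>!h. h \<in> Hom C X L \<and> (\<forall>j \<in> Obj J. l j \<cdot> h = x j)))"
    if "finite U" "U \<subseteq> Arr J" for U
    using that
  proof (induction U rule: finite_induct)
    case empty
    have "finite (Obj J)" "\<forall>j \<in> Obj J. F\<^sub>o j \<in> Obj C" using J F(1) by blast+
    from finite_product_exists[OF T pbs this] show ?case unfolding cone_def by (simp only: ball_empty simp_thms conj_assoc)
  next
    case (insert u U)
    then obtain L l where L: "cone U L l"
      and univ: "\<And>X x. cone U X x \<Longrightarrow> \<exists>!h. h \<in> Hom C X L \<and> (\<forall>j \<in> Obj J. l j \<cdot> h = x j)"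
      by auto
    have u: "u \<in> Arr J" "Dom J u \<in> Obj J" "Cod J u \<in> Obj J" using insert by auto
    have lj: "l j \<in> Arr C" "Dom C (l j) = L" "Cod C (l j) = F\<^sub>o j" if "j \<in> Obj J" for j
      using L that by (auto simp: cone_def Hom_def)
    have "F\<^sub>a u \<cdot> l (Dom J u) \<in> Arr C" "l (Cod J u) \<in> Arr C"
      "Dom C (F\<^sub>a u \<cdot> l (Dom J u)) = Dom C (l (Cod J u))" "Cod C (F\<^sub>a u \<cdot> l (Dom J u)) = Cod C (l (Cod J u))"
      "Dom C (F\<^sub>a u \<cdot> l (Dom J u)) = L"
      using F(2)[OF u(1)] lj u by simp_all
    note ty = this
    obtain e where e: "e \<in> Arr C" "Cod C e = L" "(F\<^sub>a u \<cdot> l (Dom J u)) \<cdot> e = l (Cod J u) \<cdot> e"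
      and ex: "\<And>x. \<lbrakk>x \<in> Arr C; Cod C x = L; (F\<^sub>a u \<cdot> l (Dom J u)) \<cdot> x = l (Cod J u) \<cdot> x\<rbrakk> \<Longrightarrow>
        \<exists>h. h \<in> Arr C \<and> Dom C h = Dom C x \<and> Cod C h = Dom C e \<and> e \<cdot> h = x"
      and eq: "\<And>h k. \<lbrakk>h \<in> Arr C; k \<in> Arr C; Dom C h = Dom C k; Cod C h = Dom C e; Cod C k = Dom C e;
        e \<cdot> h = e \<cdot> k\<rbrakk> \<Longrightarrow> h = k"
      by (rule equalizer_exists[OF T pbs ty(1-4), unfolded ty(5)]) (rule that; assumption)
    show ?case
    proof (intro exI[of _ "Dom C e"] exI[of _ "\<lambda>j. l j \<cdot> e"] conjI allI impI)
      show "cone (insert u U) (Dom C e) (\<lambda>j. l j \<cdot> e)"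
        unfolding cone_def
      proof (intro conjI ballI)
        fix v assume v: "v \<in> insert u U"
        then have vA: "v \<in> Arr J" using insert by auto
        have "(F\<^sub>a v \<cdot> l (Dom J v)) \<cdot> e = l (Cod J v) \<cdot> e"
          using v e(3) L unfolding cone_def by auto
        then show "F\<^sub>a v \<cdot> (l (Dom J v) \<cdot> e) = l (Cod J v) \<cdot> e"
          using F(2)[OF vA] lj vA e by simp
      qed (use e lj in \<open>auto simp: Hom_def\<close>)
    next
      fix X x assume "cone (insert u U) X x"
      then have x: "cone U X x" "F\<^sub>a u \<cdot> x (Dom J u) = x (Cod J u)" by (auto simp: cone_def)
      from univ[OF x(1)] obtain h where h: "h \<in> Arr C" "Dom C h = X" "Cod C h = L"
        "\<forall>j \<in> Obj J. l j \<cdot> h = x j" by (auto simp: Hom_def)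
      have "(F\<^sub>a u \<cdot> l (Dom J u)) \<cdot> h = l (Cod J u) \<cdot> h"
        using h x(2) F(2)[OF u(1)] lj u by simp
      from ex[OF h(1,3) this] obtain k where k: "k \<in> Arr C" "Dom C k = X" "Cod C k = Dom C e" "e \<cdot> k = h"
        using h by auto
      show "\<exists>!h. h \<in> Hom C X (Dom C e) \<and> (\<forall>j \<in> Obj J. (l j \<cdot> e) \<cdot> h = x j)"
      proof (rule ex1I[of _ k])
        show "k \<in> Hom C X (Dom C e) \<and> (\<forall>j \<in> Obj J. (l j \<cdot> e) \<cdot> k = x j)"
          using k h lj e by (auto simp: Hom_def)
        fix k' assume k': "k' \<in> Hom C X (Dom C e) \<and> (\<forall>j \<in> Obj J. (l j \<cdot> e) \<cdot> k' = x j)"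
        then have "e \<cdot> k' \<in> Hom C X L" "\<forall>j \<in> Obj J. l j \<cdot> (e \<cdot> k') = x j"
          using e lj by (auto simp: Hom_def)
        then have "e \<cdot> k' = h" using univ[OF x(1)] h by (auto simp: Hom_def)
        then show "k' = k" by (rule eq[rotated 5, OF trans]) (use k' k e in \<open>simp_all add: Hom_def\<close>)
      qed
    qed
  qed
  from this[of "Arr J"] J show "\<exists>L l. is_limit J C F\<^sub>o F\<^sub>a L l"
    unfolding cone_def is_limit_def is_cone_def by auto
qed

lemma locally_cartesian_closedI:
  assumes T: "terminal C T"
    and pbs: "\<forall>f \<in> Arr C. \<forall>g \<in> Arr C. Cod C f = Cod C g \<longrightarrow> (\<exists>p q. is_pullback C f g p q)"
    and exps: "\<And>p q. \<lbrakk>p \<in> Arr C; q \<in> Arr C; Cod C p = Cod C q\<rbrakk> \<Longrightarrow>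
      \<exists>e w\<^sub>1 w\<^sub>2 ev. Cod C e = Cod C q \<and> is_pullback C e p w\<^sub>1 w\<^sub>2 \<and>
        ev \<in> Hom C (Dom C w\<^sub>1) (Dom C q) \<and> q \<cdot> ev = p \<cdot> w\<^sub>2 \<and>
        (\<forall>z. z \<in> Arr C \<and> Cod C z = Cod C q \<longrightarrow> (\<exists>v\<^sub>1 v\<^sub>2. is_pullback C z p v\<^sub>1 v\<^sub>2 \<and>
          (\<forall>f \<in> Hom C (Dom C v\<^sub>1) (Dom C q). q \<cdot> f = p \<cdot> v\<^sub>2 \<longrightarrow>
            (\<exists>!n. n \<in> Hom C (Dom C z) (Dom C e) \<and> e \<cdot> n = z \<and>
              (\<exists>k \<in> Hom C (Dom C v\<^sub>1) (Dom C w\<^sub>1). w\<^sub>1 \<cdot> k = n \<cdot> v\<^sub>1 \<and> w\<^sub>2 \<cdot> k = v\<^sub>2 \<and> ev \<cdot> k = f)))))"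
  shows "locally_cartesian_closed C"
  unfolding locally_cartesian_closed_def cartesian_closed_def
proof (intro conjI ballI)
  show "category C" by (rule category_axioms)
  show "has_finite_limits C" by (rule finite_limits[OF T pbs])
  fix A assume A: "A \<in> Obj C"
  show "category (slice C A)" by (rule slice_category)
  show "\<exists>T. terminal (slice C A) T" using slice_terminal[OF A] by blast
  fix p q assume pq: "p \<in> Obj (slice C A)" "q \<in> Obj (slice C A)"
  then have pq': "p \<in> Arr C" "Cod C p = A" "q \<in> Arr C" "Cod C q = A" by auto
  show "\<exists>f g. is_product (slice C A) p q f g"
    using pbs[rule_format, of p q] slice_product[of p q _ _ A] pq' by metis
  from exps[OF pq'(1,3) trans[OF pq'(2) pq'(4)[symmetric]], unfolded pq'(4)] obtain e w\<^sub>1 w\<^sub>2 ev where *: "Cod C e = A" "is_pullback C e p w\<^sub>1 w\<^sub>2"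
    "ev \<in> Hom C (Dom C w\<^sub>1) (Dom C q)" "q \<cdot> ev = p \<cdot> w\<^sub>2"
    "\<forall>z. z \<in> Arr C \<and> Cod C z = A \<longrightarrow> (\<exists>v\<^sub>1 v\<^sub>2. is_pullback C z p v\<^sub>1 v\<^sub>2 \<and>
          (\<forall>f \<in> Hom C (Dom C v\<^sub>1) (Dom C q). q \<cdot> f = p \<cdot> v\<^sub>2 \<longrightarrow>
            (\<exists>!n. n \<in> Hom C (Dom C z) (Dom C e) \<and> e \<cdot> n = z \<and>
              (\<exists>k \<in> Hom C (Dom C v\<^sub>1) (Dom C w\<^sub>1). w\<^sub>1 \<cdot> k = n \<cdot> v\<^sub>1 \<and> w\<^sub>2 \<cdot> k = v\<^sub>2 \<and> ev \<cdot> k = f))))"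
    by (elim exE conjE)
  show "\<exists>E ev. is_exponential (slice C A) p q E ev"
    by (rule slice_exponential[OF pbs pq' *(1-4)]) (use *(5) in simp_all)
qed

end

section \<open>Path categories\<close>

text \<open>For a fibration \<open>d\<close> this is the truth value of the predicate
  \<open>d\<close> at the generalized element \<open>h\<close>. Such a \<open>d\<close> is rarely
  monic, so a lift is a witness that may be chosen in several ways; only its existence is
  recorded.\<close>

definition lifts :: "('o, 'm, 'z) cat_scheme \<Rightarrow> 'm \<Rightarrow> 'm \<Rightarrow> bool" where
  "lifts C d h \<longleftrightarrow> (\<exists>k \<in> Arr C. Dom C k = Dom C h \<and> Cod C k = Dom C d \<and> d \<cdot>\<^bsub>C\<^esub> k = h)"

lemma fib_slice_simps [simp]:
  "Obj (fib_slice C A) = {p \<in> Fib C. Cod C p = A}"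
  "(p, h, q) \<in> Arr (fib_slice C A) \<longleftrightarrow> (p, h, q) \<in> Arr (slice C A) \<and> p \<in> Fib C \<and> q \<in> Fib C"
  "Dom (fib_slice C A) = Dom (slice C A)"
  "Cod (fib_slice C A) = Cod (slice C A)"
  "Ident (fib_slice C A) = Ident (slice C A)"
  "Comp (fib_slice C A) = Comp (slice C A)"
  "(p, h, q) \<in> Weq (fib_slice C A) \<longleftrightarrow> (p, h, q) \<in> Arr (fib_slice C A) \<and> h \<in> Weq C"
  "(p, h, q) \<in> Fib (fib_slice C A) \<longleftrightarrow> (p, h, q) \<in> Arr (fib_slice C A) \<and> h \<in> Fib C"
  by (auto simp: fib_slice_def Let_def und_def)

lemma fib_slice_hom:
  "Hom (fib_slice C A) p q = (if p \<in> Fib C \<and> q \<in> Fib C then Hom (slice C A) p q else {})"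
  by (auto simp: Hom_def)

context path_category
begin

section \<open>Products and pairings in a path category\<close>

lemma fib_arrow [simp]: "f \<in> Fib C \<Longrightarrow> f \<in> Arr C"
  using fib_arr by auto

lemma weq_arrow: "f \<in> Weq C \<Longrightarrow> f \<in> Arr C"
  using weq_arr by auto

lemma product_exists:
  assumes "A \<in> Obj C" "B \<in> Obj C"
  shows "\<exists>p q. is_product C A B p q"
proof -
  obtain T where T: "terminal C T" "\<And>f. \<lbrakk>f \<in> Arr C; Cod C f = T\<rbrakk> \<Longrightarrow> f \<in> Fib C"
    using terminal_fib by auto
  obtain a where a: "a \<in> Arr C" "Dom C a = A" "Cod C a = T" using terminal_arrow[OF T(1) assms(1)] .
  obtain b where b: "b \<in> Arr C" "Dom C b = B" "Cod C b = T" using terminal_arrow[OF T(1) assms(2)] .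
  obtain p q where "is_pullback C a b p q" using fib_pullback_exists[of a b] T(2) a b by auto
  from pullback_is_product[OF this T(1) a(3)] show ?thesis using a b by auto
qed

text \<open>A projection of a product is a pullback of the map from the other factor to the terminal
  object, and that map is a fibration.\<close>

lemma is_product_fib:
  assumes "is_product C A B p q"
  shows "p \<in> Fib C" "q \<in> Fib C"
proof -
  obtain T where T: "terminal C T" "\<And>f. \<lbrakk>f \<in> Arr C; Cod C f = T\<rbrakk> \<Longrightarrow> f \<in> Fib C"
    using terminal_fib by auto
  have "A \<in> Obj C" "B \<in> Obj C" using productD[OF assms] by auto
  then obtain a b where ab: "a \<in> Hom C A T" "b \<in> Hom C B T" using T(1) unfolding terminal_def by blast
  then have "a \<in> Fib C" "b \<in> Fib C" using T(2) by (auto simp: Hom_def)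
  moreover have "is_pullback C a b p q" using product_is_pullback[OF assms T(1) ab] .
  ultimately show "p \<in> Fib C" "q \<in> Fib C"
    using fib_pullback[of a b p q] fib_pullback[of b a q p] pullback_sym[of a b p q] by auto
qed

lemma chosen_prod:
  assumes "A \<in> Obj C" "B \<in> Obj C"
  shows "is_product C A B (pr1 C A B) (pr2 C A B)"
  using chosen_product[OF product_exists[OF assms]] .

lemma pr_fib [simp]:
  assumes "A \<in> Obj C" "B \<in> Obj C"
  shows "pr1 C A B \<in> Fib C" "pr2 C A B \<in> Fib C"
  using is_product_fib[OF chosen_prod[OF assms]] .

lemma pr_arr [simp]:
  assumes "A \<in> Obj C" "B \<in> Obj C"
  shows "Dom C (pr1 C A B) = prd C A B" "Dom C (pr2 C A B) = prd C A B"
    "Cod C (pr1 C A B) = A" "Cod C (pr2 C A B) = B"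
  using productD[OF chosen_prod[OF assms]] by (simp_all add: prd_def)

lemma prd_obj [simp]: "\<lbrakk>A \<in> Obj C; B \<in> Obj C\<rbrakk> \<Longrightarrow> prd C A B \<in> Obj C"
  using dom_obj[of "pr1 C A B"] by simp

lemma pairing_arr [simp]:
  assumes "f \<in> Arr C" "g \<in> Arr C" "Dom C f = Dom C g"
  shows "pairing C f g \<in> Arr C" "Dom C (pairing C f g) = Dom C g"
    "Cod C (pairing C f g) = prd C (Cod C f) (Cod C g)"
  using pairing[OF product_exists assms] assms by auto

lemma pr_pairing [simp]:
  assumes "f \<in> Arr C" "g \<in> Arr C" "Dom C f = Dom C g" "Cod C f = A" "Cod C g = B"
  shows "pr1 C A B \<cdot> pairing C f g = f" "pr2 C A B \<cdot> pairing C f g = g"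
  using pairing[OF product_exists assms(1-3)] assms by auto

lemma pr_pairing_tail [simp]:
  assumes "f \<in> Arr C" "g \<in> Arr C" "Dom C f = Dom C g" "Cod C f = A" "Cod C g = B"
    "u \<in> Arr C" "Cod C u = Dom C g"
  shows "pr1 C A B \<cdot> (pairing C f g \<cdot> u) = f \<cdot> u" "pr2 C A B \<cdot> (pairing C f g \<cdot> u) = g \<cdot> u"
proof -
  have AB: "A \<in> Obj C" "B \<in> Obj C" using assms by auto
  show "pr1 C A B \<cdot> (pairing C f g \<cdot> u) = f \<cdot> u" "pr2 C A B \<cdot> (pairing C f g \<cdot> u) = g \<cdot> u"
    using assms AB by (simp_all flip: assoc)
qed

lemma prd_eq:
  assumes "A \<in> Obj C" "B \<in> Obj C" "h \<in> Arr C" "k \<in> Arr C" "Dom C h = Dom C k"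
    "Cod C h = prd C A B" "Cod C k = prd C A B"
    "pr1 C A B \<cdot> h = pr1 C A B \<cdot> k" "pr2 C A B \<cdot> h = pr2 C A B \<cdot> k"
  shows "h = k"
  by (rule product_eq[OF chosen_prod[OF assms(1,2)]]) (use assms in simp_all)

lemma pairing_comp:
  assumes "f \<in> Arr C" "g \<in> Arr C" "Dom C f = Dom C g" "u \<in> Arr C" "Cod C u = Dom C g"
  shows "pairing C f g \<cdot> u = pairing C (f \<cdot> u) (g \<cdot> u)"
  by (rule prd_eq[of "Cod C f" "Cod C g"]) (use assms in simp_all)

lemma pairing_eta:
  assumes "A \<in> Obj C" "B \<in> Obj C" "h \<in> Arr C" "Cod C h = prd C A B"
  shows "pairing C (pr1 C A B \<cdot> h) (pr2 C A B \<cdot> h) = h"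
  by (rule prd_eq[of A B]) (use assms in simp_all)

section \<open>Weak equivalences, factorization and lifting\<close>

lemma ident_weq: "A \<in> Obj C \<Longrightarrow> Ident C A \<in> Weq C"
  using iso_acyclic_fib[OF iso_ident] by auto

text \<open>2-out-of-6 for the string identity, \<open>i\<close>, \<open>t\<close>, whose two
  composites are \<open>i\<close> and \<open>t \<cdot> i\<close>. The next lemma uses the string
  \<open>f\<close>, \<open>g\<close>, identity in the same way.\<close>

lemma weq_cancel_right:
  assumes "i \<in> Weq C" "t \<cdot> i \<in> Weq C" "t \<in> Arr C" "Cod C i = Dom C t"
  shows "t \<in> Weq C"
proof -
  have i: "i \<in> Arr C" using assms(1) weq_arrow by auto
  show ?thesis
    by (rule two_out_of_six[of "Ident C (Dom C i)" "Dom C i" "Dom C i" i "Dom C t" t "Cod C t", THEN conjunct2, THEN conjunct2, THEN conjunct1])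
       (use assms i in \<open>simp_all add: Hom_def\<close>)
qed

lemma weq_cancel_left:
  assumes "g \<in> Weq C" "g \<cdot> f \<in> Weq C" "f \<in> Arr C" "Cod C f = Dom C g"
  shows "f \<in> Weq C"
proof -
  have g: "g \<in> Arr C" using assms(1) weq_arrow by auto
  show ?thesis
    by (rule two_out_of_six[of f "Dom C f" "Dom C g" g "Cod C g" "Ident C (Cod C g)" "Cod C g", THEN conjunct1])
       (use assms g in \<open>simp_all add: Hom_def\<close>)
qed

text \<open>The mapping path object of \<open>l : A \<rightarrow> B\<close>, with path object \<open>(s, t) : PB \<rightarrow> B \<times> B\<close>, is the pullback of \<open>(s, t)\<close> along
  \<open>l \<times> 1\<close>; its projection to \<open>A\<close> is also a pullback of the acyclic fibration \<open>s\<close>.\<close>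

lemma factorization:
  assumes l: "l \<in> Arr C"
  obtains i t where "i \<in> Weq C" "t \<in> Fib C" "Dom C i = Dom C l" "Cod C i = Dom C t" "Cod C t = Cod C l"
    "t \<cdot> i = l"
proof -
  define A B where "A = Dom C l" and "B = Cod C l"
  have AB: "A \<in> Obj C" "B \<in> Obj C" "Dom C l = A" "Cod C l = B" using l by (auto simp: A_def B_def)
  obtain r d where "path_object C B r d" using path_object_exists[OF AB(2)] by auto
  then have r: "r \<in> Weq C" "r \<in> Arr C" "Dom C r = B" "Cod C r = Dom C d"
    and d: "d \<in> Fib C" "d \<in> Arr C" "Cod C d = prd C B B" and dr: "d \<cdot> r = pairing C (Ident C B) (Ident C B)"
    using weq_arrow unfolding path_object_def diagonal_def by auto
  define s t where "s = pr1 C B B \<cdot> d" and "t = pr2 C B B \<cdot> d"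
  have st: "s \<in> Fib C" "t \<in> Fib C" "Dom C s = Dom C d" "Dom C t = Dom C d" "Cod C s = B" "Cod C t = B"
    using d AB fib_comp by (auto simp: s_def t_def)
  have pd: "pr1 C B B \<cdot> (d \<cdot> a) = s \<cdot> a" "pr2 C B B \<cdot> (d \<cdot> a) = t \<cdot> a" if "a \<in> Arr C" "Cod C a = Dom C d" for a
    unfolding s_def t_def using that AB d by simp_all
  have sr: "s \<cdot> r = Ident C B" "t \<cdot> r = Ident C B"
    unfolding s_def t_def using AB d r by (simp_all add: dr)
  have s_weq: "s \<in> Weq C"
    by (rule weq_cancel_right[of r]) (use st r sr ident_weq[OF AB(2)] in simp_all)
  define x where "x = pairing C (l \<cdot> pr1 C A B) (pr2 C A B)"
  have x: "x \<in> Arr C" "Dom C x = prd C A B" "Cod C x = prd C B B"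
    using l AB by (simp_all add: x_def)
  have px: "pr1 C B B \<cdot> (x \<cdot> u) = l \<cdot> (pr1 C A B \<cdot> u)" "pr2 C B B \<cdot> (x \<cdot> u) = pr2 C A B \<cdot> u"
    if "u \<in> Arr C" "Cod C u = prd C A B" for u
    using that l AB by (simp_all add: x_def)
  obtain m n where pb: "is_pullback C d x m n"
    using fib_pullback_exists[of d x] d x by auto
  note D = pullbackD[OF pb]
  have n: "n \<in> Fib C" using fib_pullback[OF d(1) pb] .
  define n\<^sub>1 where "n\<^sub>1 = pr1 C A B \<cdot> n"
  have n1: "n\<^sub>1 \<in> Arr C" "Dom C n\<^sub>1 = Dom C m" "Cod C n\<^sub>1 = A" using D x AB by (auto simp: n\<^sub>1_def)
  have sm: "s \<cdot> m = l \<cdot> n\<^sub>1"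
  proof -
    have "s \<cdot> m = pr1 C B B \<cdot> (d \<cdot> m)" unfolding s_def using D d AB by simp
    then show ?thesis using D px[of n] x by (simp add: n\<^sub>1_def)
  qed
  have tm: "t \<cdot> m = pr2 C A B \<cdot> n"
  proof -
    have "t \<cdot> m = pr2 C B B \<cdot> (d \<cdot> m)" unfolding t_def using D d AB by simp
    then show ?thesis using D px[of n] x by simp
  qed
  have pb1: "is_pullback C s l m n\<^sub>1"
  proof (rule pullbackI)
    fix a b assume ab: "a \<in> Arr C" "b \<in> Arr C" "Dom C a = Dom C b" "Cod C a = Dom C s" "Cod C b = Dom C l"
      "s \<cdot> a = l \<cdot> b"
    \<comment> \<open>A map into the mapping path object is a path together with a point
      \<open>b\<close> of \<open>A\<close> over its start; the second coordinate in \<open>B\<close>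
      that \<open>x\<close> asks for is the end \<open>t \<cdot> a\<close> of the path.\<close>
    have eq: "d \<cdot> a = x \<cdot> pairing C b (t \<cdot> a)"
      by (rule prd_eq[OF AB(2,2)])
         (use ab st d x AB px[of "pairing C b (t \<cdot> a)"] in \<open>simp_all add: pd\<close>)
    obtain h where "h \<in> Arr C" "Dom C h = Dom C a" "Cod C h = Dom C m" "m \<cdot> h = a" "n \<cdot> h = pairing C b (t \<cdot> a)"
      by (rule pullback_pair[OF pb _ _ _ _ _ eq]) (use ab st d x AB in simp_all)
    then show "\<exists>h. h \<in> Arr C \<and> Dom C h = Dom C a \<and> Cod C h = Dom C m \<and> m \<cdot> h = a \<and> n\<^sub>1 \<cdot> h = b"
      using ab st AB D x by (intro exI[of _ h]) (simp add: n\<^sub>1_def)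
  next
    fix h k assume hk: "h \<in> Arr C" "k \<in> Arr C" "Dom C h = Dom C k" "Cod C h = Dom C m" "Cod C k = Dom C m"
      "m \<cdot> h = m \<cdot> k" "n\<^sub>1 \<cdot> h = n\<^sub>1 \<cdot> k"
    have "pr2 C A B \<cdot> (n \<cdot> h) = t \<cdot> (m \<cdot> h)" "pr2 C A B \<cdot> (n \<cdot> k) = t \<cdot> (m \<cdot> k)"
      using hk(1,2,4,5) D st x AB by (simp_all add: rewrite_tail[OF tm])
    note pr2s = this
    have "pr1 C A B \<cdot> (n \<cdot> h) = pr1 C A B \<cdot> (n \<cdot> k)" using hk D x AB by (simp add: n\<^sub>1_def)
    then have "n \<cdot> h = n \<cdot> k"
      by (rule prd_eq[OF AB(1,2), rotated 5]) (use hk pr2s D x AB in simp_all)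
    then show "h = k" by (rule pullback_eq[OF pb, rotated 6]) (use hk in simp_all)
  qed (use D st l AB n1 sm in simp_all)
  have "n\<^sub>1 \<in> Weq C" using acyclic_fib_pullback[OF _ pb1] st s_weq by auto
  have "s \<cdot> (r \<cdot> l) = l \<cdot> Ident C A" using l AB r st by (simp add: rewrite_tail1[OF sr(1)])
  then obtain i where i: "i \<in> Arr C" "Dom C i = A" "Cod C i = Dom C m" "m \<cdot> i = r \<cdot> l" "n\<^sub>1 \<cdot> i = Ident C A"
    using pullback_pair[OF pb1, of "r \<cdot> l" "Ident C A"] r l AB st by auto
  show ?thesis
  proof (rule that)
    show "i \<in> Weq C"
      by (rule weq_cancel_left[OF \<open>n\<^sub>1 \<in> Weq C\<close>]) (use i ident_weq[OF AB(1)] n1 in simp_all)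
    show "t \<cdot> m \<in> Fib C" unfolding tm using fib_comp[OF n] D AB x by simp
    show "(t \<cdot> m) \<cdot> i = l" using i D st r l AB by (simp add: rewrite_tail1[OF sr(2)])
  qed (use D st i AB in simp_all)
qed

text \<open>Pull \<open>q\<close> back along \<open>u\<close> to a fibration \<open>b\<close>. A
  lift of \<open>u \<cdot> w\<close> amounts to a factorization \<open>w = b \<cdot> l'\<close>.
  Writing \<open>l' = t \<cdot> i\<close> with \<open>i\<close> a weak equivalence and
  \<open>t\<close> a fibration makes \<open>b \<cdot> t\<close> a fibration, and a weak equivalence
  because \<open>w\<close> and \<open>i\<close> are, so it has a section. The section, followed into
  the domain of \<open>q\<close>, lifts \<open>u\<close>. This lift is not claimed to extend the
  given one along \<open>w\<close>.\<close>

lemma lift_along_weq: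
  assumes q: "q \<in> Fib C" and w: "w \<in> Weq C" and u: "u \<in> Arr C" "Dom C u = Cod C w" "Cod C u = Cod C q"
    and l: "lifts C q (u \<cdot> w)"
  shows "lifts C q u"
proof -
  have w': "w \<in> Arr C" using w weq_arrow by auto
  obtain l where l: "l \<in> Arr C" "Dom C l = Dom C w" "Cod C l = Dom C q" "q \<cdot> l = u \<cdot> w"
    using l u w' unfolding lifts_def by auto
  obtain a b where pb: "is_pullback C q u a b" using fib_pullback_exists[of q u] q u by auto
  note D = pullbackD[OF pb]
  obtain l' where l': "l' \<in> Arr C" "Dom C l' = Dom C l" "Cod C l' = Dom C a" "a \<cdot> l' = l" "b \<cdot> l' = w"
    by (rule pullback_pair[OF pb l(1) w' _ _ _ l(4)]) (use l w' u in simp_all)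
  obtain i t where it: "i \<in> Weq C" "t \<in> Fib C" "Dom C i = Dom C l'" "Cod C i = Dom C t" "Cod C t = Cod C l'"
    "t \<cdot> i = l'" using factorization[OF l'(1)] .
  have i: "i \<in> Arr C" using it(1) weq_arrow by auto
  have bt: "b \<cdot> t \<in> Fib C" using fib_comp[OF it(2) fib_pullback[OF q pb]] it l' D by simp
  have "(b \<cdot> t) \<cdot> i = w" using i it l' D by simp
  with w have "(b \<cdot> t) \<cdot> i \<in> Weq C" by simp
  then have "b \<cdot> t \<in> Weq C"
    by (rule weq_cancel_right[OF it(1)]) (use bt it l' D in simp_all)
  then obtain k where "k \<in> Hom C (Cod C (b \<cdot> t)) (Dom C (b \<cdot> t))" "(b \<cdot> t) \<cdot> k = Ident C (Cod C (b \<cdot> t))"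
    using acyclic_fib_section bt by blast
  then have k: "k \<in> Arr C" "Dom C k = Dom C u" "Cod C k = Dom C t" "b \<cdot> (t \<cdot> k) = Ident C (Dom C u)"
    using it l' D by (auto simp: Hom_def)
  show ?thesis unfolding lifts_def
    by (rule bexI[of _ "a \<cdot> (t \<cdot> k)"])
       (use k it l' D q u in \<open>simp_all add: rewrite_tail[OF D(9)]\<close>)
qed

section \<open>The categories C(A) and fibrewise homotopy\<close>

lemma fib_slice_category: "category (fib_slice C A)"
proof -
  interpret S: category "slice C A" by (rule slice_category)
  show ?thesis
  proof
    fix f g B D assume "f \<in> Hom (fib_slice C A) B D"
    then show "f \<cdot>\<^bsub>fib_slice C A\<^esub> Ident (fib_slice C A) B = f" "Ident (fib_slice C A) D \<cdot>\<^bsub>fib_slice C A\<^esub> f = f"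
      using S.comp_ident[of f B D] S.ident_comp[of f B D] by (auto simp: fib_slice_hom split: if_splits)
  next
    fix f g h B D E F
    assume "f \<in> Hom (fib_slice C A) B D" "g \<in> Hom (fib_slice C A) D E"
    then show "g \<cdot>\<^bsub>fib_slice C A\<^esub> f \<in> Hom (fib_slice C A) B E"
      using S.comp_hom[of f B D g E] by (auto simp: fib_slice_hom split: if_splits)
    assume "f \<in> Hom (fib_slice C A) B D" "g \<in> Hom (fib_slice C A) D E" "h \<in> Hom (fib_slice C A) E F"
    then show "(h \<cdot>\<^bsub>fib_slice C A\<^esub> g) \<cdot>\<^bsub>fib_slice C A\<^esub> f = h \<cdot>\<^bsub>fib_slice C A\<^esub> (g \<cdot>\<^bsub>fib_slice C A\<^esub> f)"
      using S.comp_assoc[of f B D g E h F] by (auto simp: fib_slice_hom split: if_splits)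
  next
    fix B assume B: "B \<in> Obj (fib_slice C A)"
    then show "Ident (fib_slice C A) B \<in> Hom (fib_slice C A) B B"
      using S.ident_hom[of B] by (auto simp: fib_slice_hom)
  next
    fix f assume "f \<in> Arr (fib_slice C A)"
    then show "Dom (fib_slice C A) f \<in> Obj (fib_slice C A)" "Cod (fib_slice C A) f \<in> Obj (fib_slice C A)"
      by (cases f; auto)+
  qed
qed

text \<open>The product in the full slice already lies in C(A), its map to \<open>A\<close> being a
  composite of two fibrations.\<close>

lemma fib_slice_product:
  assumes "p \<in> Fib C" "q \<in> Fib C" "Cod C p = A" "Cod C q = A"
  shows "\<exists>a b. is_product (fib_slice C A) p q a b"
proof -
  obtain a b where pb: "is_pullback C p q a b" using fib_pullback_exists[of p q] assms by auto
  note D = pullbackD[OF pb]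
  have "p \<cdot> a \<in> Fib C"
    using fib_comp[OF fib_pullback[OF assms(2) pullback_sym[OF pb]] assms(1)] D by simp
  moreover have "is_product (slice C A) p q (p \<cdot> a, a, p) (p \<cdot> a, b, q)"
    by (rule slice_product[OF pb assms(3)])
  ultimately have "is_product (fib_slice C A) p q (p \<cdot> a, a, p) (p \<cdot> a, b, q)"
    using assms(1,2) unfolding is_product_def by (auto simp: fib_slice_hom)
  then show ?thesis by blast
qed

text \<open>On constant paths, \<open>y\<close> at the source paired with \<open>y\<close> at the
  target becomes \<open>(y, y)\<close>, which lifts through \<open>q\<close> by assumption. The
  constant paths form a weak equivalence into the path object, so by \<open>lift_along_weq\<close>
  the pair lifts on all paths; the homotopy from \<open>f\<close> to \<open>g\<close> is a map into
  the path object along which this lift is restricted.\<close>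

lemma fibrewise_homotopic_lifts:
  assumes fh: "fibrewise_homotopic C p f g"
    and y: "y \<in> Arr C" "Dom C y = Dom C p" and q: "q \<in> Fib C" "Cod C q = prd C (Cod C y) (Cod C y)"
    and refl: "lifts C q (pairing C y y)"
  shows "lifts C q (pairing C (y \<cdot> f) (y \<cdot> g))"
proof -
  define D where "D = fib_slice C (Cod C p)"
  interpret D: category D unfolding D_def by (rule fib_slice_category)
  have p: "p \<in> Fib C" using fh by (simp add: fibrewise_homotopic_def)
  have PD: "is_product D p p (pr1 D p p) (pr2 D p p)"
    unfolding D_def by (rule D.chosen_product[unfolded D_def, OF fib_slice_product]) (use p in auto)
  note DD = D.productD[OF PD]
  \<comment> \<open>Arrows of C(A) are triples. Their components are extracted once, so that the
    rest takes place in C.\<close>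
  obtain P s0 where 1: "pr1 D p p = (P, s0, p)" using DD(3) by (cases "pr1 D p p") (auto simp: D_def)
  obtain t0 where 2: "pr2 D p p = (P, t0, p)" using DD(4,5) unfolding 1 by (cases "pr2 D p p") (auto simp: D_def)
  obtain r d h where po: "path_object D p r d"
    and h: "h \<in> Hom C (Dom C f) (Dom C (und d))"
    and sh: "und (pr1 D p p \<cdot>\<^bsub>D\<^esub> d) \<cdot> h = f" and th: "und (pr2 D p p \<cdot>\<^bsub>D\<^esub> d) \<cdot> h = g"
    using fh unfolding fibrewise_homotopic_def D_def[symmetric] Let_def by blast
  obtain r0 R where r: "r = (p, r0, R)" using po by (cases r) (auto simp: path_object_def D_def)
  have "Cod D d = P" using po 1 unfolding path_object_def prd_def by (auto simp: D_def)
  then obtain d0 where d: "d = (R, d0, P)" using po r by (cases d) (auto simp: path_object_def D_def)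
  have id: "Ident D p \<in> Arr D" "Dom D (Ident D p) = p" "Cod D (Ident D p) = p"
    using p by (auto simp: D_def Hom_def)
  have dr: "d \<cdot>\<^bsub>D\<^esub> r = pairing D (Ident D p) (Ident D p)"
    using po by (simp add: path_object_def diagonal_def)
  have ex: "\<exists>a b. is_product D p p a b" using PD by blast
  have "pr1 D p p \<cdot>\<^bsub>D\<^esub> (d \<cdot>\<^bsub>D\<^esub> r) = Ident D p" "pr2 D p p \<cdot>\<^bsub>D\<^esub> (d \<cdot>\<^bsub>D\<^esub> r) = Ident D p"
    unfolding dr using D.pairing(4,5)[of "Ident D p" "Ident D p", unfolded id(3), OF ex] id by simp_all
  then have sdr: "s0 \<cdot> (d0 \<cdot> r0) = Ident C (Dom C p)" "t0 \<cdot> (d0 \<cdot> r0) = Ident C (Dom C p)"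
    unfolding 1 2 d r by (auto simp: D_def)
  have ty: "s0 \<in> Arr C" "Dom C s0 = Dom C P" "Cod C s0 = Dom C p" "t0 \<in> Arr C" "Dom C t0 = Dom C P" "Cod C t0 = Dom C p"
    using DD(1,2) unfolding 1 2 by (auto simp: D_def Hom_def)
  have ty2: "d0 \<in> Arr C" "Dom C d0 = Dom C R" "Cod C d0 = Dom C P" "r0 \<in> Weq C" "r0 \<in> Arr C" "Dom C r0 = Dom C p" "Cod C r0 = Dom C R"
    using po unfolding path_object_def d r by (auto simp: D_def Hom_def)
  have ty3: "h \<in> Arr C" "Dom C h = Dom C f" "Cod C h = Dom C R" using h ty2 by (auto simp: d und_def Hom_def)
  have us: "und (pr1 D p p \<cdot>\<^bsub>D\<^esub> d) = s0 \<cdot> d0" and ut: "und (pr2 D p p \<cdot>\<^bsub>D\<^esub> d) = t0 \<cdot> d0"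
    unfolding 1 2 d by (simp_all add: D_def und_def)
  have f: "f = s0 \<cdot> (d0 \<cdot> h)" unfolding sh[symmetric] us using ty ty2 ty3(1,3) by simp
  have g: "g = t0 \<cdot> (d0 \<cdot> h)" unfolding th[symmetric] ut using ty ty2 ty3(1,3) by simp
  let ?u = "pairing C (y \<cdot> (s0 \<cdot> d0)) (y \<cdot> (t0 \<cdot> d0))"
  have "?u \<cdot> r0 = pairing C y y" using ty ty2 y by (simp add: pairing_comp sdr)
  with refl have "lifts C q (?u \<cdot> r0)" by simp
  then have "lifts C q ?u" by (rule lift_along_weq[OF q(1) ty2(4), rotated 3]) (use ty ty2 y q in simp_all)
  then obtain k where k: "k \<in> Arr C" "Dom C k = Dom C R" "Cod C k = Dom C q" "q \<cdot> k = ?u"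
    using ty ty2 y by (auto simp: lifts_def)
  then show ?thesis unfolding lifts_def f g
    using k ty ty2 ty3 y q by (intro bexI[of _ "k \<cdot> h"]) (simp_all add: rewrite_tail1[OF k(4)] pairing_comp)
qed

text \<open>Fibrations over \<open>X\<close>, up to factoring through each other, serve as the predicates on \<open>X\<close>.\<close>

definition displayed :: "'o \<Rightarrow> ('m \<Rightarrow> bool) \<Rightarrow> bool" where
  "displayed X \<Phi> \<longleftrightarrow> (\<exists>d \<in> Fib C. Cod C d = X \<and> (\<forall>h \<in> Arr C. Cod C h = X \<longrightarrow> \<Phi> h = lifts C d h))"

section \<open>Substitution and conjunction for displayed predicates\<close>

lemma lifts_pullback:
  assumes pb: "is_pullback C d u a b" and h: "h \<in> Arr C" "Cod C h = Dom C u"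
  shows "lifts C b h \<longleftrightarrow> lifts C d (u \<cdot> h)"
proof
  note D = pullbackD[OF pb]
  assume "lifts C b h"
  then obtain k where k: "k \<in> Arr C" "Dom C k = Dom C h" "Cod C k = Dom C b" "b \<cdot> k = h"
    by (auto simp: lifts_def)
  then show "lifts C d (u \<cdot> h)" unfolding lifts_def
    using D h by (intro bexI[of _ "a \<cdot> k"]) (simp_all add: rewrite_tail[OF D(9)])
next
  note D = pullbackD[OF pb]
  assume "lifts C d (u \<cdot> h)"
  then obtain k where k: "k \<in> Arr C" "Dom C k = Dom C h" "Cod C k = Dom C d" "d \<cdot> k = u \<cdot> h"
    using D h by (auto simp: lifts_def)
  obtain l where "l \<in> Arr C" "Dom C l = Dom C k" "Cod C l = Dom C a" "a \<cdot> l = k" "b \<cdot> l = h"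
    by (rule pullback_pair[OF pb k(1) h(1) k(2,3) h(2) k(4)])
  then show "lifts C b h" unfolding lifts_def using k D by (intro bexI[of _ l]) simp_all
qed

lemma displayed_subst:
  assumes "displayed X \<Phi>" "u \<in> Arr C" "Cod C u = X"
  shows "displayed (Dom C u) (\<lambda>h. \<Phi> (u \<cdot> h))"
proof -
  obtain d where d: "d \<in> Fib C" "Cod C d = X" "\<And>h. \<lbrakk>h \<in> Arr C; Cod C h = X\<rbrakk> \<Longrightarrow> \<Phi> h = lifts C d h"
    using assms(1) unfolding displayed_def by auto
  obtain a b where pb: "is_pullback C d u a b" using fib_pullback_exists[of d u] d assms by auto
  show ?thesis unfolding displayed_def
    using fib_pullback[OF d(1) pb] pullbackD[OF pb] lifts_pullback[OF pb] d(3) assms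
    by (intro bexI[of _ b]) auto
qed

lemma displayed_cong:
  assumes "displayed X \<Phi>" "\<And>h. \<lbrakk>h \<in> Arr C; Cod C h = X\<rbrakk> \<Longrightarrow> \<Phi> h = \<Psi> h"
  shows "displayed X \<Psi>"
  using assms unfolding displayed_def by auto

text \<open>The fibre product of the two fibrations represents the conjunction: a lift through it is
  a pair of lifts.\<close>

lemma displayed_conj:
  assumes "displayed X \<Phi>" "displayed X \<Psi>"
  shows "displayed X (\<lambda>h. \<Phi> h \<and> \<Psi> h)"
proof -
  obtain d where d: "d \<in> Fib C" "Cod C d = X" "\<And>h. \<lbrakk>h \<in> Arr C; Cod C h = X\<rbrakk> \<Longrightarrow> \<Phi> h = lifts C d h"
    using assms(1) unfolding displayed_def by auto
  obtain e where e: "e \<in> Fib C" "Cod C e = X" "\<And>h. \<lbrakk>h \<in> Arr C; Cod C h = X\<rbrakk> \<Longrightarrow> \<Psi> h = lifts C e h"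
    using assms(2) unfolding displayed_def by auto
  obtain a b where pb: "is_pullback C d e a b" using fib_pullback_exists[of d e] d e by auto
  note D = pullbackD[OF pb]
  have "lifts C (e \<cdot> b) h \<longleftrightarrow> lifts C d h \<and> lifts C e h" if h: "h \<in> Arr C" "Cod C h = X" for h
  proof
    assume "lifts C (e \<cdot> b) h"
    then obtain k where "k \<in> Arr C" "Dom C k = Dom C h" "Cod C k = Dom C (e \<cdot> b)" "(e \<cdot> b) \<cdot> k = h"
      unfolding lifts_def by blast
    then have k: "k \<in> Arr C" "Dom C k = Dom C h" "Cod C k = Dom C b" "e \<cdot> (b \<cdot> k) = h"
      using D by simp_all
    then have "d \<cdot> (a \<cdot> k) = h" using D by (simp add: rewrite_tail[OF D(9)])
    then have "lifts C d h" unfolding lifts_def using k D by (intro bexI[of _ "a \<cdot> k"]) simp_all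
    moreover have "lifts C e h" unfolding lifts_def using k D by (intro bexI[of _ "b \<cdot> k"]) simp_all
    ultimately show "lifts C d h \<and> lifts C e h" ..
  next
    assume "lifts C d h \<and> lifts C e h"
    then obtain k l where k: "k \<in> Arr C" "Dom C k = Dom C h" "Cod C k = Dom C d" "d \<cdot> k = h"
      and l: "l \<in> Arr C" "Dom C l = Dom C h" "Cod C l = Dom C e" "e \<cdot> l = h"
      by (auto simp: lifts_def)
    obtain n where "n \<in> Arr C" "Dom C n = Dom C k" "Cod C n = Dom C a" "a \<cdot> n = k" "b \<cdot> n = l"
      using pullback_pair[OF pb k(1) l(1)] k l by metis
    then show "lifts C (e \<cdot> b) h" unfolding lifts_def using D k l by (intro bexI[of _ n]) simp_all
  qed
  then show ?thesis unfolding displayed_def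
    using fib_comp[OF fib_pullback[OF d(1) pb] e(1)] D d e by (intro bexI[of _ "e \<cdot> b"]) auto
qed

end

section \<open>Universal quantification from weak Pi-types\<close>

locale Pi_path_category = path_category C
  for C :: "('o, 'm, 'z) fcat_scheme" (structure) +
  assumes weak_Pi_types: "weak_homotopy_Pi_types C"
begin

lemma weak_Pi:
  assumes "f \<in> Fib C" "\<alpha> \<in> Fib C" "Cod C f = Dom C \<alpha>"
  obtains \<pi> a b ev where "\<pi> \<in> Fib C" "Cod C \<pi> = Cod C \<alpha>" "is_pullback C \<alpha> \<pi> a b"
    "ev \<in> Arr C" "Dom C ev = Dom C a" "Cod C ev = Dom C f" "f \<cdot> ev = a"
    "\<And>g a' b' m. \<lbrakk>is_pullback C \<alpha> g a' b'; m \<in> Arr C; Dom C m = Dom C a'; Cod C m = Dom C f; f \<cdot> m = a'\<rbrakk> \<Longrightarrow>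
      \<exists>n k. n \<in> Arr C \<and> Dom C n = Dom C g \<and> Cod C n = Dom C \<pi> \<and> \<pi> \<cdot> n = g \<and>
        k \<in> Arr C \<and> Dom C k = Dom C a' \<and> Cod C k = Dom C a \<and> a \<cdot> k = a' \<and> b \<cdot> k = n \<cdot> b' \<and>
        fibrewise_homotopic C f m (ev \<cdot> k)"
proof -
  from weak_Pi_types[unfolded weak_homotopy_Pi_types_def, rule_format, OF assms]
  obtain \<pi> a b ev where *: "\<pi> \<in> Fib C" "Cod C \<pi> = Cod C \<alpha>" "is_pullback C \<alpha> \<pi> a b"
    "ev \<in> Hom C (Dom C a) (Dom C f)" "f \<cdot> ev = a"
    and univ: "\<forall>g a' b' m. is_pullback C \<alpha> g a' b' \<and>
                m \<in> Hom C (Dom C a') (Dom C f) \<and> f \<cdot> m = a' \<longrightarrow>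
                (\<exists>n \<in> Hom C (Dom C g) (Dom C \<pi>). \<pi> \<cdot> n = g \<and>
                   (\<exists>k \<in> Hom C (Dom C a') (Dom C a).
                      a \<cdot> k = a' \<and> b \<cdot> k = n \<cdot> b' \<and> fibrewise_homotopic C f m (ev \<cdot> k)))"
    by (elim bexE exE conjE)
  show ?thesis
  proof (rule that[OF *(1-3) _ _ _ *(5)])
    fix g a' b' m assume "is_pullback C \<alpha> g a' b'" "m \<in> Arr C" "Dom C m = Dom C a'" "Cod C m = Dom C f" "f \<cdot> m = a'"
    then have "is_pullback C \<alpha> g a' b' \<and> m \<in> Hom C (Dom C a') (Dom C f) \<and> f \<cdot> m = a'" by (simp add: Hom_def)
    from univ[rule_format, OF this]
    show "\<exists>n k. n \<in> Arr C \<and> Dom C n = Dom C g \<and> Cod C n = Dom C \<pi> \<and> \<pi> \<cdot> n = g \<and>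
        k \<in> Arr C \<and> Dom C k = Dom C a' \<and> Cod C k = Dom C a \<and> a \<cdot> k = a' \<and> b \<cdot> k = n \<cdot> b' \<and>
        fibrewise_homotopic C f m (ev \<cdot> k)"
      unfolding Hom_def by blast
  qed (use *(4) in \<open>simp_all add: Hom_def\<close>)
qed

text \<open>The representing fibration is the weak Pi-type of \<open>d\<close> along
  \<open>\<alpha>\<close>. From a lift of \<open>h\<close> into it, \<open>ev\<close> produces a
  lift at every instance \<open>j\<close>. Conversely, the quantifier is applied to a single
  universal instance, whose witness is then abstracted.\<close>

lemma displayed_forall:
  assumes \<alpha>: "\<alpha> \<in> Fib C" and disp: "displayed (Dom C \<alpha>) \<Phi>"
  shows "displayed (Cod C \<alpha>) (\<lambda>h. \<forall>u \<in> Arr C. \<forall>j \<in> Arr C. Dom C u = Dom C j \<and> Cod C u = Dom C h \<and>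
    Cod C j = Dom C \<alpha> \<and> \<alpha> \<cdot> j = h \<cdot> u \<longrightarrow> \<Phi> j)"
proof -
  obtain d where d: "d \<in> Fib C" "Cod C d = Dom C \<alpha>"
    "\<And>h. \<lbrakk>h \<in> Arr C; Cod C h = Dom C \<alpha>\<rbrakk> \<Longrightarrow> \<Phi> h = lifts C d h"
    using disp unfolding displayed_def by auto
  obtain \<pi> a b ev where \<pi>: "\<pi> \<in> Fib C" "Cod C \<pi> = Cod C \<alpha>" "is_pullback C \<alpha> \<pi> a b"
    and ev: "ev \<in> Arr C" "Dom C ev = Dom C a" "Cod C ev = Dom C d" "d \<cdot> ev = a"
    and univ: "\<And>g a' b' m. \<lbrakk>is_pullback C \<alpha> g a' b'; m \<in> Arr C; Dom C m = Dom C a'; Cod C m = Dom C d; d \<cdot> m = a'\<rbrakk> \<Longrightarrow>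
      \<exists>n k. n \<in> Arr C \<and> Dom C n = Dom C g \<and> Cod C n = Dom C \<pi> \<and> \<pi> \<cdot> n = g \<and>
        k \<in> Arr C \<and> Dom C k = Dom C a' \<and> Cod C k = Dom C a \<and> a \<cdot> k = a' \<and> b \<cdot> k = n \<cdot> b' \<and>
        fibrewise_homotopic C d m (ev \<cdot> k)"
    using weak_Pi[OF d(1) \<alpha> d(2)] by blast
  note D = pullbackD[OF \<pi>(3)]
  show ?thesis unfolding displayed_def
  proof (intro bexI[of _ \<pi>] conjI ballI impI iffI)
    fix h assume h: "h \<in> Arr C" "Cod C h = Cod C \<alpha>" and all: "\<forall>u \<in> Arr C. \<forall>j \<in> Arr C. Dom C u = Dom C j \<and> Cod C u = Dom C h \<and>
      Cod C j = Dom C \<alpha> \<and> \<alpha> \<cdot> j = h \<cdot> u \<longrightarrow> \<Phi> j"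
    obtain a' b' where pb: "is_pullback C \<alpha> h a' b'" using fib_pullback_exists[of \<alpha> h] \<alpha> h by auto
    note D' = pullbackD[OF pb]
    \<comment> \<open>The universal instance of the quantifier: the stage is \<open>b'\<close> and
      the element \<open>a'\<close>, the two legs of the pullback of \<open>\<alpha>\<close> and
      \<open>h\<close>.\<close>
    have "\<Phi> a'" using all D' by auto
    then obtain m where "m \<in> Arr C" "Dom C m = Dom C a'" "Cod C m = Dom C d" "d \<cdot> m = a'"
      using d(3)[of a'] D' by (auto simp: lifts_def)
    from univ[OF pb this] show "lifts C \<pi> h" by (auto simp: lifts_def)
  next
    fix h u j assume h: "h \<in> Arr C" "Cod C h = Cod C \<alpha>" "lifts C \<pi> h"
      and uj: "u \<in> Arr C" "j \<in> Arr C" "Dom C u = Dom C j \<and> Cod C u = Dom C h \<and> Cod C j = Dom C \<alpha> \<and> \<alpha> \<cdot> j = h \<cdot> u"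
    obtain n where n: "n \<in> Arr C" "Dom C n = Dom C h" "Cod C n = Dom C \<pi>" "\<pi> \<cdot> n = h"
      using h by (auto simp: lifts_def)
    obtain k where k: "k \<in> Arr C" "Dom C k = Dom C j" "Cod C k = Dom C a" "a \<cdot> k = j" "b \<cdot> k = n \<cdot> u"
      by (rule pullback_pair[OF \<pi>(3), of j "n \<cdot> u"]) (use uj n h D in \<open>simp_all add: rewrite_tail1[OF n(4)]\<close>)
    have "lifts C d j" unfolding lifts_def
      by (rule bexI[of _ "ev \<cdot> k"]) (use k ev d D in \<open>simp_all add: rewrite_tail1[OF ev(4)]\<close>)
    then show "\<Phi> j" using d(3)[of j] uj by auto
  qed (use \<pi> in auto)
qed

end

section \<open>The homotopy exact completion\<close>

text \<open>\<open>a\<close> and \<open>b\<close> are generalized elements at a common stage. The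
  typing is part of the relation, so that a single fact \<open>eqv C A a b\<close> supplies all side
  conditions through \<open>eqvD\<close>.\<close>

definition eqv :: "('o, 'm, 'z) cat_scheme \<Rightarrow> 'o \<times> 'm \<Rightarrow> 'm \<Rightarrow> 'm \<Rightarrow> bool" where
  "eqv C A a b \<longleftrightarrow> a \<in> Arr C \<and> b \<in> Arr C \<and> Dom C a = Dom C b \<and> Cod C a = fst A \<and> Cod C b = fst A \<and>
     lifts C (snd A) (pairing C a b)"

definition hex_class ::
  "('o, 'm, 'z) fcat_scheme \<Rightarrow> 'o \<times> 'm \<Rightarrow> 'o \<times> 'm \<Rightarrow> 'm \<Rightarrow> ('o \<times> 'm) \<times> ('o \<times> 'm) \<times> 'm set" where
  "hex_class C A B f = (A, B, hex_rel C A B `` {f})"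

lemma Hex_simps [simp]:
  "A \<in> Obj (Hex C) \<longleftrightarrow> fst A \<in> Obj C \<and> heq_rel C (fst A) (snd A)"
  "Dom (Hex C) (A, B, F) = A"
  "Cod (Hex C) (A, B, F) = B"
  "Ident (Hex C) A = hex_class C A A (Ident C (fst A))"
  "Dom (Hex C) (hex_class C A B f) = A"
  "Cod (Hex C) (hex_class C A B f) = B"
  by (auto simp: Hex_def hex_class_def Let_def split: prod.splits)

declare Hex_simps(1) [simp del]

lemma eqvD:
  assumes "eqv C A a b"
  shows "a \<in> Arr C" "b \<in> Arr C" "Dom C a = Dom C b" "Cod C a = fst A" "Cod C b = fst A"
  using assms by (auto simp: eqv_def)

context path_category
begin

section \<open>Objects of \<open>Hex C\<close> as setoids of generalized elements\<close>

lemma Hex_obj [simp]: "A \<in> Obj (Hex C) \<Longrightarrow> fst A \<in> Obj C"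
  by (simp add: Hex_simps(1))

lemma Hex_obj_fib:
  assumes "A \<in> Obj (Hex C)"
  shows "snd A \<in> Fib C" "Cod C (snd A) = prd C (fst A) (fst A)"
  using assms by (auto simp: Hex_simps(1) heq_rel_def)

lemma lifts_comp:
  assumes "lifts C d h" "d \<in> Arr C" "u \<in> Arr C" "Cod C u = Dom C h"
  shows "lifts C d (h \<cdot> u)"
proof -
  obtain k where k: "k \<in> Arr C" "Dom C k = Dom C h" "Cod C k = Dom C d" and dk: "d \<cdot> k = h"
    using assms(1) by (auto simp: lifts_def)
  show ?thesis unfolding lifts_def dk[symmetric]
    using k assms(2-4) by (intro bexI[of _ "k \<cdot> u"]) simp_all
qed

lemma eqv_comp:
  assumes "A \<in> Obj (Hex C)" "eqv C A a b" "u \<in> Arr C" "Cod C u = Dom C b"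
  shows "eqv C A (a \<cdot> u) (b \<cdot> u)"
  using assms lifts_comp[of "snd A" "pairing C a b" u] Hex_obj_fib[OF assms(1)]
  unfolding eqv_def by (simp add: pairing_comp)

text \<open>The reflexivity map of the relation is the case of the identity; every other element is
  a substitution instance of it.\<close>

lemma eqv_refl:
  assumes A: "A \<in> Obj (Hex C)" and a: "a \<in> Arr C" "Cod C a = fst A"
  shows "eqv C A a a"
proof -
  obtain r where r: "r \<in> Hom C (fst A) (Dom C (snd A))" "snd A \<cdot> r = diagonal C (fst A)"
    using A unfolding Hex_simps heq_rel_def Let_def by blast
  have "eqv C A (Ident C (fst A)) (Ident C (fst A))"
    unfolding eqv_def lifts_def using r A by (auto simp: Hom_def diagonal_def)
  from eqv_comp[OF A this a(1)] show ?thesis using a A by simp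
qed

lemma eqv_sym:
  assumes A: "A \<in> Obj (Hex C)" and ab: "eqv C A a b"
  shows "eqv C A b a"
proof -
  let ?X = "fst A" and ?\<rho> = "snd A"
  obtain s where s: "s \<in> Arr C" "Dom C s = Dom C ?\<rho>" "Cod C s = Dom C ?\<rho>"
    "(pr1 C ?X ?X \<cdot> ?\<rho>) \<cdot> s = pr2 C ?X ?X \<cdot> ?\<rho>" "(pr2 C ?X ?X \<cdot> ?\<rho>) \<cdot> s = pr1 C ?X ?X \<cdot> ?\<rho>"
    using A unfolding Hex_simps heq_rel_def Let_def Hom_def by blast
  note ty = eqvD[OF ab] Hex_obj_fib[OF A]
  obtain k where k: "k \<in> Arr C" "Dom C k = Dom C b" "Cod C k = Dom C ?\<rho>" "?\<rho> \<cdot> k = pairing C a b"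
    using ab ty unfolding eqv_def lifts_def by auto
  have "pr1 C ?X ?X \<cdot> (?\<rho> \<cdot> (s \<cdot> k)) = b" "pr2 C ?X ?X \<cdot> (?\<rho> \<cdot> (s \<cdot> k)) = a"
  proof -
    have "((pr1 C ?X ?X \<cdot> ?\<rho>) \<cdot> s) \<cdot> k = b" "((pr2 C ?X ?X \<cdot> ?\<rho>) \<cdot> s) \<cdot> k = a"
      unfolding s(4,5) using A k s(1-3) ty by simp_all
    then show "pr1 C ?X ?X \<cdot> (?\<rho> \<cdot> (s \<cdot> k)) = b" "pr2 C ?X ?X \<cdot> (?\<rho> \<cdot> (s \<cdot> k)) = a"
      using A k s(1-3) ty by simp_all
  qed
  then have "?\<rho> \<cdot> (s \<cdot> k) = pairing C b a"
    using pairing_eta[of ?X ?X "?\<rho> \<cdot> (s \<cdot> k)"] A k s(1-3) ty by simp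
  then show ?thesis unfolding eqv_def lifts_def
    using ty k s(1-3) by (intro conjI bexI[of _ "s \<cdot> k"]) simp_all
qed

lemma eqv_trans:
  assumes A: "A \<in> Obj (Hex C)" and ab: "eqv C A a b" and bc: "eqv C A b c"
  shows "eqv C A a c"
proof -
  let ?X = "fst A" and ?\<rho> = "snd A"
  obtain q\<^sub>1 q\<^sub>2 t where pb: "is_pullback C (pr2 C ?X ?X \<cdot> ?\<rho>) (pr1 C ?X ?X \<cdot> ?\<rho>) q\<^sub>1 q\<^sub>2"
    and t: "t \<in> Arr C" "Dom C t = Dom C q\<^sub>1" "Cod C t = Dom C ?\<rho>"
    "(pr1 C ?X ?X \<cdot> ?\<rho>) \<cdot> t = (pr1 C ?X ?X \<cdot> ?\<rho>) \<cdot> q\<^sub>1" "(pr2 C ?X ?X \<cdot> ?\<rho>) \<cdot> t = (pr2 C ?X ?X \<cdot> ?\<rho>) \<cdot> q\<^sub>2"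
    using A unfolding Hex_simps heq_rel_def Let_def Hom_def by blast
  note D = pullbackD[OF pb]
  note ty = eqvD[OF ab] eqvD[OF bc] Hex_obj_fib[OF A]
  obtain k where k: "k \<in> Arr C" "Dom C k = Dom C c" "Cod C k = Dom C ?\<rho>" "?\<rho> \<cdot> k = pairing C a b"
    using ab ty unfolding eqv_def lifts_def by auto
  obtain l where l: "l \<in> Arr C" "Dom C l = Dom C c" "Cod C l = Dom C ?\<rho>" "?\<rho> \<cdot> l = pairing C b c"
    using bc ty unfolding eqv_def lifts_def by auto
  obtain m where m: "m \<in> Arr C" "Dom C m = Dom C k" "Cod C m = Dom C q\<^sub>1" "q\<^sub>1 \<cdot> m = k" "q\<^sub>2 \<cdot> m = l"
    by (rule pullback_pair[OF pb, of k l]) (use A k l ty in simp_all)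
  have dq: "Cod C q\<^sub>1 = Dom C ?\<rho>" "Cod C q\<^sub>2 = Dom C ?\<rho>" using D A ty by simp_all
  have "pr1 C ?X ?X \<cdot> (?\<rho> \<cdot> (t \<cdot> m)) = a" "pr2 C ?X ?X \<cdot> (?\<rho> \<cdot> (t \<cdot> m)) = c"
  proof -
    have "((pr1 C ?X ?X \<cdot> ?\<rho>) \<cdot> t) \<cdot> m = a" "((pr2 C ?X ?X \<cdot> ?\<rho>) \<cdot> t) \<cdot> m = c"
      unfolding t(4,5) using A k l m t(1-3) ty D(3,4,8) dq by simp_all
    then show "pr1 C ?X ?X \<cdot> (?\<rho> \<cdot> (t \<cdot> m)) = a" "pr2 C ?X ?X \<cdot> (?\<rho> \<cdot> (t \<cdot> m)) = c"
      using A m(1-3) t(1-3) ty by simp_all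
  qed
  then have "?\<rho> \<cdot> (t \<cdot> m) = pairing C a c"
    using pairing_eta[of ?X ?X "?\<rho> \<cdot> (t \<cdot> m)"] A m t(1-3) ty by simp
  then show ?thesis unfolding eqv_def lifts_def
    using ty k m t(1-3) by (intro conjI bexI[of _ "t \<cdot> m"]) simp_all
qed

lemma displayed_eqv:
  assumes A: "A \<in> Obj (Hex C)" and ab: "a \<in> Arr C" "b \<in> Arr C" "Dom C a = Dom C b"
    "Cod C a = fst A" "Cod C b = fst A"
  shows "displayed (Dom C b) (\<lambda>h. eqv C A (a \<cdot> h) (b \<cdot> h))"
proof -
  have "displayed (prd C (fst A) (fst A)) (lifts C (snd A))"
    unfolding displayed_def using Hex_obj_fib[OF A] by auto
  from displayed_subst[OF this, of "pairing C a b"]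
  have "displayed (Dom C b) (\<lambda>h. lifts C (snd A) (pairing C a b \<cdot> h))" using ab by simp
  then show ?thesis
    by (rule displayed_cong) (use ab in \<open>simp add: eqv_def pairing_comp\<close>)
qed

text \<open>The structure maps of a homotopy equivalence relation come from \<open>refl\<close>,
  \<open>sym\<close> and \<open>trans\<close> by the Yoneda principle, that is, by applying these to
  generic elements: the identity of \<open>X\<close>, the two projections of the relation, and the
  projections of its fibre product with itself. Stability under change of stage comes from the
  representing fibration.\<close>

lemma Hex_objI:
  assumes X: "X \<in> Obj C" and disp: "displayed (prd C X X) (\<lambda>h. Q (pr1 C X X \<cdot> h) (pr2 C X X \<cdot> h))"
    and refl: "\<And>a. \<lbrakk>a \<in> Arr C; Cod C a = X\<rbrakk> \<Longrightarrow> Q a a"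
    and sym: "\<And>a b. \<lbrakk>a \<in> Arr C; b \<in> Arr C; Cod C a = X; Cod C b = X; Dom C a = Dom C b; Q a b\<rbrakk> \<Longrightarrow> Q b a"
    and trans: "\<And>a b c. \<lbrakk>a \<in> Arr C; b \<in> Arr C; c \<in> Arr C; Cod C a = X; Cod C b = X; Cod C c = X;
      Dom C a = Dom C b; Dom C b = Dom C c; Q a b; Q b c\<rbrakk> \<Longrightarrow> Q a c"
  obtains A where "A \<in> Obj (Hex C)" "fst A = X"
    "\<And>a b. eqv C A a b \<longleftrightarrow> a \<in> Arr C \<and> b \<in> Arr C \<and> Dom C a = Dom C b \<and> Cod C a = X \<and> Cod C b = X \<and> Q a b"
proof -
  obtain d where d: "d \<in> Fib C" "Cod C d = prd C X X" and dQ: "\<And>h. \<lbrakk>h \<in> Arr C; Cod C h = prd C X X\<rbrakk> \<Longrightarrow>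
      Q (pr1 C X X \<cdot> h) (pr2 C X X \<cdot> h) = lifts C d h"
    using disp unfolding displayed_def by auto
  have pQ: "lifts C d (pairing C a b) \<longleftrightarrow> Q a b"
    if "a \<in> Arr C" "b \<in> Arr C" "Dom C a = Dom C b" "Cod C a = X" "Cod C b = X" for a b
    using dQ[of "pairing C a b"] that by simp
  define p\<^sub>1 p\<^sub>2 where "p\<^sub>1 = pr1 C X X \<cdot> d" and "p\<^sub>2 = pr2 C X X \<cdot> d"
  have p: "p\<^sub>1 \<in> Fib C" "p\<^sub>2 \<in> Fib C" "Dom C p\<^sub>1 = Dom C d" "Dom C p\<^sub>2 = Dom C d" "Cod C p\<^sub>1 = X" "Cod C p\<^sub>2 = X"
    using d X fib_comp by (simp_all add: p\<^sub>1_def p\<^sub>2_def)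
  have lift: "\<exists>k \<in> Hom C (Dom C b) (Dom C d). p\<^sub>1 \<cdot> k = a \<and> p\<^sub>2 \<cdot> k = b"
    if ab: "a \<in> Arr C" "b \<in> Arr C" "Dom C a = Dom C b" "Cod C a = X" "Cod C b = X" "Q a b" for a b
  proof -
    obtain k where k: "k \<in> Arr C" "Dom C k = Dom C b" "Cod C k = Dom C d" "d \<cdot> k = pairing C a b"
      using pQ[OF ab(1-5)] ab by (auto simp: lifts_def)
    then show ?thesis
      by (intro bexI[of _ k]) (use d X ab in \<open>simp_all add: p\<^sub>1_def p\<^sub>2_def Hom_def\<close>)
  qed
  \<comment> \<open>The generic related pair, witnessed by the tautological lift of \<open>d\<close>
    through itself.\<close>
  have p12: "Q p\<^sub>1 p\<^sub>2"
  proof -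
    have "lifts C d d" unfolding lifts_def using d by (intro bexI[of _ "Ident C (Dom C d)"]) simp_all
    then show ?thesis using dQ[of d] d by (simp add: p\<^sub>1_def p\<^sub>2_def)
  qed
  have ob: "heq_rel C X d" unfolding heq_rel_def Let_def p\<^sub>1_def[symmetric] p\<^sub>2_def[symmetric]
  proof (intro conjI)
    have "lifts C d (pairing C (Ident C X) (Ident C X))" using pQ X refl by simp
    then show "\<exists>r \<in> Hom C X (Dom C d). d \<cdot> r = diagonal C X"
      using X by (auto simp: lifts_def diagonal_def Hom_def)
    show "\<exists>s \<in> Hom C (Dom C d) (Dom C d). p\<^sub>1 \<cdot> s = p\<^sub>2 \<and> p\<^sub>2 \<cdot> s = p\<^sub>1"
      using lift[of p\<^sub>2 p\<^sub>1] sym[OF _ _ _ _ _ p12] p by simp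
    obtain q\<^sub>1 q\<^sub>2 where pb: "is_pullback C p\<^sub>2 p\<^sub>1 q\<^sub>1 q\<^sub>2" using fib_pullback_exists[of p\<^sub>2 p\<^sub>1] p by auto
    note D = pullbackD[OF pb]
    have Q_comp: "Q (p\<^sub>1 \<cdot> u) (p\<^sub>2 \<cdot> u)" if "u \<in> Arr C" "Cod C u = Dom C d" for u
    proof -
      have "lifts C d (d \<cdot> u)" unfolding lifts_def using that d by (intro bexI[of _ u]) simp_all
      then show ?thesis using dQ[of "d \<cdot> u"] that d X by (simp add: p\<^sub>1_def p\<^sub>2_def)
    qed
    have "Q (p\<^sub>1 \<cdot> q\<^sub>1) (p\<^sub>2 \<cdot> q\<^sub>2)"
    proof (rule trans)
      show "Q (p\<^sub>1 \<cdot> q\<^sub>1) (p\<^sub>2 \<cdot> q\<^sub>1)" using Q_comp[of q\<^sub>1] D p by simp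
      show "Q (p\<^sub>2 \<cdot> q\<^sub>1) (p\<^sub>2 \<cdot> q\<^sub>2)" using Q_comp[of q\<^sub>2] D p by simp
    qed (use D p in simp_all)
    then show "\<exists>q\<^sub>1 q\<^sub>2. is_pullback C p\<^sub>2 p\<^sub>1 q\<^sub>1 q\<^sub>2 \<and>
        (\<exists>t \<in> Hom C (Dom C q\<^sub>1) (Dom C d). p\<^sub>1 \<cdot> t = p\<^sub>1 \<cdot> q\<^sub>1 \<and> p\<^sub>2 \<cdot> t = p\<^sub>2 \<cdot> q\<^sub>2)"
      using lift[of "p\<^sub>1 \<cdot> q\<^sub>1" "p\<^sub>2 \<cdot> q\<^sub>2"] D p pb by (intro exI[of _ q\<^sub>1] exI[of _ q\<^sub>2]) simp
  qed (use d in auto)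
  show ?thesis
  proof (rule that[of "(X, d)"])
    show "(X, d) \<in> Obj (Hex C)" using X ob by (simp add: Hex_simps)
  qed (use pQ in \<open>auto simp: eqv_def\<close>)
qed

section \<open>Morphisms of \<open>Hex C\<close> and their composition\<close>

lemma hex_maps_iff:
  assumes A: "A \<in> Obj (Hex C)" and B: "B \<in> Obj (Hex C)"
  shows "f \<in> hex_maps C A B \<longleftrightarrow> f \<in> Arr C \<and> Dom C f = fst A \<and> Cod C f = fst B \<and>
    (\<forall>a b. eqv C A a b \<longrightarrow> eqv C B (f \<cdot> a) (f \<cdot> b))"
proof -
  let ?X = "fst A"
  note fA = Hex_obj_fib[OF A] and fB = Hex_obj_fib[OF B]
  have "(\<exists>\<phi> \<in> Hom C (Dom C (snd A)) (Dom C (snd B)). snd B \<cdot> \<phi> = cross C f f \<cdot> snd A) \<longleftrightarrow>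
    (\<forall>a b. eqv C A a b \<longrightarrow> eqv C B (f \<cdot> a) (f \<cdot> b))" (is "?L \<longleftrightarrow> ?R")
    if f: "f \<in> Arr C" "Dom C f = fst A" "Cod C f = fst B"
  proof -
    have c: "cross C f f = pairing C (f \<cdot> pr1 C ?X ?X) (f \<cdot> pr2 C ?X ?X)"
      using f by (simp add: cross_def)
    show ?thesis
    proof
      assume ?L
      then obtain \<phi> where \<phi>: "\<phi> \<in> Arr C" "Dom C \<phi> = Dom C (snd A)" "Cod C \<phi> = Dom C (snd B)"
        "snd B \<cdot> \<phi> = cross C f f \<cdot> snd A" by (auto simp: Hom_def)
      show ?R
      proof (intro allI impI)
        fix a b assume ab: "eqv C A a b"
        note ty = eqvD[OF ab]
        obtain k where k: "k \<in> Arr C" "Dom C k = Dom C b" "Cod C k = Dom C (snd A)" "snd A \<cdot> k = pairing C a b"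
          using ab ty unfolding eqv_def lifts_def by auto
        have cA: "cross C f f \<in> Arr C" "Dom C (cross C f f) = prd C ?X ?X"
          "Cod C (cross C f f) = prd C (fst B) (fst B)" using f A unfolding c by simp_all
        have "snd B \<cdot> (\<phi> \<cdot> k) = cross C f f \<cdot> (snd A \<cdot> k)"
          by (rule rewrite_tail[OF \<phi>(4)]) (use \<phi> k fA fB cA in simp_all)
        also have "\<dots> = pairing C (f \<cdot> a) (f \<cdot> b)"
          unfolding k(4) c using f A ty by (simp add: pairing_comp)
        finally show "eqv C B (f \<cdot> a) (f \<cdot> b)" unfolding eqv_def lifts_def
          using ty f \<phi> k fB by (intro conjI bexI[of _ "\<phi> \<cdot> k"]) simp_all
      qed
    next
      assume ?R
      \<comment> \<open>The two projections of the relation are the generic related pair of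
        \<open>A\<close>. That \<open>f\<close> preserves this pair is the map
        \<open>\<phi>\<close>; all other related pairs are substitution instances of it.\<close>
      moreover have "eqv C A (pr1 C ?X ?X \<cdot> snd A) (pr2 C ?X ?X \<cdot> snd A)"
      proof -
        have "lifts C (snd A) (snd A)"
          unfolding lifts_def using fA by (intro bexI[of _ "Ident C (Dom C (snd A))"]) simp_all
        then show ?thesis unfolding eqv_def using fA A pairing_eta[of ?X ?X "snd A"] by simp
      qed
      ultimately have "eqv C B (f \<cdot> (pr1 C ?X ?X \<cdot> snd A)) (f \<cdot> (pr2 C ?X ?X \<cdot> snd A))" by blast
      moreover have "pairing C (f \<cdot> (pr1 C ?X ?X \<cdot> snd A)) (f \<cdot> (pr2 C ?X ?X \<cdot> snd A)) = cross C f f \<cdot> snd A"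
        unfolding c using f A fA by (simp add: pairing_comp)
      ultimately have l: "lifts C (snd B) (cross C f f \<cdot> snd A)" by (simp add: eqv_def)
      have "Dom C (cross C f f \<cdot> snd A) = Dom C (snd A)" unfolding c using f A fA by simp
      with l show ?L unfolding lifts_def Hom_def by auto
    qed
  qed
  then show ?thesis unfolding hex_maps_def by (cases A; cases B) (auto simp: Hom_def)
qed

lemma hex_mapsD:
  assumes "f \<in> hex_maps C A B"
  shows "f \<in> Arr C" "Dom C f = fst A" "Cod C f = fst B"
  using assms by (cases A; cases B; auto simp: hex_maps_def Hom_def)+

lemma hex_maps_eqv:
  assumes "f \<in> hex_maps C A B" "A \<in> Obj (Hex C)" "B \<in> Obj (Hex C)" "eqv C A a b"
  shows "eqv C B (f \<cdot> a) (f \<cdot> b)"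
  using assms hex_maps_iff by blast

lemma hex_rel_iff:
  assumes "B \<in> Obj (Hex C)"
  shows "(f, g) \<in> hex_rel C A B \<longleftrightarrow> f \<in> hex_maps C A B \<and> g \<in> hex_maps C A B \<and> eqv C B f g"
proof -
  have "(\<exists>H \<in> Hom C (fst A) (Dom C (snd B)). snd B \<cdot> H = pairing C f g) \<longleftrightarrow> eqv C B f g"
    if "f \<in> hex_maps C A B" "g \<in> hex_maps C A B"
    using hex_mapsD[OF that(1)] hex_mapsD[OF that(2)] by (auto simp: eqv_def lifts_def Hom_def)
  then show ?thesis unfolding hex_rel_def by (cases A; cases B) auto
qed

lemma hex_class_eq:
  assumes "A \<in> Obj (Hex C)" "B \<in> Obj (Hex C)" "f \<in> hex_maps C A B" "g \<in> hex_maps C A B"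
  shows "hex_class C A B f = hex_class C A B g \<longleftrightarrow> eqv C B f g"
proof
  assume "hex_class C A B f = hex_class C A B g"
  moreover have "(g, g) \<in> hex_rel C A B"
    using assms eqv_refl[of B g] hex_mapsD[OF assms(4)] by (simp add: hex_rel_iff)
  ultimately show "eqv C B f g" using assms by (auto simp: hex_class_def hex_rel_iff)
next
  assume "eqv C B f g"
  then have "eqv C B f h \<longleftrightarrow> eqv C B g h" for h
    using eqv_sym[OF assms(2)] eqv_trans[OF assms(2)] by blast
  then show "hex_class C A B f = hex_class C A B g"
    unfolding hex_class_def using assms by (auto simp: hex_rel_iff)
qed

lemma Hex_arr_iff:
  "F \<in> Arr (Hex C) \<longleftrightarrow> (\<exists>A B f. A \<in> Obj (Hex C) \<and> B \<in> Obj (Hex C) \<and> f \<in> hex_maps C A B \<and> F = hex_class C A B f)"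
proof -
  have "(A, B, S) \<in> Arr (Hex C) \<longleftrightarrow> A \<in> Obj (Hex C) \<and> B \<in> Obj (Hex C) \<and> S \<in> hex_maps C A B // hex_rel C A B" for A B S
    by (auto simp: Hex_def Let_def)
  then show ?thesis by (cases F) (auto simp: hex_class_def quotient_def simp del: split_paired_Ex split_paired_All)
qed

lemma hex_class_arr [simp]:
  "\<lbrakk>A \<in> Obj (Hex C); B \<in> Obj (Hex C); f \<in> hex_maps C A B\<rbrakk> \<Longrightarrow> hex_class C A B f \<in> Arr (Hex C)"
  using Hex_arr_iff by blast

lemma Hex_arrE:
  assumes "F \<in> Arr (Hex C)" "Dom (Hex C) F = A" "Cod (Hex C) F = B"
  obtains f where "f \<in> hex_maps C A B" "F = hex_class C A B f" "A \<in> Obj (Hex C)" "B \<in> Obj (Hex C)"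
  using assms unfolding Hex_arr_iff by auto

lemma hex_maps_comp [simp]:
  assumes f: "f \<in> hex_maps C A B" and g: "g \<in> hex_maps C B D"
    and ob: "A \<in> Obj (Hex C)" "B \<in> Obj (Hex C)" "D \<in> Obj (Hex C)"
  shows "g \<cdot> f \<in> hex_maps C A D"
  unfolding hex_maps_iff[OF ob(1,3)]
proof (intro conjI allI impI)
  note ty = hex_mapsD[OF f] hex_mapsD[OF g]
  fix a b assume ab: "eqv C A a b"
  from hex_maps_eqv[OF g ob(2,3) hex_maps_eqv[OF f ob(1,2) ab]]
  show "eqv C D ((g \<cdot> f) \<cdot> a) ((g \<cdot> f) \<cdot> b)" using eqvD[OF ab] ty by simp
qed (use hex_mapsD[OF f] hex_mapsD[OF g] in simp_all)

text \<open>Composition in \<open>Hex C\<close> saturates the set of all composites of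
  representatives. The result is one class because each such composite is equivalent to
  \<open>g \<cdot> f\<close>: the inner map is replaced first, as \<open>g\<close> preserves the
  relations, and then the outer one by stability.\<close>

lemma hex_class_comp [simp]:
  assumes "A \<in> Obj (Hex C)" "B \<in> Obj (Hex C)" "D \<in> Obj (Hex C)" "f \<in> hex_maps C A B" "g \<in> hex_maps C B D"
  shows "hex_class C B D g \<cdot>\<^bsub>Hex C\<^esub> hex_class C A B f = hex_class C A D (g \<cdot> f)"
proof -
  have rel: "eqv C D (g \<cdot> f) (g' \<cdot> f')" if "(f, f') \<in> hex_rel C A B" "(g, g') \<in> hex_rel C B D" for f' g'
  proof -
    have f': "f' \<in> hex_maps C A B" "eqv C B f f'" and g': "g' \<in> hex_maps C B D" "eqv C D g g'"
      using that assms by (auto simp: hex_rel_iff)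
    have "eqv C D (g \<cdot> f) (g \<cdot> f')" by (rule hex_maps_eqv[OF assms(5,2,3) f'(2)])
    moreover have "eqv C D (g \<cdot> f') (g' \<cdot> f')"
      by (rule eqv_comp[OF assms(3) g'(2)]) (use hex_mapsD[OF f'(1)] hex_mapsD[OF g'(1)] in simp_all)
    ultimately show ?thesis by (rule eqv_trans[OF assms(3)])
  qed
  have self: "(f, f) \<in> hex_rel C A B" "(g, g) \<in> hex_rel C B D"
    using assms eqv_refl[of B f] eqv_refl[of D g] hex_mapsD[OF assms(4)] hex_mapsD[OF assms(5)]
    by (simp_all add: hex_rel_iff)
  have "hex_rel C A D `` {g' \<cdot> f' | g' f'. g' \<in> hex_rel C B D `` {g} \<and> f' \<in> hex_rel C A B `` {f}}
     = hex_rel C A D `` {g \<cdot> f}" (is "?L = ?R")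
  proof
    show "?R \<subseteq> ?L" using self by blast
    show "?L \<subseteq> ?R"
    proof
      fix h assume "h \<in> ?L"
      then obtain g' f' where gf: "(g, g') \<in> hex_rel C B D" "(f, f') \<in> hex_rel C A B" "(g' \<cdot> f', h) \<in> hex_rel C A D"
        by auto
      have "h \<in> hex_maps C A D" "eqv C D (g' \<cdot> f') h" using gf(3) assms by (auto simp: hex_rel_iff)
      with rel[OF gf(2,1)] show "h \<in> ?R" using assms by (auto simp: hex_rel_iff intro: eqv_trans)
    qed
  qed
  then show ?thesis unfolding hex_class_def by (simp add: Hex_def Let_def)
qed

lemma hex_maps_ident [simp]: "A \<in> Obj (Hex C) \<Longrightarrow> Ident C (fst A) \<in> hex_maps C A A"
  unfolding hex_maps_iff
proof (intro conjI allI impI)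
  fix a b assume "A \<in> Obj (Hex C)" and ab: "eqv C A a b"
  then show "eqv C A (Ident C (fst A) \<cdot> a) (Ident C (fst A) \<cdot> b)" using eqvD[OF ab] by simp
qed simp_all

lemma Hex_category: "category (Hex C)"
proof
  fix F assume F: "F \<in> Arr (Hex C)"
  then show "Dom (Hex C) F \<in> Obj (Hex C)" "Cod (Hex C) F \<in> Obj (Hex C)"
    unfolding Hex_arr_iff by auto
next
  fix A assume A: "A \<in> Obj (Hex C)"
  then show "Ident (Hex C) A \<in> Hom (Hex C) A A" by (simp add: Hom_def)
next
  fix F G A B D assume F: "F \<in> Hom (Hex C) A B"
  then obtain f where f: "f \<in> hex_maps C A B" "F = hex_class C A B f" "A \<in> Obj (Hex C)" "B \<in> Obj (Hex C)"
    by (auto simp: Hom_def elim: Hex_arrE)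
  show "F \<cdot>\<^bsub>Hex C\<^esub> Ident (Hex C) A = F" "Ident (Hex C) B \<cdot>\<^bsub>Hex C\<^esub> F = F"
    using f hex_mapsD[OF f(1)] by simp_all
  assume G: "G \<in> Hom (Hex C) B D"
  then obtain g where g: "g \<in> hex_maps C B D" "G = hex_class C B D g" "D \<in> Obj (Hex C)"
    by (auto simp: Hom_def elim: Hex_arrE)
  show "G \<cdot>\<^bsub>Hex C\<^esub> F \<in> Hom (Hex C) A D" using f g by (simp add: Hom_def)
  fix H E assume H: "H \<in> Hom (Hex C) D E"
  then obtain h where h: "h \<in> hex_maps C D E" "H = hex_class C D E h" "E \<in> Obj (Hex C)"
    by (auto simp: Hom_def elim: Hex_arrE)
  show "(H \<cdot>\<^bsub>Hex C\<^esub> G) \<cdot>\<^bsub>Hex C\<^esub> F = H \<cdot>\<^bsub>Hex C\<^esub> (G \<cdot>\<^bsub>Hex C\<^esub> F)"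
    using f g h hex_mapsD[OF f(1)] hex_mapsD[OF g(1)] hex_mapsD[OF h(1)] by simp
qed

section \<open>Terminal object and pullbacks of \<open>Hex C\<close>\<close>

lemma Hex_terminal: "\<exists>A. terminal (Hex C) A"
proof -
  obtain T where T: "terminal C T" using terminal_fib by blast
  then have Tob: "T \<in> Obj C" by (simp add: terminal_def)
  \<comment> \<open>The total relation on \<open>T\<close>, represented by the identity of
    \<open>T \<times> T\<close>.\<close>
  have "displayed (prd C T T) (\<lambda>h. True)"
    unfolding displayed_def lifts_def using iso_acyclic_fib[OF iso_ident[of "prd C T T"]] Tob
    by (intro bexI[of _ "Ident C (prd C T T)"]) auto
  then obtain A where A: "A \<in> Obj (Hex C)" "fst A = T"
    "\<And>a b. eqv C A a b \<longleftrightarrow> a \<in> Arr C \<and> b \<in> Arr C \<and> Dom C a = Dom C b \<and> Cod C a = T \<and> Cod C b = T \<and> True"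
    using Hex_objI[OF Tob, of "\<lambda>_ _. True"] by blast
  have "\<exists>!F. F \<in> Hom (Hex C) B A" if B: "B \<in> Obj (Hex C)" for B
  proof -
    obtain t where t: "t \<in> Arr C" "Dom C t = fst B" "Cod C t = T" by (rule terminal_arrow[OF T Hex_obj[OF B]])
    have tm: "t \<in> hex_maps C B A" unfolding hex_maps_iff[OF B A(1)]
    proof (intro conjI allI impI)
      fix a b assume ab: "eqv C B a b"
      show "eqv C A (t \<cdot> a) (t \<cdot> b)" unfolding A(3) using eqvD[OF ab] t by simp
    qed (use t A(2) in simp_all)
    show ?thesis
    proof (rule ex1I[of _ "hex_class C B A t"])
      show "hex_class C B A t \<in> Hom (Hex C) B A" using tm A B by (simp add: Hom_def)
      fix F assume "F \<in> Hom (Hex C) B A"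
      then obtain f where f: "f \<in> hex_maps C B A" "F = hex_class C B A f"
        by (auto simp: Hom_def elim: Hex_arrE)
      then show "F = hex_class C B A t"
        using tm A B t hex_mapsD[OF f(1)] by (simp add: hex_class_eq)
    qed
  qed
  then show ?thesis using A(1) unfolding terminal_def by blast
qed

text \<open>The object of triples of \<open>a\<close>, \<open>b\<close> and a witness of
  \<open>p a \<sim> q b\<close>, a fibration over the product of the two domains. The map
  \<open>h\<close> depends on the witness, hence the word weak. That \<open>y\<close> is a fibration
  is what admits such objects into weak Pi-types: with an identity for \<open>q\<close>, it is the
  fibration along which functions are formed.\<close>

lemma weak_fibre_product:
  assumes T: "T \<in> Obj (Hex C)" and pq: "p \<in> Arr C" "q \<in> Arr C" "Cod C p = fst T" "Cod C q = fst T"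
  obtains x y where "x \<in> Arr C" "y \<in> Fib C" "Dom C x = Dom C y" "Cod C x = Dom C p" "Cod C y = Dom C q"
    "eqv C T (p \<cdot> x) (q \<cdot> y)"
    "\<And>a b. \<lbrakk>a \<in> Arr C; b \<in> Arr C; Cod C a = Dom C p; Cod C b = Dom C q; eqv C T (p \<cdot> a) (q \<cdot> b)\<rbrakk> \<Longrightarrow>
      \<exists>h. h \<in> Arr C \<and> Dom C h = Dom C b \<and> Cod C h = Dom C y \<and> x \<cdot> h = a \<and> y \<cdot> h = b"
proof -
  let ?X = "Dom C p" and ?Y = "Dom C q"
  have XY: "?X \<in> Obj C" "?Y \<in> Obj C" using pq by auto
  have "displayed (prd C ?X ?Y) (\<lambda>h. eqv C T ((p \<cdot> pr1 C ?X ?Y) \<cdot> h) ((q \<cdot> pr2 C ?X ?Y) \<cdot> h))"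
    using displayed_eqv[OF T, of "p \<cdot> pr1 C ?X ?Y" "q \<cdot> pr2 C ?X ?Y"] pq XY by simp
  then obtain d where d: "d \<in> Fib C" "Cod C d = prd C ?X ?Y"
    and dQ: "\<And>h. \<lbrakk>h \<in> Arr C; Cod C h = prd C ?X ?Y\<rbrakk> \<Longrightarrow>
      eqv C T ((p \<cdot> pr1 C ?X ?Y) \<cdot> h) ((q \<cdot> pr2 C ?X ?Y) \<cdot> h) = lifts C d h"
    unfolding displayed_def by auto
  show ?thesis
  proof (rule that[of "pr1 C ?X ?Y \<cdot> d" "pr2 C ?X ?Y \<cdot> d"])
    have "lifts C d d" unfolding lifts_def using d by (intro bexI[of _ "Ident C (Dom C d)"]) simp_all
    then show "eqv C T (p \<cdot> (pr1 C ?X ?Y \<cdot> d)) (q \<cdot> (pr2 C ?X ?Y \<cdot> d))"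
      using dQ[of d] d pq XY by simp
    fix a b assume ab: "a \<in> Arr C" "b \<in> Arr C" "Cod C a = ?X" "Cod C b = ?Y" "eqv C T (p \<cdot> a) (q \<cdot> b)"
    have dom: "Dom C a = Dom C b" using eqvD(3)[OF ab(5)] ab pq by simp
    have "lifts C d (pairing C a b)" using dQ[of "pairing C a b"] ab dom pq XY by simp
    then obtain h where "h \<in> Arr C" "Dom C h = Dom C b" "Cod C h = Dom C d" "d \<cdot> h = pairing C a b"
      using ab dom by (auto simp: lifts_def)
    then show "\<exists>h. h \<in> Arr C \<and> Dom C h = Dom C b \<and> Cod C h = Dom C (pr2 C ?X ?Y \<cdot> d) \<and>
        (pr1 C ?X ?Y \<cdot> d) \<cdot> h = a \<and> (pr2 C ?X ?Y \<cdot> d) \<cdot> h = b"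
      using d XY ab dom by (intro exI[of _ h]) simp
  qed (use d XY fib_comp in simp_all)
qed

text \<open>Relating triples by their components alone forgets the witnesses, and this makes
  factorizations through the weak fibre product unique in \<open>Hex C\<close>. Besides the
  pullback, the conclusion exports what holds before passing to classes, namely the description of
  the relation and a factorization with strict equations, so that later arguments can compute with
  representatives.\<close>

lemma hex_pullback:
  assumes ob: "A \<in> Obj (Hex C)" "B \<in> Obj (Hex C)" "T \<in> Obj (Hex C)"
    and p: "p \<in> hex_maps C A T" and q: "q \<in> hex_maps C B T"
  obtains P x y where "P \<in> Obj (Hex C)" "x \<in> hex_maps C P A" "y \<in> hex_maps C P B"
    "is_pullback (Hex C) (hex_class C A T p) (hex_class C B T q) (hex_class C P A x) (hex_class C P B y)"
    "eqv C T (p \<cdot> x) (q \<cdot> y)"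
    "\<And>h k. \<lbrakk>h \<in> Arr C; k \<in> Arr C; Cod C h = fst P; Cod C k = fst P; Dom C h = Dom C k\<rbrakk> \<Longrightarrow>
      eqv C P h k \<longleftrightarrow> eqv C A (x \<cdot> h) (x \<cdot> k) \<and> eqv C B (y \<cdot> h) (y \<cdot> k)"
    "\<And>a b. \<lbrakk>a \<in> Arr C; b \<in> Arr C; Cod C a = fst A; Cod C b = fst B; eqv C T (p \<cdot> a) (q \<cdot> b)\<rbrakk> \<Longrightarrow>
      \<exists>h. h \<in> Arr C \<and> Dom C h = Dom C b \<and> Cod C h = fst P \<and> x \<cdot> h = a \<and> y \<cdot> h = b"
proof -
  interpret H: category "Hex C" by (rule Hex_category)
  note pD = hex_mapsD[OF p] and qD = hex_mapsD[OF q]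
  obtain x y where xy: "x \<in> Arr C" "y \<in> Fib C" "Dom C x = Dom C y" "Cod C x = fst A" "Cod C y = fst B"
    and comm: "eqv C T (p \<cdot> x) (q \<cdot> y)"
    and univ: "\<And>a b. \<lbrakk>a \<in> Arr C; b \<in> Arr C; Cod C a = fst A; Cod C b = fst B; eqv C T (p \<cdot> a) (q \<cdot> b)\<rbrakk> \<Longrightarrow>
      \<exists>h. h \<in> Arr C \<and> Dom C h = Dom C b \<and> Cod C h = Dom C y \<and> x \<cdot> h = a \<and> y \<cdot> h = b"
    using weak_fibre_product[OF ob(3) pD(1) qD(1) pD(3) qD(3)] pD(2) qD(2) by metis
  let ?P = "Dom C y" and ?Q = "\<lambda>h k. eqv C A (x \<cdot> h) (x \<cdot> k) \<and> eqv C B (y \<cdot> h) (y \<cdot> k)"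
  have Pob: "?P \<in> Obj C" using xy by simp
  let ?p = "pr1 C ?P ?P" and ?q = "pr2 C ?P ?P"
  have "displayed (prd C ?P ?P) (\<lambda>h. eqv C A ((x \<cdot> ?p) \<cdot> h) ((x \<cdot> ?q) \<cdot> h))"
    using displayed_eqv[OF ob(1), of "x \<cdot> ?p" "x \<cdot> ?q"] xy Pob by simp
  moreover have "displayed (prd C ?P ?P) (\<lambda>h. eqv C B ((y \<cdot> ?p) \<cdot> h) ((y \<cdot> ?q) \<cdot> h))"
    using displayed_eqv[OF ob(2), of "y \<cdot> ?p" "y \<cdot> ?q"] xy Pob by simp
  ultimately have disp: "displayed (prd C ?P ?P) (\<lambda>h. ?Q (?p \<cdot> h) (?q \<cdot> h))"
    by (rule displayed_cong[OF displayed_conj]) (use xy Pob in simp)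
  obtain P where P: "P \<in> Obj (Hex C)" "fst P = ?P"
    and eqP: "\<And>h k. eqv C P h k \<longleftrightarrow> h \<in> Arr C \<and> k \<in> Arr C \<and> Dom C h = Dom C k \<and> Cod C h = ?P \<and> Cod C k = ?P \<and> ?Q h k"
  proof (rule Hex_objI[of ?P ?Q, OF Pob disp])
    show "?Q a a" if "a \<in> Arr C" "Cod C a = ?P" for a
      using eqv_refl[OF ob(1), of "x \<cdot> a"] eqv_refl[OF ob(2), of "y \<cdot> a"] that xy by simp
    show "?Q b a" if "?Q a b" for a b
      using that eqv_sym[OF ob(1)] eqv_sym[OF ob(2)] by blast
    show "?Q a c" if "?Q a b" "?Q b c" for a b c
      using that eqv_trans[OF ob(1)] eqv_trans[OF ob(2)] by blast
  qed (rule that; assumption)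
  have x: "x \<in> hex_maps C P A" and y: "y \<in> hex_maps C P B"
    using xy P ob eqP by (auto simp: hex_maps_iff)
  have "is_pullback (Hex C) (hex_class C A T p) (hex_class C B T q) (hex_class C P A x) (hex_class C P B y)"
  proof (rule H.pullbackI)
    show "hex_class C A T p \<cdot>\<^bsub>Hex C\<^esub> hex_class C P A x = hex_class C B T q \<cdot>\<^bsub>Hex C\<^esub> hex_class C P B y"
      using ob P(1) x y p q comm by (simp add: hex_class_eq)
    fix F G assume FG: "F \<in> Arr (Hex C)" "G \<in> Arr (Hex C)" "Dom (Hex C) F = Dom (Hex C) G"
      "Cod (Hex C) F = Dom (Hex C) (hex_class C A T p)" "Cod (Hex C) G = Dom (Hex C) (hex_class C B T q)"
      "hex_class C A T p \<cdot>\<^bsub>Hex C\<^esub> F = hex_class C B T q \<cdot>\<^bsub>Hex C\<^esub> G"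
    define Z where "Z = Dom (Hex C) G"
    obtain f where f: "f \<in> hex_maps C Z A" "F = hex_class C Z A f" and Z: "Z \<in> Obj (Hex C)"
      by (rule Hex_arrE[OF FG(1) FG(3)[folded Z_def] FG(4)[unfolded Hex_simps(5)]])
    obtain g where g: "g \<in> hex_maps C Z B" "G = hex_class C Z B g"
      by (rule Hex_arrE[OF FG(2) Z_def[symmetric] FG(5)[unfolded Hex_simps(5)]])
    note fD = hex_mapsD[OF f(1)] and gD = hex_mapsD[OF g(1)]
    have "eqv C T (p \<cdot> f) (q \<cdot> g)"
      using FG(6) f g p q ob Z by (simp add: hex_class_eq)
    from univ[OF fD(1) gD(1) fD(3) gD(3) this]
    obtain h where h: "h \<in> Arr C" "Dom C h = fst Z" "Cod C h = fst P" "x \<cdot> h = f" "y \<cdot> h = g"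
      using gD P by auto
    have hm: "h \<in> hex_maps C Z P" unfolding hex_maps_iff[OF Z P(1)]
    proof (intro conjI allI impI)
      fix a b assume ab: "eqv C Z a b"
      note ty = eqvD[OF ab]
      show "eqv C P (h \<cdot> a) (h \<cdot> b)" unfolding eqP
        using hex_maps_eqv[OF f(1) Z ob(1) ab] hex_maps_eqv[OF g(1) Z ob(2) ab] ty h xy P
        by (simp add: rewrite_tail1[OF h(4)] rewrite_tail1[OF h(5)])
    qed (use h in simp_all)
    show "\<exists>H. H \<in> Arr (Hex C) \<and> Dom (Hex C) H = Dom (Hex C) F \<and> Cod (Hex C) H = Dom (Hex C) (hex_class C P A x) \<and>
        hex_class C P A x \<cdot>\<^bsub>Hex C\<^esub> H = F \<and> hex_class C P B y \<cdot>\<^bsub>Hex C\<^esub> H = G"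
      by (rule exI[of _ "hex_class C Z P h"]) (use f(2) g(2) hm Z P(1) ob x y h in simp)
  next
    fix F G assume FG: "F \<in> Arr (Hex C)" "G \<in> Arr (Hex C)" "Dom (Hex C) F = Dom (Hex C) G"
      "Cod (Hex C) F = Dom (Hex C) (hex_class C P A x)" "Cod (Hex C) G = Dom (Hex C) (hex_class C P A x)"
      "hex_class C P A x \<cdot>\<^bsub>Hex C\<^esub> F = hex_class C P A x \<cdot>\<^bsub>Hex C\<^esub> G"
      "hex_class C P B y \<cdot>\<^bsub>Hex C\<^esub> F = hex_class C P B y \<cdot>\<^bsub>Hex C\<^esub> G"
    define Z where "Z = Dom (Hex C) G"
    obtain f where f: "f \<in> hex_maps C Z P" "F = hex_class C Z P f" and Z: "Z \<in> Obj (Hex C)"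
      by (rule Hex_arrE[OF FG(1) FG(3)[folded Z_def] FG(4)[unfolded Hex_simps(5)]])
    obtain g where g: "g \<in> hex_maps C Z P" "G = hex_class C Z P g"
      by (rule Hex_arrE[OF FG(2) Z_def[symmetric] FG(5)[unfolded Hex_simps(5)]])
    have "eqv C A (x \<cdot> f) (x \<cdot> g)" "eqv C B (y \<cdot> f) (y \<cdot> g)"
      using FG(6,7) f g Z P(1) ob x y by (simp_all add: hex_class_eq)
    then have "eqv C P f g" unfolding eqP
      using hex_mapsD[OF f(1)] hex_mapsD[OF g(1)] P by simp
    then show "F = G" using f g Z P(1) by (simp add: hex_class_eq)
  qed (use ob P(1) x y p q in simp_all)
  then show ?thesis
  proof (rule that[OF P(1) x y _ comm])
    fix h k assume "h \<in> Arr C" "k \<in> Arr C" "Cod C h = fst P" "Cod C k = fst P" "Dom C h = Dom C k"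
    then show "eqv C P h k \<longleftrightarrow> ?Q h k" unfolding eqP P(2) by simp
  next
    fix a b assume "a \<in> Arr C" "b \<in> Arr C" "Cod C a = fst A" "Cod C b = fst B" "eqv C T (p \<cdot> a) (q \<cdot> b)"
    from univ[OF this] show "\<exists>h. h \<in> Arr C \<and> Dom C h = Dom C b \<and> Cod C h = fst P \<and> x \<cdot> h = a \<and> y \<cdot> h = b"
      unfolding P(2) .
  qed
qed

end

section \<open>Exponentials in the slices\<close>

text \<open>The data for exponentiating \<open>q : B \<rightarrow> T\<close> by \<open>p : A \<rightarrow> T\<close>: \<open>Dom C \<alpha>\<close> is the object of triples \<open>(i, x, p x \<sim> i)\<close>,
  and \<open>Dom C \<pi>\<close> that of functions \<open>e\<close>, not yet required to respect the relations, on the fibre over \<open>\<pi> e\<close>, of which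
  \<open>app e j\<close> is the value at \<open>j\<close>.\<close>

locale exponential_data = path_category C
  for C :: "('o, 'm, 'z) fcat_scheme" (structure) +
  fixes A B T :: "'o \<times> 'm" and p q \<alpha> \<chi> \<pi> :: 'm and app :: "'m \<Rightarrow> 'm \<Rightarrow> 'm"
  assumes obs [simp]: "A \<in> Obj (Hex C)" "B \<in> Obj (Hex C)" "T \<in> Obj (Hex C)"
    and p: "p \<in> hex_maps C A T" and q: "q \<in> hex_maps C B T"
    and \<alpha>: "\<alpha> \<in> Fib C" "Cod C \<alpha> = fst T"
    and \<chi>: "\<chi> \<in> Arr C" "Dom C \<chi> = Dom C \<alpha>" "Cod C \<chi> = fst A" "eqv C T (p \<cdot> \<chi>) \<alpha>"
    and fibre_element: "\<And>a b. \<lbrakk>a \<in> Arr C; b \<in> Arr C; Cod C a = fst A; Cod C b = fst T; eqv C T (p \<cdot> a) b\<rbrakk> \<Longrightarrow>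
      \<exists>j. j \<in> Arr C \<and> Dom C j = Dom C b \<and> Cod C j = Dom C \<alpha> \<and> \<chi> \<cdot> j = a \<and> \<alpha> \<cdot> j = b"
    and \<pi>: "\<pi> \<in> Fib C" "Cod C \<pi> = fst T"
    and app: "\<And>e j. \<lbrakk>e \<in> Arr C; j \<in> Arr C; Dom C e = Dom C j; Cod C e = Dom C \<pi>; Cod C j = Dom C \<alpha>; \<pi> \<cdot> e = \<alpha> \<cdot> j\<rbrakk> \<Longrightarrow>
      app e j \<in> Arr C \<and> Dom C (app e j) = Dom C j \<and> Cod C (app e j) = fst B \<and> eqv C T (q \<cdot> app e j) (\<alpha> \<cdot> j) \<and>
      (\<forall>u \<in> Arr C. Cod C u = Dom C j \<longrightarrow> app (e \<cdot> u) (j \<cdot> u) = app e j \<cdot> u)"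
    and abstraction: "\<And>g a b m. \<lbrakk>is_pullback C \<alpha> g a b; m \<in> Arr C; Dom C m = Dom C a; Cod C m = fst B;
      eqv C T (q \<cdot> m) (\<alpha> \<cdot> a)\<rbrakk> \<Longrightarrow>
      \<exists>n \<in> Arr C. Dom C n = Dom C g \<and> Cod C n = Dom C \<pi> \<and> \<pi> \<cdot> n = g \<and> eqv C B m (app (n \<cdot> b) a)"
begin

text \<open>The pairs at which \<open>app\<close> is meaningful: the argument \<open>j\<close> lies
  in the fibre on which the function \<open>e\<close> is defined. They are the generalized elements
  of the pullback of \<open>\<pi>\<close> and \<open>\<alpha>\<close>.\<close>

definition fits :: "'m \<Rightarrow> 'm \<Rightarrow> bool" where
  "fits e j \<longleftrightarrow> e \<in> Arr C \<and> j \<in> Arr C \<and> Dom C e = Dom C j \<and> Cod C e = Dom C \<pi> \<and> Cod C j = Dom C \<alpha> \<and>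
     \<pi> \<cdot> e = \<alpha> \<cdot> j"

lemma fitsD:
  assumes "fits e j"
  shows "e \<in> Arr C" "j \<in> Arr C" "Dom C e = Dom C j" "Cod C e = Dom C \<pi>" "Cod C j = Dom C \<alpha>" "\<pi> \<cdot> e = \<alpha> \<cdot> j"
  using assms by (auto simp: fits_def)

lemma fits_comp:
  assumes "fits e j" "u \<in> Arr C" "Cod C u = Dom C j"
  shows "fits (e \<cdot> u) (j \<cdot> u)"
  unfolding fits_def using fitsD[OF assms(1)] assms(2,3) \<alpha> \<pi>
  by (simp add: rewrite_tail[OF fitsD(6)[OF assms(1)]])

lemma appD:
  assumes "fits e j"
  shows "app e j \<in> Arr C" "Dom C (app e j) = Dom C j" "Cod C (app e j) = fst B"
    "eqv C T (q \<cdot> app e j) (\<alpha> \<cdot> j)"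
  using app assms by (auto simp: fits_def)

lemma app_comp:
  assumes "fits e j" "u \<in> Arr C" "Cod C u = Dom C j"
  shows "app (e \<cdot> u) (j \<cdot> u) = app e j \<cdot> u"
  using app assms by (auto simp: fits_def)

lemma fibre_over:
  assumes "fits e j"
  shows "eqv C T (p \<cdot> (\<chi> \<cdot> j)) (\<pi> \<cdot> e)"
  using eqv_comp[OF obs(3) \<chi>(4), of j] fitsD[OF assms] hex_mapsD[OF p] \<chi> \<alpha> by simp

text \<open>The stage \<open>u\<close> is that of the Kripke semantics of the universal quantifiers; \<open>j\<close> and \<open>j'\<close> may lie over
  different points, so that \<open>same_function e e\<close> says that \<open>e\<close> respects the relations.\<close>

definition same_function :: "'m \<Rightarrow> 'm \<Rightarrow> bool" where
  "same_function e e' \<longleftrightarrow> eqv C T (\<pi> \<cdot> e) (\<pi> \<cdot> e') \<and>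
     (\<forall>u j j'. u \<in> Arr C \<and> Cod C u = Dom C e \<and> fits (e \<cdot> u) j \<and> fits (e' \<cdot> u) j' \<and> eqv C A (\<chi> \<cdot> j) (\<chi> \<cdot> j') \<longrightarrow>
       eqv C B (app (e \<cdot> u) j) (app (e' \<cdot> u) j'))"

lemma same_function_sym:
  assumes "same_function e e'" "Dom C e = Dom C e'"
  shows "same_function e' e"
  unfolding same_function_def
proof (intro conjI allI impI)
  show "eqv C T (\<pi> \<cdot> e') (\<pi> \<cdot> e)" using assms eqv_sym[OF obs(3)] unfolding same_function_def by blast
  fix u j j'
  assume *: "u \<in> Arr C \<and> Cod C u = Dom C e' \<and> fits (e' \<cdot> u) j \<and> fits (e \<cdot> u) j' \<and> eqv C A (\<chi> \<cdot> j) (\<chi> \<cdot> j')"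
  then have "eqv C A (\<chi> \<cdot> j') (\<chi> \<cdot> j)" using eqv_sym[OF obs(1)] by blast
  with * assms have "eqv C B (app (e \<cdot> u) j') (app (e' \<cdot> u) j)" unfolding same_function_def by auto
  then show "eqv C B (app (e' \<cdot> u) j) (app (e \<cdot> u) j')" by (rule eqv_sym[OF obs(2)])
qed

text \<open>The arguments \<open>j\<close> and \<open>j''\<close> belong to \<open>e\<close> and
  \<open>e''\<close>, so one for the middle function \<open>e'\<close> has to be found. The
  underlying element \<open>\<chi> \<cdot> j\<close> of \<open>A\<close> can be kept: membership in
  a fibre is required only up to the relation of \<open>T\<close>, and the base points of
  \<open>e\<close> and \<open>e'\<close> are related. Just the base point and the witness
  change.\<close>

lemma same_function_trans:
  assumes e: "same_function e e'" "same_function e' e''" and dom: "Dom C e = Dom C e'"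
    and ty: "e \<in> Arr C" "e' \<in> Arr C" "Cod C e = Dom C \<pi>" "Cod C e' = Dom C \<pi>"
  shows "same_function e e''"
  unfolding same_function_def
proof (intro conjI allI impI)
  show "eqv C T (\<pi> \<cdot> e) (\<pi> \<cdot> e'')" using e eqv_trans[OF obs(3)] unfolding same_function_def by blast
  fix u j j''
  assume *: "u \<in> Arr C \<and> Cod C u = Dom C e \<and> fits (e \<cdot> u) j \<and> fits (e'' \<cdot> u) j'' \<and> eqv C A (\<chi> \<cdot> j) (\<chi> \<cdot> j'')"
  note fj = fitsD[OF *[THEN conjunct2, THEN conjunct2, THEN conjunct1]]
  have "eqv C T (p \<cdot> (\<chi> \<cdot> j)) (\<pi> \<cdot> (e \<cdot> u))" using fibre_over * by blast
  moreover have "eqv C T ((\<pi> \<cdot> e) \<cdot> u) ((\<pi> \<cdot> e') \<cdot> u)"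
    using e(1) * dom ty \<pi> by (intro eqv_comp[OF obs(3)]) (simp_all add: same_function_def)
  moreover have "(\<pi> \<cdot> e) \<cdot> u = \<pi> \<cdot> (e \<cdot> u)" "(\<pi> \<cdot> e') \<cdot> u = \<pi> \<cdot> (e' \<cdot> u)"
    using * dom ty \<pi> by simp_all
  ultimately have "eqv C T (p \<cdot> (\<chi> \<cdot> j)) (\<pi> \<cdot> (e' \<cdot> u))"
    using eqv_trans[OF obs(3)] by metis
  then obtain j' where j': "j' \<in> Arr C" "Dom C j' = Dom C u" "Cod C j' = Dom C \<alpha>" "\<chi> \<cdot> j' = \<chi> \<cdot> j" "\<alpha> \<cdot> j' = \<pi> \<cdot> (e' \<cdot> u)"
    using fibre_element[of "\<chi> \<cdot> j" "\<pi> \<cdot> (e' \<cdot> u)"] fj * ty dom \<pi> \<chi> by auto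
  have fits': "fits (e' \<cdot> u) j'" unfolding fits_def using j' * ty dom by simp
  have "\<chi> \<cdot> j \<in> Arr C" "Cod C (\<chi> \<cdot> j) = fst A" using fj \<chi> by simp_all
  then have "eqv C A (\<chi> \<cdot> j) (\<chi> \<cdot> j')" unfolding j'(4) by (rule eqv_refl[OF obs(1)])
  then have "eqv C B (app (e \<cdot> u) j) (app (e' \<cdot> u) j')"
    using e(1) * fits' unfolding same_function_def by blast
  moreover have "eqv C B (app (e' \<cdot> u) j') (app (e'' \<cdot> u) j'')"
    using e(2) * fits' dom j'(4) unfolding same_function_def by auto
  ultimately show "eqv C B (app (e \<cdot> u) j) (app (e'' \<cdot> u) j'')" by (rule eqv_trans[OF obs(2)])
qed

lemma same_functionD:
  assumes e: "same_function e e'" and f: "fits e j" "fits e' j'" "eqv C A (\<chi> \<cdot> j) (\<chi> \<cdot> j')"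
  shows "eqv C B (app e j) (app e' j')"
proof -
  note ty = fitsD[OF f(1)] fitsD[OF f(2)] eqvD[OF f(3)]
  have "Dom C e' = Dom C e" using ty \<chi> by simp
  then have "e \<cdot> Ident C (Dom C e) = e" "e' \<cdot> Ident C (Dom C e) = e'" using ty(1,7) by simp_all
  with e f ty(1) show ?thesis
    unfolding same_function_def
    by (elim conjE allE[of _ "Ident C (Dom C e)"] allE[of _ j] allE[of _ j']) simp
qed

text \<open>The quantifiers in \<open>same_function\<close> are collected into one fibration
  \<open>d\<close> over \<open>E \<times> E\<close>, whose points over
  \<open>(e\<^sub>1, e\<^sub>2)\<close> are pairs of arguments, one for each function, with a
  witness that they are equivalent in \<open>A\<close>. The body is then quantified along
  \<open>d\<close>.\<close>

lemma displayed_same_function: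
  assumes Pi: "weak_homotopy_Pi_types C"
  defines "E \<equiv> Dom C \<pi>"
  shows "displayed (prd C E E) (\<lambda>h. same_function (pr1 C E E \<cdot> h) (pr2 C E E \<cdot> h))"
proof -
  interpret Pi_path_category C by unfold_locales (rule Pi)
  have E: "E \<in> Obj C" "Dom C \<pi> = E" using \<pi> by (auto simp: E_def)
  define e\<^sub>1 e\<^sub>2 where "e\<^sub>1 = pr1 C E E" and "e\<^sub>2 = pr2 C E E"
  have e: "e\<^sub>1 \<in> Arr C" "e\<^sub>2 \<in> Arr C" "Dom C e\<^sub>1 = prd C E E" "Dom C e\<^sub>2 = prd C E E" "Cod C e\<^sub>1 = E" "Cod C e\<^sub>2 = E"
    using E by (simp_all add: e\<^sub>1_def e\<^sub>2_def)
  \<comment> \<open>The context has three layers: \<open>d\<^sub>1\<close> adjoins an argument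
    \<open>j\<^sub>1\<close> of the first function, \<open>d\<^sub>2\<close> an argument
    \<open>j\<^sub>2\<close> of the second, \<open>d\<^sub>3\<close> the witness of their
    equivalence. Below, \<open>a\<close> and \<open>b\<close> are these two arguments in the full
    context.\<close>
  obtain j\<^sub>1 d\<^sub>1 where pb1: "is_pullback C \<alpha> (\<pi> \<cdot> e\<^sub>1) j\<^sub>1 d\<^sub>1"
    using fib_pullback_exists[of \<alpha> "\<pi> \<cdot> e\<^sub>1"] \<alpha> \<pi> e E by auto
  note D1 = pullbackD[OF pb1]
  have d1: "d\<^sub>1 \<in> Fib C" "Cod C d\<^sub>1 = prd C E E" using fib_pullback[OF \<alpha>(1) pb1] D1 e E \<pi> by auto
  obtain j\<^sub>2 d\<^sub>2 where pb2: "is_pullback C \<alpha> (\<pi> \<cdot> (e\<^sub>2 \<cdot> d\<^sub>1)) j\<^sub>2 d\<^sub>2"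
    using fib_pullback_exists[of \<alpha> "\<pi> \<cdot> (e\<^sub>2 \<cdot> d\<^sub>1)"] \<alpha> \<pi> e E d1 by auto
  note D2 = pullbackD[OF pb2]
  have d2: "d\<^sub>2 \<in> Fib C" "Cod C d\<^sub>2 = Dom C j\<^sub>1" using fib_pullback[OF \<alpha>(1) pb2] D2 D1(8) e E \<pi> d1 by auto
  have "displayed (Dom C j\<^sub>2) (\<lambda>h. eqv C A ((\<chi> \<cdot> (j\<^sub>1 \<cdot> d\<^sub>2)) \<cdot> h) ((\<chi> \<cdot> j\<^sub>2) \<cdot> h))"
    using displayed_eqv[OF obs(1), of "\<chi> \<cdot> (j\<^sub>1 \<cdot> d\<^sub>2)" "\<chi> \<cdot> j\<^sub>2"] \<chi> D1(3,6) D2(3,6,8) d2 by simp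
  then obtain d\<^sub>3 where d3: "d\<^sub>3 \<in> Fib C" "Cod C d\<^sub>3 = Dom C j\<^sub>2"
    and lift3: "\<And>h. \<lbrakk>h \<in> Arr C; Cod C h = Dom C j\<^sub>2\<rbrakk> \<Longrightarrow>
      eqv C A ((\<chi> \<cdot> (j\<^sub>1 \<cdot> d\<^sub>2)) \<cdot> h) ((\<chi> \<cdot> j\<^sub>2) \<cdot> h) = lifts C d\<^sub>3 h"
    unfolding displayed_def by auto
  define d where "d = d\<^sub>1 \<cdot> (d\<^sub>2 \<cdot> d\<^sub>3)"
  define a where "a = j\<^sub>1 \<cdot> (d\<^sub>2 \<cdot> d\<^sub>3)"
  define b where "b = j\<^sub>2 \<cdot> d\<^sub>3"
  have d23: "d\<^sub>2 \<cdot> d\<^sub>3 \<in> Fib C" "Dom C (d\<^sub>2 \<cdot> d\<^sub>3) = Dom C d\<^sub>3" "Cod C (d\<^sub>2 \<cdot> d\<^sub>3) = Dom C j\<^sub>1"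
    using fib_comp[OF d3(1) d2(1)] d2 d3 D2(8) by simp_all
  have d: "d \<in> Fib C" "Dom C d = Dom C d\<^sub>3" "Cod C d = prd C E E"
    using fib_comp[OF d23(1) d1(1)] d23 d1 D1(8) by (simp_all add: d_def)
  have a: "a \<in> Arr C" "Dom C a = Dom C d\<^sub>3" "Cod C a = Dom C \<alpha>" and b: "b \<in> Arr C" "Dom C b = Dom C d\<^sub>3" "Cod C b = Dom C \<alpha>"
    using d23 d3 D1(3,6) D2(3,6) by (simp_all add: a_def b_def)
  have fa: "fits (e\<^sub>1 \<cdot> d) a"
  proof -
    have "\<alpha> \<cdot> (j\<^sub>1 \<cdot> (d\<^sub>2 \<cdot> d\<^sub>3)) = (\<pi> \<cdot> e\<^sub>1) \<cdot> (d\<^sub>1 \<cdot> (d\<^sub>2 \<cdot> d\<^sub>3))"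
      by (rule rewrite_tail[OF D1(9)]) (use D1(1-8) d23 in simp_all)
    then show ?thesis unfolding fits_def using a d e \<pi> E by (simp add: a_def d_def)
  qed
  have fb: "fits (e\<^sub>2 \<cdot> d) b"
  proof -
    have "\<alpha> \<cdot> (j\<^sub>2 \<cdot> d\<^sub>3) = (\<pi> \<cdot> (e\<^sub>2 \<cdot> d\<^sub>1)) \<cdot> (d\<^sub>2 \<cdot> d\<^sub>3)"
      by (rule rewrite_tail[OF D2(9)]) (use D2(1-8) d3 in simp_all)
    then show ?thesis unfolding fits_def using b d d1 d23 D1(8) e \<pi> E by (simp add: b_def d_def)
  qed
  have ab: "eqv C A (\<chi> \<cdot> a) (\<chi> \<cdot> b)"
  proof -
    have "lifts C d\<^sub>3 d\<^sub>3" unfolding lifts_def using d3 by (intro bexI[of _ "Ident C (Dom C d\<^sub>3)"]) simp_all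
    then have "eqv C A ((\<chi> \<cdot> (j\<^sub>1 \<cdot> d\<^sub>2)) \<cdot> d\<^sub>3) ((\<chi> \<cdot> j\<^sub>2) \<cdot> d\<^sub>3)" using lift3[of d\<^sub>3] d3 by simp
    then show ?thesis using \<chi> d3 d2 D1(3,6) D2(3,6,8) by (simp add: a_def b_def)
  qed
  \<comment> \<open>Every instance of the quantifiers is pulled back from the generic arguments
    \<open>a\<close> and \<open>b\<close> along a map \<open>k\<close> into the context.\<close>
  have context_ext: "\<exists>k. k \<in> Arr C \<and> Dom C k = Dom C h \<and> Cod C k = Dom C d \<and> d \<cdot> k = h \<and> a \<cdot> k = j \<and> b \<cdot> k = j'"
    if h: "h \<in> Arr C" "Cod C h = prd C E E" and j: "fits (e\<^sub>1 \<cdot> h) j" "fits (e\<^sub>2 \<cdot> h) j'" "eqv C A (\<chi> \<cdot> j) (\<chi> \<cdot> j')"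
    for h j j'
  proof -
    note J = fitsD[OF j(1)] and J' = fitsD[OF j(2)]
    have dj: "Dom C j = Dom C h" "Dom C j' = Dom C h" using J(3) J'(3) h e by simp_all
    obtain k\<^sub>1 where k1: "k\<^sub>1 \<in> Arr C" "Dom C k\<^sub>1 = Dom C j" "Cod C k\<^sub>1 = Dom C j\<^sub>1" "j\<^sub>1 \<cdot> k\<^sub>1 = j" "d\<^sub>1 \<cdot> k\<^sub>1 = h"
      by (rule pullback_pair[OF pb1, of j h]) (use J h e \<pi> E dj in simp_all)
    have eq2: "\<alpha> \<cdot> j' = (\<pi> \<cdot> (e\<^sub>2 \<cdot> d\<^sub>1)) \<cdot> k\<^sub>1"
      using J'(6) k1 e d1 h \<pi> E D1(8) by simp
    obtain k\<^sub>2 where k2: "k\<^sub>2 \<in> Arr C" "Dom C k\<^sub>2 = Dom C j'" "Cod C k\<^sub>2 = Dom C j\<^sub>2" "j\<^sub>2 \<cdot> k\<^sub>2 = j'" "d\<^sub>2 \<cdot> k\<^sub>2 = k\<^sub>1"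
      by (rule pullback_pair[OF pb2 J'(2) k1(1) _ _ _ eq2]) (use J' k1 dj e d1 \<pi> E D1(8) in simp_all)
    have "eqv C A ((\<chi> \<cdot> (j\<^sub>1 \<cdot> d\<^sub>2)) \<cdot> k\<^sub>2) ((\<chi> \<cdot> j\<^sub>2) \<cdot> k\<^sub>2)"
      using j(3) k1 k2 \<chi> d2 D1(3,6) D2(3,6,8) by simp
    then have "lifts C d\<^sub>3 k\<^sub>2" using lift3 k2 by simp
    then obtain k where k: "k \<in> Arr C" "Dom C k = Dom C k\<^sub>2" "Cod C k = Dom C d\<^sub>3" "d\<^sub>3 \<cdot> k = k\<^sub>2"
      unfolding lifts_def by blast
    have "d \<cdot> k = h" "a \<cdot> k = j" "b \<cdot> k = j'"
      unfolding d_def a_def b_def using k k1 k2 d1 d2 d3 D1(3,8) D2(3,8) d23 by simp_all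
    then show ?thesis using k k2 dj d by (intro exI[of _ k]) simp
  qed
  have "displayed (Dom C d) (\<lambda>k. eqv C B (app (e\<^sub>1 \<cdot> d) a \<cdot> k) (app (e\<^sub>2 \<cdot> d) b \<cdot> k))"
    using displayed_eqv[OF obs(2), of "app (e\<^sub>1 \<cdot> d) a" "app (e\<^sub>2 \<cdot> d) b"] appD[OF fa] appD[OF fb] a b d by simp
  \<comment> \<open>The body is stated for the generic arguments only. Quantifying it along
    \<open>d\<close> introduces the stage \<open>u\<close>, which matches the stage in
    \<open>same_function\<close>.\<close>
  from displayed_forall[OF d(1) this]
  have all: "displayed (prd C E E) (\<lambda>h. \<forall>u \<in> Arr C. \<forall>k \<in> Arr C. Dom C u = Dom C k \<and> Cod C u = Dom C h \<and>
      Cod C k = Dom C d \<and> d \<cdot> k = h \<cdot> u \<longrightarrow> eqv C B (app (e\<^sub>1 \<cdot> d) a \<cdot> k) (app (e\<^sub>2 \<cdot> d) b \<cdot> k))"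
    unfolding d(3) .
  have base: "displayed (prd C E E) (\<lambda>h. eqv C T ((\<pi> \<cdot> e\<^sub>1) \<cdot> h) ((\<pi> \<cdot> e\<^sub>2) \<cdot> h))"
    using displayed_eqv[OF obs(3), of "\<pi> \<cdot> e\<^sub>1" "\<pi> \<cdot> e\<^sub>2"] \<pi> e E by simp
  show ?thesis unfolding e\<^sub>1_def[symmetric] e\<^sub>2_def[symmetric]
  proof (rule displayed_cong[OF displayed_conj[OF base all]])
    fix h assume h: "h \<in> Arr C" "Cod C h = prd C E E"
    have "(\<forall>u \<in> Arr C. \<forall>k \<in> Arr C. Dom C u = Dom C k \<and> Cod C u = Dom C h \<and>
        Cod C k = Dom C d \<and> d \<cdot> k = h \<cdot> u \<longrightarrow> eqv C B (app (e\<^sub>1 \<cdot> d) a \<cdot> k) (app (e\<^sub>2 \<cdot> d) b \<cdot> k)) \<longleftrightarrow>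
      (\<forall>u j j'. u \<in> Arr C \<and> Cod C u = Dom C (e\<^sub>1 \<cdot> h) \<and> fits ((e\<^sub>1 \<cdot> h) \<cdot> u) j \<and> fits ((e\<^sub>2 \<cdot> h) \<cdot> u) j' \<and>
        eqv C A (\<chi> \<cdot> j) (\<chi> \<cdot> j') \<longrightarrow> eqv C B (app ((e\<^sub>1 \<cdot> h) \<cdot> u) j) (app ((e\<^sub>2 \<cdot> h) \<cdot> u) j'))"
      (is "?L \<longleftrightarrow> ?R")
    proof
      assume L: ?L
      show ?R
      proof (intro allI impI)
        fix u j j' assume *: "u \<in> Arr C \<and> Cod C u = Dom C (e\<^sub>1 \<cdot> h) \<and> fits ((e\<^sub>1 \<cdot> h) \<cdot> u) j \<and>
          fits ((e\<^sub>2 \<cdot> h) \<cdot> u) j' \<and> eqv C A (\<chi> \<cdot> j) (\<chi> \<cdot> j')"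
        have u: "u \<in> Arr C" "Cod C u = Dom C h" using * h e by simp_all
        have f': "fits ((e\<^sub>1 \<cdot> h) \<cdot> u) j" "fits ((e\<^sub>2 \<cdot> h) \<cdot> u) j'"
          and jj: "eqv C A (\<chi> \<cdot> j) (\<chi> \<cdot> j')" using * by blast+
        have f: "fits (e\<^sub>1 \<cdot> (h \<cdot> u)) j" "fits (e\<^sub>2 \<cdot> (h \<cdot> u)) j'" using f' u h e by simp_all
        have hu: "h \<cdot> u \<in> Arr C" "Cod C (h \<cdot> u) = prd C E E" "Dom C (h \<cdot> u) = Dom C u" using u h by simp_all
        obtain k where k: "k \<in> Arr C" "Dom C k = Dom C u" "Cod C k = Dom C d" "d \<cdot> k = h \<cdot> u" "a \<cdot> k = j" "b \<cdot> k = j'"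
          using context_ext[OF hu(1,2) f jj] hu(3) by auto
        have "eqv C B (app (e\<^sub>1 \<cdot> d) a \<cdot> k) (app (e\<^sub>2 \<cdot> d) b \<cdot> k)" using L u k by simp
        moreover have "app (e\<^sub>1 \<cdot> d) a \<cdot> k = app ((e\<^sub>1 \<cdot> h) \<cdot> u) j" "app (e\<^sub>2 \<cdot> d) b \<cdot> k = app ((e\<^sub>2 \<cdot> h) \<cdot> u) j'"
          using app_comp[OF fa, of k] app_comp[OF fb, of k] k a b d e h u by simp_all
        ultimately show "eqv C B (app ((e\<^sub>1 \<cdot> h) \<cdot> u) j) (app ((e\<^sub>2 \<cdot> h) \<cdot> u) j')" by simp
      qed
    next
      assume R: ?R
      show ?L
      proof (intro ballI impI)
        fix u k assume uk: "u \<in> Arr C" "k \<in> Arr C"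
          "Dom C u = Dom C k \<and> Cod C u = Dom C h \<and> Cod C k = Dom C d \<and> d \<cdot> k = h \<cdot> u"
        have eqs: "(e\<^sub>1 \<cdot> d) \<cdot> k = (e\<^sub>1 \<cdot> h) \<cdot> u" "(e\<^sub>2 \<cdot> d) \<cdot> k = (e\<^sub>2 \<cdot> h) \<cdot> u"
          using uk d e h by simp_all
        have "fits ((e\<^sub>1 \<cdot> h) \<cdot> u) (a \<cdot> k)" "fits ((e\<^sub>2 \<cdot> h) \<cdot> u) (b \<cdot> k)"
          using fits_comp[OF fa, of k] fits_comp[OF fb, of k] uk a b d unfolding eqs by simp_all
        moreover have "eqv C A (\<chi> \<cdot> (a \<cdot> k)) (\<chi> \<cdot> (b \<cdot> k))"
          using eqv_comp[OF obs(1) ab, of k] \<chi> a b d uk by simp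
        moreover have "Cod C u = Dom C (e\<^sub>1 \<cdot> h)" using uk e h by simp
        ultimately have "eqv C B (app ((e\<^sub>1 \<cdot> h) \<cdot> u) (a \<cdot> k)) (app ((e\<^sub>2 \<cdot> h) \<cdot> u) (b \<cdot> k))"
          using R uk(1) by blast
        then show "eqv C B (app (e\<^sub>1 \<cdot> d) a \<cdot> k) (app (e\<^sub>2 \<cdot> d) b \<cdot> k)"
          unfolding eqs[symmetric] using app_comp[OF fa, of k] app_comp[OF fb, of k] uk a b d by simp
      qed
    qed
    then show "(eqv C T ((\<pi> \<cdot> e\<^sub>1) \<cdot> h) ((\<pi> \<cdot> e\<^sub>2) \<cdot> h) \<and>
        (\<forall>u \<in> Arr C. \<forall>k \<in> Arr C. Dom C u = Dom C k \<and> Cod C u = Dom C h \<and>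
          Cod C k = Dom C d \<and> d \<cdot> k = h \<cdot> u \<longrightarrow> eqv C B (app (e\<^sub>1 \<cdot> d) a \<cdot> k) (app (e\<^sub>2 \<cdot> d) b \<cdot> k))) =
        same_function (e\<^sub>1 \<cdot> h) (e\<^sub>2 \<cdot> h)"
      unfolding same_function_def using \<pi> e h E by simp
  qed
qed

end

text \<open>\<open>\<epsilon> : E \<rightarrow> Dom C \<pi>\<close> cuts out the functions that respect the relations, and \<open>app (\<epsilon> \<cdot> w\<^sub>1) j\<close> is the
  evaluation map on the fibre product \<open>W\<close> of \<open>E\<close> and \<open>A\<close> over \<open>T\<close>.\<close>

locale exponential_object = exponential_data C A B T p q \<alpha> \<chi> \<pi> app
  for C :: "('o, 'm, 'z) fcat_scheme" (structure) and A B T p q \<alpha> \<chi> \<pi> app +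
  fixes E W :: "'o \<times> 'm" and \<epsilon> w\<^sub>1 w\<^sub>2 j :: 'm
  assumes E_ob [simp]: "E \<in> Obj (Hex C)"
    and \<epsilon>: "\<epsilon> \<in> Arr C" "Dom C \<epsilon> = fst E" "Cod C \<epsilon> = Dom C \<pi>"
    and E_eqv: "\<And>a b. \<lbrakk>a \<in> Arr C; b \<in> Arr C; Cod C a = fst E; Cod C b = fst E; Dom C a = Dom C b\<rbrakk> \<Longrightarrow>
      eqv C E a b \<longleftrightarrow> same_function (\<epsilon> \<cdot> a) (\<epsilon> \<cdot> b)"
    and E_lift: "\<And>e. \<lbrakk>e \<in> Arr C; Cod C e = Dom C \<pi>; same_function e e\<rbrakk> \<Longrightarrow>
      \<exists>h \<in> Arr C. Dom C h = Dom C e \<and> Cod C h = fst E \<and> \<epsilon> \<cdot> h = e"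
    and W_ob [simp]: "W \<in> Obj (Hex C)"
    and w1: "w\<^sub>1 \<in> hex_maps C W E" and w2: "w\<^sub>2 \<in> hex_maps C W A"
    and W_eqv: "\<And>h k. \<lbrakk>h \<in> Arr C; k \<in> Arr C; Cod C h = fst W; Cod C k = fst W; Dom C h = Dom C k\<rbrakk> \<Longrightarrow>
      eqv C W h k \<longleftrightarrow> eqv C E (w\<^sub>1 \<cdot> h) (w\<^sub>1 \<cdot> k) \<and> eqv C A (w\<^sub>2 \<cdot> h) (w\<^sub>2 \<cdot> k)"
    and W_univ: "\<And>a b. \<lbrakk>a \<in> Arr C; b \<in> Arr C; Cod C a = fst E; Cod C b = fst A; eqv C T ((\<pi> \<cdot> \<epsilon>) \<cdot> a) (p \<cdot> b)\<rbrakk> \<Longrightarrow>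
      \<exists>h. h \<in> Arr C \<and> Dom C h = Dom C b \<and> Cod C h = fst W \<and> w\<^sub>1 \<cdot> h = a \<and> w\<^sub>2 \<cdot> h = b"
    and j: "fits (\<epsilon> \<cdot> w\<^sub>1) j" "\<chi> \<cdot> j = w\<^sub>2"
begin

lemma j_arr: "j \<in> Arr C" "Dom C j = fst W" "Cod C j = Dom C \<alpha>"
  using fitsD[OF j(1)] hex_mapsD[OF w1] \<epsilon> by simp_all

lemma eval_at:
  assumes "u \<in> Arr C" "Cod C u = fst W"
  shows "fits (\<epsilon> \<cdot> (w\<^sub>1 \<cdot> u)) (j \<cdot> u)" "app (\<epsilon> \<cdot> w\<^sub>1) j \<cdot> u = app (\<epsilon> \<cdot> (w\<^sub>1 \<cdot> u)) (j \<cdot> u)" "\<chi> \<cdot> (j \<cdot> u) = w\<^sub>2 \<cdot> u"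
  using fits_comp[OF j(1), of u] app_comp[OF j(1), of u] rewrite_tail1[OF j(2), of u]
    assms j_arr hex_mapsD[OF w1] \<epsilon> \<chi> by simp_all

text \<open>Equivalent elements of \<open>W\<close> have equivalent functions and equivalent
  arguments. Since \<open>same_function\<close> compares values at two equivalent arguments,
  possibly in different fibres, it handles both variations in one step.\<close>

lemma eval_map: "app (\<epsilon> \<cdot> w\<^sub>1) j \<in> hex_maps C W B"
  unfolding hex_maps_iff[OF W_ob obs(2)]
proof (intro conjI allI impI)
  fix a b assume ab: "eqv C W a b"
  note ty = eqvD[OF ab]
  have "eqv C E (w\<^sub>1 \<cdot> a) (w\<^sub>1 \<cdot> b)" and A: "eqv C A (w\<^sub>2 \<cdot> a) (w\<^sub>2 \<cdot> b)" using ab W_eqv ty by auto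
  then have "same_function (\<epsilon> \<cdot> (w\<^sub>1 \<cdot> a)) (\<epsilon> \<cdot> (w\<^sub>1 \<cdot> b))"
    using E_eqv[of "w\<^sub>1 \<cdot> a" "w\<^sub>1 \<cdot> b"] ty hex_mapsD[OF w1] by simp
  from same_functionD[OF this eval_at(1)[OF ty(1,4)] eval_at(1)[OF ty(2,5)]]
  show "eqv C B (app (\<epsilon> \<cdot> w\<^sub>1) j \<cdot> a) (app (\<epsilon> \<cdot> w\<^sub>1) j \<cdot> b)"
    unfolding eval_at(2)[OF ty(1,4)] eval_at(2)[OF ty(2,5)] eval_at(3)[OF ty(1,4)] eval_at(3)[OF ty(2,5)]
    using A by blast
qed (use appD[OF j(1)] j_arr in simp_all)

lemma eval_over: "eqv C T (q \<cdot> app (\<epsilon> \<cdot> w\<^sub>1) j) (p \<cdot> w\<^sub>2)"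
proof -
  have "eqv C T (p \<cdot> w\<^sub>2) (\<alpha> \<cdot> j)" using fibre_over[OF j(1)] unfolding j(2) fitsD(6)[OF j(1)] .
  then show ?thesis using appD(4)[OF j(1)] eqv_sym[OF obs(3)] eqv_trans[OF obs(3)] by blast
qed

end

section \<open>Transposes of maps \<open>V \<rightarrow> B\<close>, where \<open>V\<close> is the
  fibre product of \<open>Z\<close> and \<open>A\<close> over \<open>T\<close>\<close>

locale exponential_test = exponential_object C A B T p q \<alpha> \<chi> \<pi> app E W \<epsilon> w\<^sub>1 w\<^sub>2 j
  for C :: "('o, 'm, 'z) fcat_scheme" (structure) and A B T p q \<alpha> \<chi> \<pi> app E W \<epsilon> w\<^sub>1 w\<^sub>2 j +
  fixes Z V :: "'o \<times> 'm" and z v\<^sub>1 v\<^sub>2 f :: 'm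
  assumes Z_ob [simp]: "Z \<in> Obj (Hex C)" and V_ob [simp]: "V \<in> Obj (Hex C)"
    and z: "z \<in> hex_maps C Z T" and v1: "v\<^sub>1 \<in> hex_maps C V Z" and v2: "v\<^sub>2 \<in> hex_maps C V A"
    and V_comm: "eqv C T (z \<cdot> v\<^sub>1) (p \<cdot> v\<^sub>2)"
    and V_eqv: "\<And>h k. \<lbrakk>h \<in> Arr C; k \<in> Arr C; Cod C h = fst V; Cod C k = fst V; Dom C h = Dom C k\<rbrakk> \<Longrightarrow>
      eqv C V h k \<longleftrightarrow> eqv C Z (v\<^sub>1 \<cdot> h) (v\<^sub>1 \<cdot> k) \<and> eqv C A (v\<^sub>2 \<cdot> h) (v\<^sub>2 \<cdot> k)"
    and V_univ: "\<And>a b. \<lbrakk>a \<in> Arr C; b \<in> Arr C; Cod C a = fst Z; Cod C b = fst A; eqv C T (z \<cdot> a) (p \<cdot> b)\<rbrakk> \<Longrightarrow>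
      \<exists>h. h \<in> Arr C \<and> Dom C h = Dom C b \<and> Cod C h = fst V \<and> v\<^sub>1 \<cdot> h = a \<and> v\<^sub>2 \<cdot> h = b"
    and f: "f \<in> hex_maps C V B" "eqv C T (q \<cdot> f) (p \<cdot> v\<^sub>2)"
begin

text \<open>\<open>f\<close> lives on \<open>V\<close>, a fibre product taken up to the relation of
  \<open>T\<close>, whereas abstraction takes place over a strict pullback, that of
  \<open>\<alpha>\<close> and \<open>z\<close>. The map \<open>c\<close> from the latter to the
  former reads off the underlying elements, and \<open>f \<cdot> c\<close> is abstracted. The
  resulting beta-law is stated for all arguments \<open>i\<close> at all stages
  \<open>t\<close>.\<close>

lemma abstracted_function:
  obtains n where "n \<in> Arr C" "Dom C n = fst Z" "Cod C n = Dom C \<pi>" "\<pi> \<cdot> n = z"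
    "\<And>t i. \<lbrakk>t \<in> Arr C; Cod C t = fst Z; fits (n \<cdot> t) i\<rbrakk> \<Longrightarrow>
      \<exists>d. d \<in> Arr C \<and> Dom C d = Dom C t \<and> Cod C d = fst V \<and> v\<^sub>1 \<cdot> d = t \<and> v\<^sub>2 \<cdot> d = \<chi> \<cdot> i \<and>
        eqv C B (app (n \<cdot> t) i) (f \<cdot> d)"
proof -
  note ty = hex_mapsD[OF z] hex_mapsD[OF v1] hex_mapsD[OF v2] hex_mapsD[OF f(1)] hex_mapsD[OF p] hex_mapsD[OF q]
  obtain a b where pb: "is_pullback C \<alpha> z a b" using fib_pullback_exists[of \<alpha> z] \<alpha> ty by auto
  note D = pullbackD[OF pb]
  have pa: "eqv C T (p \<cdot> (\<chi> \<cdot> a)) (\<alpha> \<cdot> a)" using eqv_comp[OF obs(3) \<chi>(4), of a] D \<chi> ty by simp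
  have "eqv C T (z \<cdot> b) (p \<cdot> (\<chi> \<cdot> a))" unfolding D(9)[symmetric] by (rule eqv_sym[OF obs(3) pa])
  from V_univ[OF _ _ _ _ this] D ty \<chi>
  obtain c where c: "c \<in> Arr C" "Dom C c = Dom C a" "Cod C c = fst V" "v\<^sub>1 \<cdot> c = b" "v\<^sub>2 \<cdot> c = \<chi> \<cdot> a" by auto
  have "eqv C T (q \<cdot> (f \<cdot> c)) (p \<cdot> (\<chi> \<cdot> a))"
    using eqv_comp[OF obs(3) f(2), of c] c ty by simp
  then have "eqv C T (q \<cdot> (f \<cdot> c)) (\<alpha> \<cdot> a)" using pa eqv_trans[OF obs(3)] by blast
  from abstraction[OF pb _ _ _ this] c ty
  obtain n where n: "n \<in> Arr C" "Dom C n = fst Z" "Cod C n = Dom C \<pi>" "\<pi> \<cdot> n = z" "eqv C B (f \<cdot> c) (app (n \<cdot> b) a)"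
    by auto
  have nb: "fits (n \<cdot> b) a" unfolding fits_def using n D ty \<pi> by (simp add: rewrite_tail1[OF n(4)])
  show ?thesis
  proof (rule that[OF n(1-4)])
    fix t i assume t: "t \<in> Arr C" "Cod C t = fst Z" "fits (n \<cdot> t) i"
    note I = fitsD[OF t(3)]
    have dom: "Dom C i = Dom C t" using I(3) t n by simp
    have zt: "\<alpha> \<cdot> i = z \<cdot> t" using I(6) t n \<pi> by (simp add: rewrite_tail1[OF n(4)])
    \<comment> \<open>The argument \<open>i\<close> is a substitution instance, along
      \<open>s\<close>, of the generic argument \<open>a\<close>.\<close>
    obtain s where s: "s \<in> Arr C" "Dom C s = Dom C i" "Cod C s = Dom C a" "a \<cdot> s = i" "b \<cdot> s = t"
      by (rule pullback_pair[OF pb I(2) t(1) dom I(5) _ zt]) (use t ty in simp)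
    have "app (n \<cdot> t) i = app (n \<cdot> b) a \<cdot> s"
      using app_comp[OF nb s(1,3)] s n D ty by simp
    moreover have "eqv C B ((f \<cdot> c) \<cdot> s) (app (n \<cdot> b) a \<cdot> s)"
      by (rule eqv_comp[OF obs(2) n(5) s(1)]) (use s appD[OF nb] in simp)
    ultimately have "eqv C B (app (n \<cdot> t) i) ((f \<cdot> c) \<cdot> s)" using eqv_sym[OF obs(2)] by simp
    then have "eqv C B (app (n \<cdot> t) i) (f \<cdot> (c \<cdot> s))" using c s ty by simp
    moreover have "v\<^sub>1 \<cdot> (c \<cdot> s) = t" "v\<^sub>2 \<cdot> (c \<cdot> s) = \<chi> \<cdot> i"
      using c(1-3) s D \<chi> ty by (simp_all add: rewrite_tail1[OF c(4)] rewrite_tail[OF c(5)])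
    ultimately show "\<exists>d. d \<in> Arr C \<and> Dom C d = Dom C t \<and> Cod C d = fst V \<and> v\<^sub>1 \<cdot> d = t \<and> v\<^sub>2 \<cdot> d = \<chi> \<cdot> i \<and>
        eqv C B (app (n \<cdot> t) i) (f \<cdot> d)"
      using c s dom by (intro exI[of _ "c \<cdot> s"]) simp
  qed
qed

lemma transpose_exists:
  obtains n k where "n \<in> hex_maps C Z E" "(\<pi> \<cdot> \<epsilon>) \<cdot> n = z" "k \<in> hex_maps C V W"
    "w\<^sub>1 \<cdot> k = n \<cdot> v\<^sub>1" "w\<^sub>2 \<cdot> k = v\<^sub>2" "eqv C B (app (\<epsilon> \<cdot> w\<^sub>1) j \<cdot> k) f"
proof -
  note ty = hex_mapsD[OF z] hex_mapsD[OF v1] hex_mapsD[OF v2] hex_mapsD[OF f(1)] hex_mapsD[OF w1] hex_mapsD[OF w2]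
  obtain n where n: "n \<in> Arr C" "Dom C n = fst Z" "Cod C n = Dom C \<pi>" "\<pi> \<cdot> n = z"
    and beta: "\<And>t i. \<lbrakk>t \<in> Arr C; Cod C t = fst Z; fits (n \<cdot> t) i\<rbrakk> \<Longrightarrow>
      \<exists>d. d \<in> Arr C \<and> Dom C d = Dom C t \<and> Cod C d = fst V \<and> v\<^sub>1 \<cdot> d = t \<and> v\<^sub>2 \<cdot> d = \<chi> \<cdot> i \<and>
        eqv C B (app (n \<cdot> t) i) (f \<cdot> d)"
    by (rule abstracted_function) (rule that; assumption)
  \<comment> \<open>Values of \<open>n\<close> at equivalent arguments over equivalent points are
    values of \<open>f\<close> at equivalent elements of \<open>V\<close>. Taken at the identity of
    \<open>Z\<close>, this says that \<open>n\<close> consists of functions respecting the relations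
    and so factors through \<open>\<epsilon>\<close>; taken at arbitrary pairs, it makes that
    factorization a map of \<open>Hex C\<close>.\<close>
  have resp: "same_function (n \<cdot> a) (n \<cdot> b)" if ab: "eqv C Z a b" for a b
    unfolding same_function_def
  proof (intro conjI allI impI)
    note tyab = eqvD[OF ab]
    show "eqv C T (\<pi> \<cdot> (n \<cdot> a)) (\<pi> \<cdot> (n \<cdot> b))"
      using hex_maps_eqv[OF z Z_ob obs(3) ab] tyab n \<pi> by (simp add: rewrite_tail1[OF n(4)])
    fix u i i'
    assume *: "u \<in> Arr C \<and> Cod C u = Dom C (n \<cdot> a) \<and> fits ((n \<cdot> a) \<cdot> u) i \<and> fits ((n \<cdot> b) \<cdot> u) i' \<and>
      eqv C A (\<chi> \<cdot> i) (\<chi> \<cdot> i')"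
    have u: "u \<in> Arr C" "Cod C u = Dom C b" using * tyab n by simp_all
    have eqs: "(n \<cdot> a) \<cdot> u = n \<cdot> (a \<cdot> u)" "(n \<cdot> b) \<cdot> u = n \<cdot> (b \<cdot> u)" using u tyab n by simp_all
    have au: "a \<cdot> u \<in> Arr C" "Cod C (a \<cdot> u) = fst Z" "b \<cdot> u \<in> Arr C" "Cod C (b \<cdot> u) = fst Z"
      "Dom C (a \<cdot> u) = Dom C u" "Dom C (b \<cdot> u) = Dom C u" using u tyab by simp_all
    have fi: "fits (n \<cdot> (a \<cdot> u)) i" "fits (n \<cdot> (b \<cdot> u)) i'" "eqv C A (\<chi> \<cdot> i) (\<chi> \<cdot> i')" using * unfolding eqs by blast+
    obtain d where d: "d \<in> Arr C" "Dom C d = Dom C u" "Cod C d = fst V" "v\<^sub>1 \<cdot> d = a \<cdot> u" "v\<^sub>2 \<cdot> d = \<chi> \<cdot> i"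
        "eqv C B (app (n \<cdot> (a \<cdot> u)) i) (f \<cdot> d)"
      using beta[OF au(1,2) fi(1)] unfolding au(5) by blast
    obtain d' where d': "d' \<in> Arr C" "Dom C d' = Dom C u" "Cod C d' = fst V" "v\<^sub>1 \<cdot> d' = b \<cdot> u" "v\<^sub>2 \<cdot> d' = \<chi> \<cdot> i'"
        "eqv C B (app (n \<cdot> (b \<cdot> u)) i') (f \<cdot> d')"
      using beta[OF au(3,4) fi(2)] unfolding au(6) by blast
    have "eqv C V d d'"
      using V_eqv[of d d'] d(1-5) d'(1-5) eqv_comp[OF Z_ob ab u] fi(3) by simp
    from hex_maps_eqv[OF f(1) V_ob obs(2) this]
    show "eqv C B (app ((n \<cdot> a) \<cdot> u) i) (app ((n \<cdot> b) \<cdot> u) i')"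
      unfolding eqs using d(6) d'(6) eqv_sym[OF obs(2)] eqv_trans[OF obs(2)] by blast
  qed
  have "same_function n n"
    using resp[OF eqv_refl[OF Z_ob, of "Ident C (fst Z)"]] n by simp
  then obtain m where m: "m \<in> Arr C" "Dom C m = fst Z" "Cod C m = fst E" "\<epsilon> \<cdot> m = n"
    using E_lift[OF n(1,3)] n(2) by auto
  have mE: "m \<in> hex_maps C Z E" unfolding hex_maps_iff[OF Z_ob E_ob]
  proof (intro conjI allI impI)
    fix a b assume ab: "eqv C Z a b"
    show "eqv C E (m \<cdot> a) (m \<cdot> b)"
      using E_eqv[of "m \<cdot> a" "m \<cdot> b"] resp[OF ab] eqvD[OF ab] m \<epsilon> by (simp add: rewrite_tail1[OF m(4)])
  qed (use m in simp_all)
  have mz: "(\<pi> \<cdot> \<epsilon>) \<cdot> m = z" using m \<epsilon> \<pi> n by simp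
  have "eqv C T ((\<pi> \<cdot> \<epsilon>) \<cdot> (m \<cdot> v\<^sub>1)) (p \<cdot> v\<^sub>2)"
  proof -
    have "(\<pi> \<cdot> \<epsilon>) \<cdot> (m \<cdot> v\<^sub>1) = z \<cdot> v\<^sub>1"
      by (rule rewrite_tail1[OF mz]) (use m \<epsilon> \<pi> ty in simp_all)
    then show ?thesis using V_comm by simp
  qed
  from W_univ[OF _ _ _ _ this] m ty
  obtain k where k: "k \<in> Arr C" "Dom C k = fst V" "Cod C k = fst W" "w\<^sub>1 \<cdot> k = m \<cdot> v\<^sub>1" "w\<^sub>2 \<cdot> k = v\<^sub>2" by auto
  have kW: "k \<in> hex_maps C V W" unfolding hex_maps_iff[OF V_ob W_ob]
  proof (intro conjI allI impI)
    fix a b assume ab: "eqv C V a b"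
    note tyab = eqvD[OF ab]
    have "eqv C E (m \<cdot> (v\<^sub>1 \<cdot> a)) (m \<cdot> (v\<^sub>1 \<cdot> b))"
      by (rule hex_maps_eqv[OF mE Z_ob E_ob hex_maps_eqv[OF v1 V_ob Z_ob ab]])
    moreover have "w\<^sub>1 \<cdot> (k \<cdot> a) = m \<cdot> (v\<^sub>1 \<cdot> a)" "w\<^sub>1 \<cdot> (k \<cdot> b) = m \<cdot> (v\<^sub>1 \<cdot> b)"
      by (rule rewrite_tail[OF k(4)]; use k m ty tyab in simp)+
    moreover have "w\<^sub>2 \<cdot> (k \<cdot> a) = v\<^sub>2 \<cdot> a" "w\<^sub>2 \<cdot> (k \<cdot> b) = v\<^sub>2 \<cdot> b"
      by (rule rewrite_tail1[OF k(5)]; use k ty tyab in simp)+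
    ultimately show "eqv C W (k \<cdot> a) (k \<cdot> b)"
      using W_eqv[of "k \<cdot> a" "k \<cdot> b"] hex_maps_eqv[OF v2 V_ob obs(1) ab] k tyab by simp
  qed (use k in simp_all)
  have "eqv C B (app (\<epsilon> \<cdot> w\<^sub>1) j \<cdot> k) f"
  proof -
    note ev = eval_at[OF k(1,3)]
    have e: "\<epsilon> \<cdot> (w\<^sub>1 \<cdot> k) = n \<cdot> v\<^sub>1" unfolding k(4) by (rule rewrite_tail1[OF m(4)]) (use m \<epsilon> ty in simp_all)
    \<comment> \<open>The components of \<open>d\<close> are those of the identity of
      \<open>V\<close>, but its witness may differ. The relation of \<open>V\<close> ignores
      witnesses, so \<open>f \<cdot> d\<close> is equivalent to \<open>f\<close>.\<close>
    obtain d where d: "d \<in> Arr C" "Dom C d = fst V" "Cod C d = fst V" "v\<^sub>1 \<cdot> d = v\<^sub>1" "v\<^sub>2 \<cdot> d = v\<^sub>2"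
        "eqv C B (app (n \<cdot> v\<^sub>1) (j \<cdot> k)) (f \<cdot> d)"
      using beta[OF ty(4,6) ev(1)[unfolded e]] unfolding ev(3) k(5) ty(5) by blast
    have "eqv C V d (Ident C (fst V))"
      using V_eqv[of d "Ident C (fst V)"] d(1-5) ty eqv_refl[OF Z_ob, of v\<^sub>1] eqv_refl[OF obs(1), of v\<^sub>2] by simp
    from hex_maps_eqv[OF f(1) V_ob obs(2) this] have "eqv C B (f \<cdot> d) f" using ty by simp
    then show ?thesis unfolding ev(2) e using d(6) eqv_trans[OF obs(2)] by blast
  qed
  then show ?thesis using that mE mz kW k(4,5) by blast
qed

text \<open>Functions are compared through their values, and \<open>key\<close> shows that the
  values of a transpose are prescribed by \<open>f\<close>: at stage \<open>u\<close> and argument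
  \<open>i\<close> the value is equivalent to \<open>f\<close> at an element \<open>v\<close> of
  \<open>V\<close> with components \<open>u\<close> and, up to equivalence,
  \<open>\<chi> \<cdot> i\<close>. The hypotheses are equivalences because they translate equations
  of \<open>Hex C\<close>.\<close>

lemma transpose_unique:
  assumes n: "n \<in> hex_maps C Z E" "eqv C T ((\<pi> \<cdot> \<epsilon>) \<cdot> n) z" "k \<in> hex_maps C V W"
      "eqv C E (w\<^sub>1 \<cdot> k) (n \<cdot> v\<^sub>1)" "eqv C A (w\<^sub>2 \<cdot> k) v\<^sub>2" "eqv C B (app (\<epsilon> \<cdot> w\<^sub>1) j \<cdot> k) f"
    and n': "n' \<in> hex_maps C Z E" "eqv C T ((\<pi> \<cdot> \<epsilon>) \<cdot> n') z" "k' \<in> hex_maps C V W"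
      "eqv C E (w\<^sub>1 \<cdot> k') (n' \<cdot> v\<^sub>1)" "eqv C A (w\<^sub>2 \<cdot> k') v\<^sub>2" "eqv C B (app (\<epsilon> \<cdot> w\<^sub>1) j \<cdot> k') f"
  shows "eqv C E n n'"
proof -
  note ty = hex_mapsD[OF z] hex_mapsD[OF v1] hex_mapsD[OF v2] hex_mapsD[OF f(1)] hex_mapsD[OF w1] hex_mapsD[OF w2]
  have key: "eqv C B (app (\<epsilon> \<cdot> (n \<cdot> u)) i) (f \<cdot> v)"
    if n: "n \<in> hex_maps C Z E" "k \<in> hex_maps C V W"
      "eqv C E (w\<^sub>1 \<cdot> k) (n \<cdot> v\<^sub>1)" "eqv C A (w\<^sub>2 \<cdot> k) v\<^sub>2" "eqv C B (app (\<epsilon> \<cdot> w\<^sub>1) j \<cdot> k) f"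
      and v: "v \<in> Arr C" "Cod C v = fst V" "v\<^sub>1 \<cdot> v = u" and i: "fits (\<epsilon> \<cdot> (n \<cdot> u)) i" "eqv C A (v\<^sub>2 \<cdot> v) (\<chi> \<cdot> i)"
    for n k u v i
  proof -
    note tn = hex_mapsD[OF n(1)] hex_mapsD[OF n(2)]
    have kv: "k \<cdot> v \<in> Arr C" "Cod C (k \<cdot> v) = fst W" using tn v by simp_all
    note ev = eval_at[OF kv]
    have u: "u \<in> Arr C" "Cod C u = fst Z" "Dom C u = Dom C v" unfolding v(3)[symmetric] using v(1,2) ty by simp_all
    have "eqv C E ((w\<^sub>1 \<cdot> k) \<cdot> v) ((n \<cdot> v\<^sub>1) \<cdot> v)"
      by (rule eqv_comp[OF E_ob n(3) v(1)]) (use v tn ty in simp)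
    then have "eqv C E (w\<^sub>1 \<cdot> (k \<cdot> v)) (n \<cdot> u)" using v tn ty by simp
    then have "same_function (\<epsilon> \<cdot> (w\<^sub>1 \<cdot> (k \<cdot> v))) (\<epsilon> \<cdot> (n \<cdot> u))"
      using E_eqv[of "w\<^sub>1 \<cdot> (k \<cdot> v)" "n \<cdot> u"] kv u tn ty v by simp
    moreover have "eqv C A (\<chi> \<cdot> (j \<cdot> (k \<cdot> v))) (\<chi> \<cdot> i)"
    proof -
      have "eqv C A ((w\<^sub>2 \<cdot> k) \<cdot> v) (v\<^sub>2 \<cdot> v)" by (rule eqv_comp[OF obs(1) n(4) v(1)]) (use v ty in simp)
      then have "eqv C A (w\<^sub>2 \<cdot> (k \<cdot> v)) (v\<^sub>2 \<cdot> v)" using v tn ty by simp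
      then show ?thesis unfolding ev(3) using i(2) eqv_trans[OF obs(1)] by blast
    qed
    ultimately have "eqv C B (app (\<epsilon> \<cdot> (w\<^sub>1 \<cdot> (k \<cdot> v))) (j \<cdot> (k \<cdot> v))) (app (\<epsilon> \<cdot> (n \<cdot> u)) i)"
      using same_functionD ev(1) i(1) by blast
    moreover have "eqv C B ((app (\<epsilon> \<cdot> w\<^sub>1) j \<cdot> k) \<cdot> v) (f \<cdot> v)"
      by (rule eqv_comp[OF obs(2) n(5) v(1)]) (use v ty in simp)
    moreover have "(app (\<epsilon> \<cdot> w\<^sub>1) j \<cdot> k) \<cdot> v = app (\<epsilon> \<cdot> (w\<^sub>1 \<cdot> (k \<cdot> v))) (j \<cdot> (k \<cdot> v))"
      using ev(2) v tn hex_mapsD[OF eval_map] by simp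
    ultimately show ?thesis using eqv_sym[OF obs(2)] eqv_trans[OF obs(2)] by metis
  qed
  note tn = hex_mapsD[OF n(1)] hex_mapsD[OF n'(1)]
  have "same_function (\<epsilon> \<cdot> n) (\<epsilon> \<cdot> n')" unfolding same_function_def
  proof (intro conjI allI impI)
    have pn: "eqv C T ((\<pi> \<cdot> \<epsilon>) \<cdot> n) ((\<pi> \<cdot> \<epsilon>) \<cdot> n')"
      using n(2) n'(2) eqv_sym[OF obs(3)] eqv_trans[OF obs(3)] by blast
    then show "eqv C T (\<pi> \<cdot> (\<epsilon> \<cdot> n)) (\<pi> \<cdot> (\<epsilon> \<cdot> n'))" using \<pi> \<epsilon> tn by simp
    fix u i i'
    assume *: "u \<in> Arr C \<and> Cod C u = Dom C (\<epsilon> \<cdot> n) \<and> fits ((\<epsilon> \<cdot> n) \<cdot> u) i \<and> fits ((\<epsilon> \<cdot> n') \<cdot> u) i' \<and>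
      eqv C A (\<chi> \<cdot> i) (\<chi> \<cdot> i')"
    have u: "u \<in> Arr C" "Cod C u = fst Z" using * tn \<epsilon> by simp_all
    have eqs: "(\<epsilon> \<cdot> n) \<cdot> u = \<epsilon> \<cdot> (n \<cdot> u)" "(\<epsilon> \<cdot> n') \<cdot> u = \<epsilon> \<cdot> (n' \<cdot> u)" using u tn \<epsilon> by simp_all
    have fi: "fits (\<epsilon> \<cdot> (n \<cdot> u)) i" "fits (\<epsilon> \<cdot> (n' \<cdot> u)) i'" "eqv C A (\<chi> \<cdot> i) (\<chi> \<cdot> i')" using * unfolding eqs by blast+
    have "eqv C T (((\<pi> \<cdot> \<epsilon>) \<cdot> n) \<cdot> u) (z \<cdot> u)" by (rule eqv_comp[OF obs(3) n(2) u(1)]) (use u ty in simp)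
    then have "eqv C T (\<pi> \<cdot> (\<epsilon> \<cdot> (n \<cdot> u))) (z \<cdot> u)" using u tn \<epsilon> \<pi> by simp
    then have "eqv C T (z \<cdot> u) (p \<cdot> (\<chi> \<cdot> i))"
      using fibre_over[OF fi(1)] eqv_sym[OF obs(3)] eqv_trans[OF obs(3)] by blast
    from V_univ[OF _ _ _ _ this] u fitsD[OF fi(1)] \<chi>
    \<comment> \<open>One \<open>v\<close> serves both functions: its second component is
      \<open>\<chi> \<cdot> i\<close>, which is equivalent to
      \<open>\<chi> \<cdot> i'\<close>.\<close>
    obtain v where v: "v \<in> Arr C" "Cod C v = fst V" "v\<^sub>1 \<cdot> v = u" "v\<^sub>2 \<cdot> v = \<chi> \<cdot> i" by auto
    have "eqv C A (v\<^sub>2 \<cdot> v) (\<chi> \<cdot> i)" unfolding v(4)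
      by (rule eqv_refl[OF obs(1)]) (use fitsD[OF fi(1)] \<chi> in simp_all)
    moreover from this fi(3) have "eqv C A (v\<^sub>2 \<cdot> v) (\<chi> \<cdot> i')" by (rule eqv_trans[OF obs(1)])
    ultimately show "eqv C B (app ((\<epsilon> \<cdot> n) \<cdot> u) i) (app ((\<epsilon> \<cdot> n') \<cdot> u) i')"
      unfolding eqs
      using key[OF n(1,3-6) v(1-3) fi(1)] key[OF n'(1,3-6) v(1-3) fi(2)]
        eqv_sym[OF obs(2)] eqv_trans[OF obs(2)] by blast
  qed
  then show ?thesis using E_eqv[OF tn(1,4,3,6)] tn by simp
qed

end

section \<open>The exponential object and its universal property\<close>

context exponential_data
begin

text \<open>The carrier is \<open>same_function\<close> substituted along the diagonal, and the
  relation is \<open>same_function\<close> substituted along \<open>\<epsilon>\<close>; reflexivity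
  thus holds by the choice of the carrier, since \<open>\<epsilon> \<cdot> a\<close> lifts through
  \<open>\<epsilon>\<close>.\<close>

lemma function_object:
  assumes Pi: "weak_homotopy_Pi_types C"
  obtains E \<epsilon> where "E \<in> Obj (Hex C)" "\<epsilon> \<in> Arr C" "Dom C \<epsilon> = fst E" "Cod C \<epsilon> = Dom C \<pi>"
    "\<And>a b. \<lbrakk>a \<in> Arr C; b \<in> Arr C; Cod C a = fst E; Cod C b = fst E; Dom C a = Dom C b\<rbrakk> \<Longrightarrow>
      eqv C E a b \<longleftrightarrow> same_function (\<epsilon> \<cdot> a) (\<epsilon> \<cdot> b)"
    "\<And>e. \<lbrakk>e \<in> Arr C; Cod C e = Dom C \<pi>; same_function e e\<rbrakk> \<Longrightarrow>
      \<exists>h \<in> Arr C. Dom C h = Dom C e \<and> Cod C h = fst E \<and> \<epsilon> \<cdot> h = e"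
proof -
  define X where "X = Dom C \<pi>"
  have X: "X \<in> Obj C" using \<pi> by (simp add: X_def)
  note disp = displayed_same_function[OF Pi, folded X_def]
  have "displayed X (\<lambda>h. same_function h h)"
    using displayed_cong[OF displayed_subst[OF disp, of "pairing C (Ident C X) (Ident C X)"], of "\<lambda>h. same_function h h"] X
    by simp
  then obtain \<epsilon> where \<epsilon>: "\<epsilon> \<in> Fib C" "Cod C \<epsilon> = X"
    and lift: "\<And>h. \<lbrakk>h \<in> Arr C; Cod C h = X\<rbrakk> \<Longrightarrow> same_function h h = lifts C \<epsilon> h"
    unfolding displayed_def by auto
  let ?F = "Dom C \<epsilon>"
  have F: "?F \<in> Obj C" using \<epsilon> by simp
  let ?p = "pr1 C ?F ?F" and ?q = "pr2 C ?F ?F"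
  have dispF: "displayed (prd C ?F ?F) (\<lambda>h. same_function (\<epsilon> \<cdot> (?p \<cdot> h)) (\<epsilon> \<cdot> (?q \<cdot> h)))"
    using displayed_cong[OF displayed_subst[OF disp, of "pairing C (\<epsilon> \<cdot> ?p) (\<epsilon> \<cdot> ?q)"],
        of "\<lambda>h. same_function (\<epsilon> \<cdot> (?p \<cdot> h)) (\<epsilon> \<cdot> (?q \<cdot> h))"] X F \<epsilon>
    by simp
  obtain E where E: "E \<in> Obj (Hex C)" "fst E = ?F"
    and E_eqv: "\<And>a b. eqv C E a b \<longleftrightarrow> a \<in> Arr C \<and> b \<in> Arr C \<and> Dom C a = Dom C b \<and> Cod C a = ?F \<and> Cod C b = ?F \<and>
      same_function (\<epsilon> \<cdot> a) (\<epsilon> \<cdot> b)"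
  proof (rule Hex_objI[of ?F "\<lambda>a b. same_function (\<epsilon> \<cdot> a) (\<epsilon> \<cdot> b)", OF F dispF])
    show "same_function (\<epsilon> \<cdot> a) (\<epsilon> \<cdot> a)" if "a \<in> Arr C" "Cod C a = ?F" for a
    proof -
      have "lifts C \<epsilon> (\<epsilon> \<cdot> a)" unfolding lifts_def using that \<epsilon> by (intro bexI[of _ a]) simp_all
      then show ?thesis using lift that \<epsilon> by simp
    qed
    show "same_function (\<epsilon> \<cdot> b) (\<epsilon> \<cdot> a)"
      if "a \<in> Arr C" "b \<in> Arr C" "Cod C a = ?F" "Cod C b = ?F" "Dom C a = Dom C b" "same_function (\<epsilon> \<cdot> a) (\<epsilon> \<cdot> b)" for a b
      by (rule same_function_sym[OF that(6)]) (use that(1-5) \<epsilon> in simp)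
    show "same_function (\<epsilon> \<cdot> a) (\<epsilon> \<cdot> c)"
      if "a \<in> Arr C" "b \<in> Arr C" "c \<in> Arr C" "Cod C a = ?F" "Cod C b = ?F" "Cod C c = ?F"
        "Dom C a = Dom C b" "Dom C b = Dom C c" "same_function (\<epsilon> \<cdot> a) (\<epsilon> \<cdot> b)" "same_function (\<epsilon> \<cdot> b) (\<epsilon> \<cdot> c)" for a b c
      by (rule same_function_trans[OF that(9,10)]) (use that(1-8) \<epsilon> X_def in simp_all)
  qed (rule that; assumption)
  show ?thesis
  proof (rule that[OF E(1)])
    show "\<epsilon> \<in> Arr C" "Dom C \<epsilon> = fst E" "Cod C \<epsilon> = Dom C \<pi>" using \<epsilon> E by (simp_all add: X_def)
    fix a b assume "a \<in> Arr C" "b \<in> Arr C" "Cod C a = fst E" "Cod C b = fst E" "Dom C a = Dom C b"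
    then show "eqv C E a b \<longleftrightarrow> same_function (\<epsilon> \<cdot> a) (\<epsilon> \<cdot> b)" unfolding E_eqv E(2) by simp
  next
    fix e assume "e \<in> Arr C" "Cod C e = Dom C \<pi>" "same_function e e"
    then have "lifts C \<epsilon> e" using lift[of e] by (simp add: X_def)
    then show "\<exists>h \<in> Arr C. Dom C h = Dom C e \<and> Cod C h = fst E \<and> \<epsilon> \<cdot> h = e"
      unfolding lifts_def E(2) .
  qed
qed

lemma slice_exponential_data:
  assumes Pi: "weak_homotopy_Pi_types C"
  defines "P \<equiv> hex_class C A T p" and "Q \<equiv> hex_class C B T q"
  shows "\<exists>e w\<^sub>1 w\<^sub>2 ev. Cod (Hex C) e = T \<and> is_pullback (Hex C) e P w\<^sub>1 w\<^sub>2 \<and>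
    ev \<in> Hom (Hex C) (Dom (Hex C) w\<^sub>1) B \<and> Q \<cdot>\<^bsub>Hex C\<^esub> ev = P \<cdot>\<^bsub>Hex C\<^esub> w\<^sub>2 \<and>
    (\<forall>z. z \<in> Arr (Hex C) \<and> Cod (Hex C) z = T \<longrightarrow> (\<exists>v\<^sub>1 v\<^sub>2. is_pullback (Hex C) z P v\<^sub>1 v\<^sub>2 \<and>
      (\<forall>f \<in> Hom (Hex C) (Dom (Hex C) v\<^sub>1) B. Q \<cdot>\<^bsub>Hex C\<^esub> f = P \<cdot>\<^bsub>Hex C\<^esub> v\<^sub>2 \<longrightarrow>
        (\<exists>!n. n \<in> Hom (Hex C) (Dom (Hex C) z) (Dom (Hex C) e) \<and> e \<cdot>\<^bsub>Hex C\<^esub> n = z \<and>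
          (\<exists>k \<in> Hom (Hex C) (Dom (Hex C) v\<^sub>1) (Dom (Hex C) w\<^sub>1).
            w\<^sub>1 \<cdot>\<^bsub>Hex C\<^esub> k = n \<cdot>\<^bsub>Hex C\<^esub> v\<^sub>1 \<and> w\<^sub>2 \<cdot>\<^bsub>Hex C\<^esub> k = v\<^sub>2 \<and> ev \<cdot>\<^bsub>Hex C\<^esub> k = f)))))"
proof -
  obtain E \<epsilon> where E: "E \<in> Obj (Hex C)" "\<epsilon> \<in> Arr C" "Dom C \<epsilon> = fst E" "Cod C \<epsilon> = Dom C \<pi>"
    and E_eqv: "\<And>a b. \<lbrakk>a \<in> Arr C; b \<in> Arr C; Cod C a = fst E; Cod C b = fst E; Dom C a = Dom C b\<rbrakk> \<Longrightarrow>
      eqv C E a b \<longleftrightarrow> same_function (\<epsilon> \<cdot> a) (\<epsilon> \<cdot> b)"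
    and E_lift: "\<And>e. \<lbrakk>e \<in> Arr C; Cod C e = Dom C \<pi>; same_function e e\<rbrakk> \<Longrightarrow>
      \<exists>h \<in> Arr C. Dom C h = Dom C e \<and> Cod C h = fst E \<and> \<epsilon> \<cdot> h = e"
    by (rule function_object[OF Pi]) (rule that; assumption)
  have \<pi>\<epsilon>: "\<pi> \<cdot> \<epsilon> \<in> hex_maps C E T" unfolding hex_maps_iff[OF E(1) obs(3)]
  proof (intro conjI allI impI)
    fix a b assume ab: "eqv C E a b"
    note ty = eqvD[OF ab]
    have "same_function (\<epsilon> \<cdot> a) (\<epsilon> \<cdot> b)" using E_eqv[OF ty(1,2,4,5,3)] ab by blast
    then have "eqv C T (\<pi> \<cdot> (\<epsilon> \<cdot> a)) (\<pi> \<cdot> (\<epsilon> \<cdot> b))" unfolding same_function_def by blast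
    then show "eqv C T ((\<pi> \<cdot> \<epsilon>) \<cdot> a) ((\<pi> \<cdot> \<epsilon>) \<cdot> b)" using ty E \<pi> by simp
  qed (use E \<pi> in simp_all)
  obtain W w\<^sub>1 w\<^sub>2 where W: "W \<in> Obj (Hex C)" "w\<^sub>1 \<in> hex_maps C W E" "w\<^sub>2 \<in> hex_maps C W A"
    and pbW: "is_pullback (Hex C) (hex_class C E T (\<pi> \<cdot> \<epsilon>)) (hex_class C A T p) (hex_class C W E w\<^sub>1) (hex_class C W A w\<^sub>2)"
    and W_comm: "eqv C T ((\<pi> \<cdot> \<epsilon>) \<cdot> w\<^sub>1) (p \<cdot> w\<^sub>2)"
    and W_eqv: "\<And>h k. \<lbrakk>h \<in> Arr C; k \<in> Arr C; Cod C h = fst W; Cod C k = fst W; Dom C h = Dom C k\<rbrakk> \<Longrightarrow>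
      eqv C W h k \<longleftrightarrow> eqv C E (w\<^sub>1 \<cdot> h) (w\<^sub>1 \<cdot> k) \<and> eqv C A (w\<^sub>2 \<cdot> h) (w\<^sub>2 \<cdot> k)"
    and W_univ: "\<And>a b. \<lbrakk>a \<in> Arr C; b \<in> Arr C; Cod C a = fst E; Cod C b = fst A; eqv C T ((\<pi> \<cdot> \<epsilon>) \<cdot> a) (p \<cdot> b)\<rbrakk> \<Longrightarrow>
      \<exists>h. h \<in> Arr C \<and> Dom C h = Dom C b \<and> Cod C h = fst W \<and> w\<^sub>1 \<cdot> h = a \<and> w\<^sub>2 \<cdot> h = b"
    by (rule hex_pullback[OF E(1) obs(1) obs(3) \<pi>\<epsilon> p]) (rule that; assumption)
  note ty = hex_mapsD[OF W(2)] hex_mapsD[OF W(3)] hex_mapsD[OF p] hex_mapsD[OF q]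
  \<comment> \<open>\<open>W\<close> commutes over \<open>T\<close> only up to equivalence. This is
    exactly the datum of an element of \<open>Dom C \<alpha>\<close> with base point
    \<open>\<pi> \<cdot> (\<epsilon> \<cdot> w\<^sub>1)\<close> and underlying element
    \<open>w\<^sub>2\<close>.\<close>
  obtain j where j: "j \<in> Arr C" "Dom C j = fst W" "Cod C j = Dom C \<alpha>" "\<chi> \<cdot> j = w\<^sub>2" "\<alpha> \<cdot> j = \<pi> \<cdot> (\<epsilon> \<cdot> w\<^sub>1)"
    using fibre_element[of w\<^sub>2 "\<pi> \<cdot> (\<epsilon> \<cdot> w\<^sub>1)"] eqv_sym[OF obs(3) W_comm] ty E \<pi> by auto
  have fits_j: "fits (\<epsilon> \<cdot> w\<^sub>1) j" unfolding fits_def using j ty E by simp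
  interpret exponential_object C A B T p q \<alpha> \<chi> \<pi> app E W \<epsilon> w\<^sub>1 w\<^sub>2 j
    by unfold_locales (fact E E_eqv E_lift W W_eqv W_univ fits_j j)+
  let ?ev = "app (\<epsilon> \<cdot> w\<^sub>1) j"
  show ?thesis
  proof (rule exI, rule exI, rule exI, rule exI, intro conjI allI impI)
    show "Cod (Hex C) (hex_class C E T (\<pi> \<cdot> \<epsilon>)) = T" by simp
    show "is_pullback (Hex C) (hex_class C E T (\<pi> \<cdot> \<epsilon>)) P (hex_class C W E w\<^sub>1) (hex_class C W A w\<^sub>2)"
      unfolding P_def by (rule pbW)
    show "hex_class C W B ?ev \<in> Hom (Hex C) (Dom (Hex C) (hex_class C W E w\<^sub>1)) B"
      using eval_map by (simp add: Hom_def)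
    show "Q \<cdot>\<^bsub>Hex C\<^esub> hex_class C W B ?ev = P \<cdot>\<^bsub>Hex C\<^esub> hex_class C W A w\<^sub>2"
      unfolding P_def Q_def using eval_over eval_map p q W by (simp add: hex_class_eq)
    fix z' assume "z' \<in> Arr (Hex C) \<and> Cod (Hex C) z' = T"
    then have arr_z': "z' \<in> Arr (Hex C)" and cod_z': "Cod (Hex C) z' = T" by blast+
    define Z where "Z = Dom (Hex C) z'"
    obtain z where z: "Z \<in> Obj (Hex C)" "z \<in> hex_maps C Z T" and z': "z' = hex_class C Z T z"
      by (rule Hex_arrE[OF arr_z' Z_def[symmetric] cod_z'])
    obtain V v\<^sub>1 v\<^sub>2 where V: "V \<in> Obj (Hex C)" "v\<^sub>1 \<in> hex_maps C V Z" "v\<^sub>2 \<in> hex_maps C V A"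
      and pbV: "is_pullback (Hex C) (hex_class C Z T z) (hex_class C A T p) (hex_class C V Z v\<^sub>1) (hex_class C V A v\<^sub>2)"
      and V_comm: "eqv C T (z \<cdot> v\<^sub>1) (p \<cdot> v\<^sub>2)"
      and V_eqv: "\<And>h k. \<lbrakk>h \<in> Arr C; k \<in> Arr C; Cod C h = fst V; Cod C k = fst V; Dom C h = Dom C k\<rbrakk> \<Longrightarrow>
        eqv C V h k \<longleftrightarrow> eqv C Z (v\<^sub>1 \<cdot> h) (v\<^sub>1 \<cdot> k) \<and> eqv C A (v\<^sub>2 \<cdot> h) (v\<^sub>2 \<cdot> k)"
      and V_univ: "\<And>a b. \<lbrakk>a \<in> Arr C; b \<in> Arr C; Cod C a = fst Z; Cod C b = fst A; eqv C T (z \<cdot> a) (p \<cdot> b)\<rbrakk> \<Longrightarrow>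
        \<exists>h. h \<in> Arr C \<and> Dom C h = Dom C b \<and> Cod C h = fst V \<and> v\<^sub>1 \<cdot> h = a \<and> v\<^sub>2 \<cdot> h = b"
      by (rule hex_pullback[OF z(1) obs(1) obs(3) z(2) p]) (rule that; assumption)
    show "\<exists>v\<^sub>1 v\<^sub>2. is_pullback (Hex C) z' P v\<^sub>1 v\<^sub>2 \<and>
      (\<forall>f \<in> Hom (Hex C) (Dom (Hex C) v\<^sub>1) B. Q \<cdot>\<^bsub>Hex C\<^esub> f = P \<cdot>\<^bsub>Hex C\<^esub> v\<^sub>2 \<longrightarrow>
        (\<exists>!n. n \<in> Hom (Hex C) (Dom (Hex C) z') (Dom (Hex C) (hex_class C E T (\<pi> \<cdot> \<epsilon>))) \<and>
          hex_class C E T (\<pi> \<cdot> \<epsilon>) \<cdot>\<^bsub>Hex C\<^esub> n = z' \<and>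
          (\<exists>k \<in> Hom (Hex C) (Dom (Hex C) v\<^sub>1) (Dom (Hex C) (hex_class C W E w\<^sub>1)).
            hex_class C W E w\<^sub>1 \<cdot>\<^bsub>Hex C\<^esub> k = n \<cdot>\<^bsub>Hex C\<^esub> v\<^sub>1 \<and> hex_class C W A w\<^sub>2 \<cdot>\<^bsub>Hex C\<^esub> k = v\<^sub>2 \<and>
            hex_class C W B ?ev \<cdot>\<^bsub>Hex C\<^esub> k = f)))"
    proof (intro exI conjI ballI impI)
      show "is_pullback (Hex C) z' P (hex_class C V Z v\<^sub>1) (hex_class C V A v\<^sub>2)"
        unfolding P_def z' by (rule pbV)
      fix f' assume "f' \<in> Hom (Hex C) (Dom (Hex C) (hex_class C V Z v\<^sub>1)) B"
        and f'_over: "Q \<cdot>\<^bsub>Hex C\<^esub> f' = P \<cdot>\<^bsub>Hex C\<^esub> hex_class C V A v\<^sub>2"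
      then obtain f where f: "f \<in> hex_maps C V B" and f': "f' = hex_class C V B f"
        by (auto simp: Hom_def elim: Hex_arrE)
      have f_over: "eqv C T (q \<cdot> f) (p \<cdot> v\<^sub>2)"
        using f'_over f p q V unfolding P_def Q_def f' by (simp add: hex_class_eq)
      interpret exponential_test C A B T p q \<alpha> \<chi> \<pi> app E W \<epsilon> w\<^sub>1 w\<^sub>2 j Z V z v\<^sub>1 v\<^sub>2 f
        by unfold_locales (fact z V V_comm V_eqv V_univ f f_over)+
      \<comment> \<open>The universal property read on representatives, with each equation of
        \<open>Hex C\<close> turned into an equivalence. Uniqueness is wanted for the class of
        \<open>n\<close> alone, so \<open>k\<close> is bound existentially.\<close>
      let ?R = "\<lambda>n k. n \<in> hex_maps C Z E \<and> eqv C T ((\<pi> \<cdot> \<epsilon>) \<cdot> n) z \<and> k \<in> hex_maps C V W \<and>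
        eqv C E (w\<^sub>1 \<cdot> k) (n \<cdot> v\<^sub>1) \<and> eqv C A (w\<^sub>2 \<cdot> k) v\<^sub>2 \<and> eqv C B (?ev \<cdot> k) f"
      have conv: "(N \<in> Hom (Hex C) (Dom (Hex C) z') (Dom (Hex C) (hex_class C E T (\<pi> \<cdot> \<epsilon>))) \<and>
          hex_class C E T (\<pi> \<cdot> \<epsilon>) \<cdot>\<^bsub>Hex C\<^esub> N = z' \<and>
          (\<exists>K \<in> Hom (Hex C) (Dom (Hex C) (hex_class C V Z v\<^sub>1)) (Dom (Hex C) (hex_class C W E w\<^sub>1)).
            hex_class C W E w\<^sub>1 \<cdot>\<^bsub>Hex C\<^esub> K = N \<cdot>\<^bsub>Hex C\<^esub> hex_class C V Z v\<^sub>1 \<and>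
            hex_class C W A w\<^sub>2 \<cdot>\<^bsub>Hex C\<^esub> K = hex_class C V A v\<^sub>2 \<and> hex_class C W B ?ev \<cdot>\<^bsub>Hex C\<^esub> K = f')) \<longleftrightarrow>
          (\<exists>n k. N = hex_class C Z E n \<and> ?R n k)" (is "?L \<longleftrightarrow> _") for N
      proof
        assume L: ?L
        then obtain n where n: "n \<in> hex_maps C Z E" "N = hex_class C Z E n"
          unfolding z' by (auto simp: Hom_def elim: Hex_arrE)
        from L obtain K where K: "K \<in> Hom (Hex C) V W"
          "hex_class C W E w\<^sub>1 \<cdot>\<^bsub>Hex C\<^esub> K = N \<cdot>\<^bsub>Hex C\<^esub> hex_class C V Z v\<^sub>1"
          "hex_class C W A w\<^sub>2 \<cdot>\<^bsub>Hex C\<^esub> K = hex_class C V A v\<^sub>2" "hex_class C W B ?ev \<cdot>\<^bsub>Hex C\<^esub> K = f'" by auto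
        then obtain k where k: "k \<in> hex_maps C V W" "K = hex_class C V W k" by (auto simp: Hom_def elim: Hex_arrE)
        have "?R n k" using L K(2-4) n k z V W E(1) f eval_map \<pi>\<epsilon> unfolding z' f' by (simp add: hex_class_eq)
        then show "\<exists>n k. N = hex_class C Z E n \<and> ?R n k" using n(2) by blast
      next
        assume "\<exists>n k. N = hex_class C Z E n \<and> ?R n k"
        then obtain n k where nk: "N = hex_class C Z E n" "?R n k" by blast
        then have n: "n \<in> hex_maps C Z E" "k \<in> hex_maps C V W" by blast+
        show ?L
          using nk(2) n z V W E(1) f eval_map \<pi>\<epsilon> unfolding z' f' nk(1)
          by (intro conjI bexI[of _ "hex_class C V W k"]) (simp_all add: hex_class_eq Hom_def)
      qed
      obtain n k where nk: "n \<in> hex_maps C Z E" "(\<pi> \<cdot> \<epsilon>) \<cdot> n = z" "k \<in> hex_maps C V W"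
        "w\<^sub>1 \<cdot> k = n \<cdot> v\<^sub>1" "w\<^sub>2 \<cdot> k = v\<^sub>2" "eqv C B (?ev \<cdot> k) f"
        by (rule transpose_exists)
      have "?R n k"
      proof (intro conjI nk(1,3,6))
        show "eqv C T ((\<pi> \<cdot> \<epsilon>) \<cdot> n) z" unfolding nk(2) by (rule eqv_refl[OF obs(3)]) (use hex_mapsD[OF z] in simp_all)
        show "eqv C E (w\<^sub>1 \<cdot> k) (n \<cdot> v\<^sub>1)" unfolding nk(4)
          by (rule eqv_refl[OF E(1)]) (use hex_mapsD[OF nk(1)] hex_mapsD[OF V(2)] in simp_all)
        show "eqv C A (w\<^sub>2 \<cdot> k) v\<^sub>2" unfolding nk(5) by (rule eqv_refl[OF obs(1)]) (use hex_mapsD[OF V(3)] in simp_all)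
      qed
      moreover have "hex_class C Z E n = hex_class C Z E n'" if "?R n k" "?R n' k'" for n n' k k'
      proof -
        have "eqv C E n n'" using that by (elim conjE) (rule transpose_unique; assumption)
        then show ?thesis using that z E(1) by (simp add: hex_class_eq)
      qed
      ultimately show "\<exists>!N. N \<in> Hom (Hex C) (Dom (Hex C) z') (Dom (Hex C) (hex_class C E T (\<pi> \<cdot> \<epsilon>))) \<and>
          hex_class C E T (\<pi> \<cdot> \<epsilon>) \<cdot>\<^bsub>Hex C\<^esub> N = z' \<and>
          (\<exists>K \<in> Hom (Hex C) (Dom (Hex C) (hex_class C V Z v\<^sub>1)) (Dom (Hex C) (hex_class C W E w\<^sub>1)).
            hex_class C W E w\<^sub>1 \<cdot>\<^bsub>Hex C\<^esub> K = N \<cdot>\<^bsub>Hex C\<^esub> hex_class C V Z v\<^sub>1 \<and>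
            hex_class C W A w\<^sub>2 \<cdot>\<^bsub>Hex C\<^esub> K = hex_class C V A v\<^sub>2 \<and> hex_class C W B ?ev \<cdot>\<^bsub>Hex C\<^esub> K = f')"
        unfolding conv by blast
    qed
  qed
qed

end

section \<open>The function object as a weak Pi-type, and local cartesian closure\<close>

context Pi_path_category
begin

text \<open>Both fibrations come from \<open>weak_fibre_product\<close>: \<open>\<alpha>\<close>
  from \<open>p\<close> and the identity of \<open>T\<close>, and \<open>\<kappa>\<close> from
  \<open>q\<close> and \<open>\<alpha>\<close>, so that over an argument based at i it has the fibre
  {b | q b ~ i}. The functions form the weak Pi-type of \<open>\<kappa>\<close> along
  \<open>\<alpha>\<close>; \<open>app\<close> evaluates and then projects to \<open>B\<close> by
  \<open>y\<close>.\<close>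

lemma exponential_data_exists:
  assumes ob: "A \<in> Obj (Hex C)" "B \<in> Obj (Hex C)" "T \<in> Obj (Hex C)"
    and p: "p \<in> hex_maps C A T" and q: "q \<in> hex_maps C B T"
  shows "\<exists>\<alpha> \<chi> \<pi> app. exponential_data C A B T p q \<alpha> \<chi> \<pi> app"
proof -
  note pD = hex_mapsD[OF p] and qD = hex_mapsD[OF q]
  have idT: "Ident C (fst T) \<in> Arr C" "Cod C (Ident C (fst T)) = fst T" using ob(3) by simp_all
  obtain \<chi> \<alpha> where \<chi>\<alpha>: "\<chi> \<in> Arr C" "\<alpha> \<in> Fib C" "Dom C \<chi> = Dom C \<alpha>" "Cod C \<chi> = Dom C p" "Cod C \<alpha> = Dom C (Ident C (fst T))"
    "eqv C T (p \<cdot> \<chi>) (Ident C (fst T) \<cdot> \<alpha>)"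
    and J: "\<And>a b. \<lbrakk>a \<in> Arr C; b \<in> Arr C; Cod C a = Dom C p; Cod C b = Dom C (Ident C (fst T)); eqv C T (p \<cdot> a) (Ident C (fst T) \<cdot> b)\<rbrakk> \<Longrightarrow>
      \<exists>h. h \<in> Arr C \<and> Dom C h = Dom C b \<and> Cod C h = Dom C \<alpha> \<and> \<chi> \<cdot> h = a \<and> \<alpha> \<cdot> h = b"
    by (rule weak_fibre_product[OF ob(3) pD(1) idT(1) pD(3) idT(2)]) (rule that; assumption)
  have \<alpha>: "\<alpha> \<in> Arr C" "Cod C \<alpha> = fst T" using \<chi>\<alpha> ob(3) by simp_all
  obtain y \<kappa> where y\<kappa>: "y \<in> Arr C" "\<kappa> \<in> Fib C" "Dom C y = Dom C \<kappa>" "Cod C y = Dom C q" "Cod C \<kappa> = Dom C \<alpha>"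
    "eqv C T (q \<cdot> y) (\<alpha> \<cdot> \<kappa>)"
    and K: "\<And>a b. \<lbrakk>a \<in> Arr C; b \<in> Arr C; Cod C a = Dom C q; Cod C b = Dom C \<alpha>; eqv C T (q \<cdot> a) (\<alpha> \<cdot> b)\<rbrakk> \<Longrightarrow>
      \<exists>h. h \<in> Arr C \<and> Dom C h = Dom C b \<and> Cod C h = Dom C \<kappa> \<and> y \<cdot> h = a \<and> \<kappa> \<cdot> h = b"
    by (rule weak_fibre_product[OF ob(3) qD(1) \<alpha>(1) qD(3) \<alpha>(2)]) (rule that; assumption)
  obtain \<pi> a b ev where \<pi>: "\<pi> \<in> Fib C" "Cod C \<pi> = Cod C \<alpha>" and pb: "is_pullback C \<alpha> \<pi> a b"
    and ev: "ev \<in> Arr C" "Dom C ev = Dom C a" "Cod C ev = Dom C \<kappa>" "\<kappa> \<cdot> ev = a"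
    and univ: "\<And>g a' b' m. \<lbrakk>is_pullback C \<alpha> g a' b'; m \<in> Arr C; Dom C m = Dom C a'; Cod C m = Dom C \<kappa>; \<kappa> \<cdot> m = a'\<rbrakk> \<Longrightarrow>
      \<exists>n k. n \<in> Arr C \<and> Dom C n = Dom C g \<and> Cod C n = Dom C \<pi> \<and> \<pi> \<cdot> n = g \<and>
        k \<in> Arr C \<and> Dom C k = Dom C a' \<and> Cod C k = Dom C a \<and> a \<cdot> k = a' \<and> b \<cdot> k = n \<cdot> b' \<and>
        fibrewise_homotopic C \<kappa> m (ev \<cdot> k)"
    by (rule weak_Pi[OF y\<kappa>(2) \<chi>\<alpha>(2) y\<kappa>(5)]) (rule that; assumption)
  note D = pullbackD[OF pb]
  \<comment> \<open>\<open>SOME\<close> selects the point of the pullback with components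
    \<open>j\<close> and \<open>e\<close>. Where there is one it is unique, which makes
    \<open>app\<close> commute with change of stage; elsewhere the value is arbitrary.\<close>
  define app where "app e j = y \<cdot> (ev \<cdot> (SOME h. h \<in> Arr C \<and> Dom C h = Dom C j \<and> Cod C h = Dom C a \<and> a \<cdot> h = j \<and> b \<cdot> h = e))"
    for e j
  have app: "app e j = y \<cdot> (ev \<cdot> h)"
    if h: "h \<in> Arr C" "Dom C h = Dom C j" "Cod C h = Dom C a" "a \<cdot> h = j" "b \<cdot> h = e" for e j h
  proof -
    let ?P = "\<lambda>h. h \<in> Arr C \<and> Dom C h = Dom C j \<and> Cod C h = Dom C a \<and> a \<cdot> h = j \<and> b \<cdot> h = e"
    have "?P (SOME h. ?P h)" using h by (intro someI[of ?P h]) blast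
    then have "(SOME h. ?P h) = h" by (intro pullback_eq[OF pb, of "SOME h. ?P h" h]) (use h in simp_all)
    then show ?thesis unfolding app_def by simp
  qed
  have "exponential_data C A B T p q \<alpha> \<chi> \<pi> app"
  proof unfold_locales
    show "eqv C T (p \<cdot> \<chi>) \<alpha>" using \<chi>\<alpha>(6) \<alpha> by simp
    show "Cod C \<pi> = fst T" "Cod C \<chi> = fst A" using \<pi> \<alpha> \<chi>\<alpha> pD by simp_all
    show "\<exists>j. j \<in> Arr C \<and> Dom C j = Dom C b \<and> Cod C j = Dom C \<alpha> \<and> \<chi> \<cdot> j = a \<and> \<alpha> \<cdot> j = b"
      if "a \<in> Arr C" "b \<in> Arr C" "Cod C a = fst A" "Cod C b = fst T" "eqv C T (p \<cdot> a) b" for a b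
      using J[of a b] that pD ob(3) by simp
    show "app e j \<in> Arr C \<and> Dom C (app e j) = Dom C j \<and> Cod C (app e j) = fst B \<and> eqv C T (q \<cdot> app e j) (\<alpha> \<cdot> j) \<and>
      (\<forall>u \<in> Arr C. Cod C u = Dom C j \<longrightarrow> app (e \<cdot> u) (j \<cdot> u) = app e j \<cdot> u)"
      if ej: "e \<in> Arr C" "j \<in> Arr C" "Dom C e = Dom C j" "Cod C e = Dom C \<pi>" "Cod C j = Dom C \<alpha>" "\<pi> \<cdot> e = \<alpha> \<cdot> j" for e j
    proof -
      obtain h where h: "h \<in> Arr C" "Dom C h = Dom C j" "Cod C h = Dom C a" "a \<cdot> h = j" "b \<cdot> h = e"
        by (rule pullback_pair[OF pb ej(2,1) ej(3)[symmetric] ej(5,4) ej(6)[symmetric]])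
      have evh: "ev \<cdot> h \<in> Arr C" "Dom C (ev \<cdot> h) = Dom C j" "Cod C (ev \<cdot> h) = Dom C \<kappa>" "\<kappa> \<cdot> (ev \<cdot> h) = j"
        using h ev y\<kappa> by (simp_all add: rewrite_tail1[OF ev(4)])
      have "eqv C T ((q \<cdot> y) \<cdot> (ev \<cdot> h)) ((\<alpha> \<cdot> \<kappa>) \<cdot> (ev \<cdot> h))"
        by (rule eqv_comp[OF ob(3) y\<kappa>(6) evh(1)]) (use evh y\<kappa> \<alpha> in simp)
      then have "eqv C T (q \<cdot> app e j) (\<alpha> \<cdot> j)" unfolding app[OF h] using evh y\<kappa>(1-5) \<alpha> qD by simp
      moreover have "app (e \<cdot> u) (j \<cdot> u) = app e j \<cdot> u" if u: "u \<in> Arr C" "Cod C u = Dom C j" for u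
      proof -
        have "app (e \<cdot> u) (j \<cdot> u) = y \<cdot> (ev \<cdot> (h \<cdot> u))"
          by (rule app) (use h(1-3) u ej D in \<open>simp_all add: rewrite_tail1[OF h(4)] rewrite_tail1[OF h(5)]\<close>)
        then show ?thesis unfolding app[OF h] using h(1-3) ev y\<kappa> u by simp
      qed
      ultimately show ?thesis unfolding app[OF h] using evh y\<kappa> qD by simp
    qed
    show "\<exists>n \<in> Arr C. Dom C n = Dom C g \<and> Cod C n = Dom C \<pi> \<and> \<pi> \<cdot> n = g \<and> eqv C B m (app (n \<cdot> b') a')"
      if pb': "is_pullback C \<alpha> g a' b'" and m: "m \<in> Arr C" "Dom C m = Dom C a'" "Cod C m = fst B"
        "eqv C T (q \<cdot> m) (\<alpha> \<cdot> a')" for g a' b' m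
    proof -
      note D' = pullbackD[OF pb']
      \<comment> \<open>\<open>m\<close> lands in \<open>B\<close> rather than in the domain of
        \<open>\<kappa>\<close>; the equivalence of \<open>q \<cdot> m\<close> and
        \<open>\<alpha> \<cdot> a'\<close> is the witness that lifts it there.\<close>
      obtain l where l: "l \<in> Arr C" "Dom C l = Dom C a'" "Cod C l = Dom C \<kappa>" "y \<cdot> l = m" "\<kappa> \<cdot> l = a'"
        using K[OF m(1) D'(3) _ D'(6) m(4)] m qD by auto
      obtain n k where n: "n \<in> Arr C" "Dom C n = Dom C g" "Cod C n = Dom C \<pi>" "\<pi> \<cdot> n = g"
        and k: "k \<in> Arr C" "Dom C k = Dom C a'" "Cod C k = Dom C a" "a \<cdot> k = a'" "b \<cdot> k = n \<cdot> b'"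
        and fh: "fibrewise_homotopic C \<kappa> l (ev \<cdot> k)"
        using univ[OF pb' l(1-3,5)] by blast
      \<comment> \<open>The weak Pi-type makes \<open>l\<close> and \<open>ev \<cdot> k\<close> only
        fibrewise homotopic over \<open>Dom C \<alpha>\<close>. Reflexivity of the relation of
        \<open>B\<close> at \<open>y\<close> lets \<open>fibrewise_homotopic_lifts\<close> turn this
        into an equivalence in \<open>B\<close> after composing with \<open>y\<close>.\<close>
      have "eqv C B y y" by (rule eqv_refl[OF ob(2)]) (use y\<kappa> qD in simp_all)
      then have "lifts C (snd B) (pairing C y y)" by (simp add: eqv_def)
      from fibrewise_homotopic_lifts[OF fh y\<kappa>(1,3) Hex_obj_fib(1)[OF ob(2)] _ this]
      have "lifts C (snd B) (pairing C (y \<cdot> l) (y \<cdot> (ev \<cdot> k)))" using Hex_obj_fib(2)[OF ob(2)] y\<kappa> qD by simp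
      then have "eqv C B m (y \<cdot> (ev \<cdot> k))" unfolding eqv_def l(4) using m k ev y\<kappa> qD by simp
      then show ?thesis using n app[OF k] by auto
    qed
  qed (use ob p q \<chi>\<alpha> \<pi> \<alpha> in simp_all)
  then show ?thesis by blast
qed

theorem Hex_locally_cartesian_closed: "locally_cartesian_closed (Hex C)"
proof -
  interpret H: category "Hex C" by (rule Hex_category)
  obtain T where T: "terminal (Hex C) T" using Hex_terminal by blast
  show ?thesis
  proof (rule H.locally_cartesian_closedI[OF T])
    show "\<forall>F \<in> Arr (Hex C). \<forall>G \<in> Arr (Hex C). Cod (Hex C) F = Cod (Hex C) G \<longrightarrow> (\<exists>p q. is_pullback (Hex C) F G p q)"
    proof (intro ballI impI)
      fix F G assume FG: "F \<in> Arr (Hex C)" "G \<in> Arr (Hex C)" "Cod (Hex C) F = Cod (Hex C) G"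
      obtain f where f: "f \<in> hex_maps C (Dom (Hex C) F) (Cod (Hex C) G)"
        "F = hex_class C (Dom (Hex C) F) (Cod (Hex C) G) f" "Dom (Hex C) F \<in> Obj (Hex C)" "Cod (Hex C) G \<in> Obj (Hex C)"
        by (rule Hex_arrE[OF FG(1) refl FG(3)])
      obtain g where g: "g \<in> hex_maps C (Dom (Hex C) G) (Cod (Hex C) G)"
        "G = hex_class C (Dom (Hex C) G) (Cod (Hex C) G) g" "Dom (Hex C) G \<in> Obj (Hex C)"
        by (rule Hex_arrE[OF FG(2) refl refl])
      show "\<exists>p q. is_pullback (Hex C) F G p q"
        using hex_pullback[OF f(3) g(3) f(4) f(1) g(1)] f(2) g(2) by metis
    qed
    fix P Q assume PQ: "P \<in> Arr (Hex C)" "Q \<in> Arr (Hex C)" "Cod (Hex C) P = Cod (Hex C) Q"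
    define A B T where "A = Dom (Hex C) P" and "B = Dom (Hex C) Q" and "T = Cod (Hex C) Q"
    obtain p where p: "p \<in> hex_maps C A T" "P = hex_class C A T p" "A \<in> Obj (Hex C)" "T \<in> Obj (Hex C)"
      by (rule Hex_arrE[OF PQ(1) A_def[symmetric] PQ(3)[folded T_def]])
    obtain q where q: "q \<in> hex_maps C B T" "Q = hex_class C B T q" "B \<in> Obj (Hex C)"
      by (rule Hex_arrE[OF PQ(2) B_def[symmetric] T_def[symmetric]])
    note P = p(2) and Q = q(2)
    obtain \<alpha> \<chi> \<pi> app where "exponential_data C A B T p q \<alpha> \<chi> \<pi> app"
      using exponential_data_exists[OF p(3) q(3) p(4) p(1) q(1)] by blast
    then interpret exponential_data C A B T p q \<alpha> \<chi> \<pi> app .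
    show "\<exists>e w\<^sub>1 w\<^sub>2 ev. Cod (Hex C) e = Cod (Hex C) Q \<and> is_pullback (Hex C) e P w\<^sub>1 w\<^sub>2 \<and>
        ev \<in> Hom (Hex C) (Dom (Hex C) w\<^sub>1) (Dom (Hex C) Q) \<and> Q \<cdot>\<^bsub>Hex C\<^esub> ev = P \<cdot>\<^bsub>Hex C\<^esub> w\<^sub>2 \<and>
        (\<forall>z. z \<in> Arr (Hex C) \<and> Cod (Hex C) z = Cod (Hex C) Q \<longrightarrow> (\<exists>v\<^sub>1 v\<^sub>2. is_pullback (Hex C) z P v\<^sub>1 v\<^sub>2 \<and>
          (\<forall>f \<in> Hom (Hex C) (Dom (Hex C) v\<^sub>1) (Dom (Hex C) Q). Q \<cdot>\<^bsub>Hex C\<^esub> f = P \<cdot>\<^bsub>Hex C\<^esub> v\<^sub>2 \<longrightarrow>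
            (\<exists>!n. n \<in> Hom (Hex C) (Dom (Hex C) z) (Dom (Hex C) e) \<and> e \<cdot>\<^bsub>Hex C\<^esub> n = z \<and>
              (\<exists>k \<in> Hom (Hex C) (Dom (Hex C) v\<^sub>1) (Dom (Hex C) w\<^sub>1).
                w\<^sub>1 \<cdot>\<^bsub>Hex C\<^esub> k = n \<cdot>\<^bsub>Hex C\<^esub> v\<^sub>1 \<and> w\<^sub>2 \<cdot>\<^bsub>Hex C\<^esub> k = v\<^sub>2 \<and> ev \<cdot>\<^bsub>Hex C\<^esub> k = f)))))"
      unfolding B_def[symmetric] T_def[symmetric] P Q Hex_simps(5,6)
      by (rule slice_exponential_data[OF weak_Pi_types])
  qed
qed

end

theorem theorem5p10:
  fixes C :: "('o, 'm, 'z) fcat_scheme"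
  assumes "path_category C"
    and "weak_homotopy_Pi_types C"
  shows "locally_cartesian_closed (Hex C)"
proof -
  interpret Pi_path_category C
    using assms by (simp add: Pi_path_category_def Pi_path_category_axioms_def)
  show ?thesis by (rule Hex_locally_cartesian_closed)
qed

end
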